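(* Let $w\in W^P$ be such that the Schubert variety $X_w$ in $G/P=\mathrm{Gr}(d,n)$ is toric. For $v\in W^P$ with $v\le w$, the maximal cone $C_v$ corresponding to $v$ in the fan of the toric variety $X_w$ is $$C_v=\bigcup_{u\in[v]} C_u^B,$$ where $[v]:=\{u\in\mathfrak{S}_n \mid u\le w,\ uW_P=vW_P\}$.
   Context: $G=\mathrm{SL}_n(\mathbb{C})$, $B$ is the Borel subgroup of upper triangular matrices, $T\subset B$ is the maximal torus of diagonal matrices, $1\le d\le n-1$, $P=P_d\supset B$ is the maximal parabolic subgroup with $G/P\cong \mathrm{Gr}(d,n)$. The Weyl group is $\mathfrak{S}_n$ with simple reflections $s_i=(i\ i+1)$, $W_P=\langle s_i\mid i\neq d\rangle$, and $W^P=\{w\in\mathfrak{S}_n \mid w(1)<\cdots<w(d),\ w(d+1)<\cdots<w(n)\}$. The order $\le$ is the Bruhat order. For $w\in W^P$, $X_w=\overline{BwP/P}\subset G/P$ and $X_w^B=\overline{BwB/B}\subset G/B$; a Schubert variety is toric if it is a toric variety for the left action of $T$ (normal with a dense $T$-orbit; the action need not be effective). The $T$-fixed points of $X_w$ are $vP$ for $v\in W^P$, $v\le w$, and those of $X_w^B$ are $uB$ for $u\in\mathfrak{S}_n$, $u\le w$. If $X_w$ is toric ($w\in W^P$), then $w$ is a product of distinct simple reflections and $X_w^B$ is also toric. The projection $\pi:G/B\to G/P$ restricts to a $T$-equivariant birational toric morphism $X_w^B\to X_w$, which identifies the dense tori of $X_w^B$ and $X_w$; the fans of $X_w^B$ and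 $X_w$ are thereby regarded as fans in the same real vector space $N\otimes\mathbb{R}\cong\mathbb{R}^{\ell(w)}$, where $N$ is the lattice of one-parameter subgroups of the dense torus. $C_u^B$ denotes the maximal cone of the fan of $X_w^B$ corresponding to the fixed point $uB$, and $C_v$ the maximal cone of the fan of $X_w$ corresponding to the fixed point $vP$. Known explicit description of the cones $C_u^B$ (up to isomorphism of fans): if $w=s_{i_1}\cdots s_{i_m}$ is a reduced decomposition with $i_1,\dots,i_m$ distinct, put $\mathbf{v}_k=\mathbf{e}_k$ (standard basis of $\mathbb{R}^m$) and $\mathbf{w}_k=-\mathbf{e}_k-\sum_{j>k}c_{i_j,i_k}\mathbf{e}_j$, where $c_{i,j}=2$ if $i=j$, $-1$ if $|i-j|=1$, and $0$ otherwise. For $\mathscr{J}=\{j_1<\cdots<j_k\}\subseteq\{1,\dots,m\}$ and $u=s_{i_{j_1}}\cdots s_{i_{j_k}}$, one has $C_u^B=\mathrm{Cone}(\{\mathbf{v}_i\mid i\notin\mathscr{J}\}\cup\{\mathbf{w}_i\mid i\in\mathscr{J}\})$. *)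

theory Defs
  imports
    "HOL-Analysis.Function_Topology"
    "HOL-Algebra.Sym_Groups"
    "HOL-Algebra.Generated_Groups"
    "Jordan_Normal_Form.Determinant"
begin

text \<open>
  Varieties are treated classically: a variety is a set of closed points together with its Zariski
  topology and its sheaf of complex-valued regular functions.
\<close>


section \<open>Zariski topology and regular functions\<close>

inductive_set poly_funs :: "('a \<Rightarrow> complex) set \<Rightarrow> ('a \<Rightarrow> complex) set"
  for C :: "('a \<Rightarrow> complex) set" where
  coord: "x \<in> C \<Longrightarrow> x \<in> poly_funs C"
| const: "(\<lambda>_. c) \<in> poly_funs C"
| add: "p \<in> poly_funs C \<Longrightarrow> q \<in> poly_funs C \<Longrightarrow> (\<lambda>x. p x + q x) \<in> poly_funs C"
| mult: "p \<in> poly_funs C \<Longrightarrow> q \<in> poly_funs C \<Longrightarrow> (\<lambda>x. p x * q x) \<in> poly_funs C"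

definition mat_coords :: "nat \<Rightarrow> (complex mat \<Rightarrow> complex) set" where
  "mat_coords n = {(\<lambda>A. A $$ (i, j)) | i j. i < n \<and> j < n}"

definition vec_coords :: "nat \<Rightarrow> (complex vec \<Rightarrow> complex) set" where
  "vec_coords k = {(\<lambda>x. x $ i) | i. i < k}"

definition zariski :: "('a \<Rightarrow> complex) set \<Rightarrow> 'a set \<Rightarrow> 'a topology" where
  "zariski C S = subtopology (topology_generated_by {{x. f x \<noteq> 0} | f. f \<in> poly_funs C}) S"

text \<open>
  Locally a quotient of polynomial functions.  The principal open sets form a basis, so it is enough
  to ask that, near each point \<open>x\<close>, \<open>f = p / q\<close> wherever \<open>q\<close> does not vanish.
\<close>
definition regular_on :: "('a \<Rightarrow> complex) set \<Rightarrow> 'a set \<Rightarrow> ('a \<Rightarrow> complex) \<Rightarrow> bool" where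
  "regular_on C V f \<longleftrightarrow>
     (\<forall>x\<in>V. \<exists>p\<in>poly_funs C. \<exists>q\<in>poly_funs C. q x \<noteq> 0 \<and> (\<forall>y\<in>V. q y \<noteq> 0 \<longrightarrow> f y = p y / q y))"

definition quotient_topology :: "'a topology \<Rightarrow> ('a \<Rightarrow> 'b) \<Rightarrow> 'b topology" where
  "quotient_topology X f =
     topology (\<lambda>U. U \<subseteq> f ` topspace X \<and> openin X {x \<in> topspace X. f x \<in> U})"

lemma openin_quotient_topology:
  "openin (quotient_topology X f) U \<longleftrightarrow>
     U \<subseteq> f ` topspace X \<and> openin X {x \<in> topspace X. f x \<in> U}"
proof -
  define P where "P U = {x \<in> topspace X. f x \<in> U}" for U
  have Int: "P (S \<inter> T) = P S \<inter> P T" for S T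
    by (auto simp: P_def)
  have Union: "P (\<Union>K) = \<Union>(P ` K)" for K
    by (auto simp: P_def)
  have "istopology (\<lambda>U. U \<subseteq> f ` topspace X \<and> openin X (P U))"
    unfolding istopology_def
  proof (intro conjI allI impI)
    fix S T
    assume S: "S \<subseteq> f ` topspace X \<and> openin X (P S)"
      and T: "T \<subseteq> f ` topspace X \<and> openin X (P T)"
    show "S \<inter> T \<subseteq> f ` topspace X" using S by blast
    show "openin X (P (S \<inter> T))" unfolding Int using S T by (blast intro: openin_Int)
  next
    fix K
    assume K: "\<forall>U\<in>K. U \<subseteq> f ` topspace X \<and> openin X (P U)"
    show "\<Union>K \<subseteq> f ` topspace X" using K by blast
    show "openin X (P (\<Union>K))" unfolding Union using K by (blast intro: openin_Union)
  qed
  then show ?thesis by (simp add: quotient_topology_def P_def)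
qed


section \<open>The special linear group and its homogeneous spaces\<close>

text \<open>
  Matrix indices run over \<open>0..n-1\<close>, whereas the symmetric group acts on \<open>{1..n}\<close>.
\<close>

definition SL :: "nat \<Rightarrow> complex mat monoid" where
  "SL n = \<lparr>carrier = {A \<in> carrier_mat n n. det A = 1}, mult = (*), one = 1\<^sub>m n\<rparr>"

definition torus :: "nat \<Rightarrow> complex mat set" where
  "torus n = {A \<in> carrier (SL n). \<forall>i<n. \<forall>j<n. i \<noteq> j \<longrightarrow> A $$ (i, j) = 0}"

definition borel :: "nat \<Rightarrow> complex mat set" where
  "borel n = {A \<in> carrier (SL n). \<forall>i<n. \<forall>j<i. A $$ (i, j) = 0}"

definition parabolic :: "nat \<Rightarrow> nat \<Rightarrow> complex mat set" where
  "parabolic n d = {A \<in> carrier (SL n). \<forall>i<n. \<forall>j<d. d \<le> i \<longrightarrow> A $$ (i, j) = 0}"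

text \<open>
  The element of \<open>N(T)/T\<close>, as a coset of \<open>T\<close> in \<open>N(T)\<close>, given by the permutation \<open>w\<close>: the monomial
  matrices sending the line of \<open>e\<^sub>j\<close> to the line of \<open>e\<^bsub>w(j)\<^esub>\<close>.
\<close>
definition weyl_coset :: "nat \<Rightarrow> (nat \<Rightarrow> nat) \<Rightarrow> complex mat set" where
  "weyl_coset n w =
     {A \<in> carrier (SL n). \<forall>i<n. \<forall>j<n. A $$ (i, j) \<noteq> 0 \<longleftrightarrow> Suc i = w (Suc j)}"

text \<open>
  Points of \<open>G/Q\<close> are left cosets \<open>g <#\<^bsub>SL n\<^esub> Q\<close>; \<open>G/Q\<close> carries the quotient
  topology, and a function on a locally closed subset of \<open>G/Q\<close> is regular iff its pullback to \<open>G\<close> is.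
\<close>

definition homog_topology :: "nat \<Rightarrow> complex mat set \<Rightarrow> complex mat set topology" where
  "homog_topology n Q =
     quotient_topology (zariski (mat_coords n) (carrier (SL n))) (\<lambda>g. g <#\<^bsub>SL n\<^esub> Q)"

definition homog_regular ::
    "nat \<Rightarrow> complex mat set \<Rightarrow> complex mat set set \<Rightarrow> (complex mat set \<Rightarrow> complex) \<Rightarrow> bool" where
  "homog_regular n Q V f \<longleftrightarrow>
     regular_on (mat_coords n) {g \<in> carrier (SL n). g <#\<^bsub>SL n\<^esub> Q \<in> V} (\<lambda>g. f (g <#\<^bsub>SL n\<^esub> Q))"

text \<open>The point \<open>wQ\<close>, for \<open>Q\<close> containing the torus.\<close>
definition fixed_point :: "nat \<Rightarrow> complex mat set \<Rightarrow> (nat \<Rightarrow> nat) \<Rightarrow> complex mat set" where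
  "fixed_point n Q w = weyl_coset n w <#>\<^bsub>SL n\<^esub> Q"

definition schubert_variety ::
    "nat \<Rightarrow> complex mat set \<Rightarrow> (nat \<Rightarrow> nat) \<Rightarrow> complex mat set set" where
  "schubert_variety n Q w =
     homog_topology n Q closure_of ((\<lambda>b. b <#\<^bsub>SL n\<^esub> fixed_point n Q w) ` borel n)"


section \<open>Toric varieties inside \<open>G/Q\<close>\<close>

text \<open>
  In this section \<open>X\<close> is a closed subset of \<open>G/Q\<close>, stable under the left action of the torus.
\<close>

text \<open>
  The points whose torus orbit is dense in \<open>X\<close>.  As \<open>X\<close> is irreducible whenever there is such a point,
  and orbits are open in their closure, these points form a single orbit.
\<close>
definition dense_orbit :: "nat \<Rightarrow> complex mat set \<Rightarrow> complex mat set set \<Rightarrow> complex mat set set" where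
  "dense_orbit n Q X =
     {x \<in> X. homog_topology n Q closure_of ((\<lambda>t. t <#\<^bsub>SL n\<^esub> x) ` torus n) = X}"

text \<open>
  Normality of an irreducible \<open>X\<close>: a rational function (a regular function on a nonempty open \<open>V\<close>) that is
  integral over the ring of regular functions on an open \<open>U\<close> is itself regular on \<open>U\<close>.
\<close>
definition normal_variety :: "nat \<Rightarrow> complex mat set \<Rightarrow> complex mat set set \<Rightarrow> bool" where
  "normal_variety n Q X \<longleftrightarrow>
     (\<forall>U V f k a.
        openin (subtopology (homog_topology n Q) X) U \<and>
        openin (subtopology (homog_topology n Q) X) V \<and> V \<noteq> {} \<and> V \<subseteq> U \<and>
        homog_regular n Q V f \<and> (\<forall>i<k. homog_regular n Q U (a i)) \<and>
        (\<forall>x\<in>V. f x ^ k + (\<Sum>i<k. a i x * f x ^ i) = 0)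
        \<longrightarrow> (\<exists>g. homog_regular n Q U g \<and> (\<forall>x\<in>V. g x = f x)))"

definition toric :: "nat \<Rightarrow> complex mat set \<Rightarrow> complex mat set set \<Rightarrow> bool" where
  "toric n Q X \<longleftrightarrow> dense_orbit n Q X \<noteq> {} \<and> normal_variety n Q X"

text \<open>\<open>U\<close> is isomorphic, as a space with regular functions, to a closed subset \<open>Y\<close> of an affine space.\<close>
definition affine_variety :: "nat \<Rightarrow> complex mat set \<Rightarrow> complex mat set set \<Rightarrow> bool" where
  "affine_variety n Q U \<longleftrightarrow>
     (\<exists>k Y \<phi>.
        closedin (zariski (vec_coords k) (carrier_vec k)) Y \<and>
        homeomorphic_map (subtopology (homog_topology n Q) U)
          (subtopology (zariski (vec_coords k) (carrier_vec k)) Y) \<phi> \<and>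
        (\<forall>V h. openin (subtopology (homog_topology n Q) U) V \<longrightarrow>
           (homog_regular n Q V (h \<circ> \<phi>) \<longleftrightarrow> regular_on (vec_coords k) (\<phi> ` V) h)))"


subsection \<open>The lattices of the dense torus\<close>

text \<open>Characters of the maximal torus, extended by \<open>0\<close>; they are multiplied pointwise.\<close>
definition characters :: "nat \<Rightarrow> (complex mat \<Rightarrow> complex) set" where
  "characters n =
     {(\<lambda>t. if t \<in> torus n then \<Prod>i<n. t $$ (i, i) powi a i else 0) | a :: nat \<Rightarrow> int. True}"

text \<open>
  The character lattice \<open>M\<close> of the dense torus of \<open>X\<close>.  That torus is the quotient of the maximal torus by
  the stabilizer of the dense orbit, the action not being effective in general.
\<close>
definition char_lattice ::
    "nat \<Rightarrow> complex mat set \<Rightarrow> complex mat set set \<Rightarrow> (complex mat \<Rightarrow> complex) set" where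
  "char_lattice n Q X =
     {\<chi> \<in> characters n. \<forall>t\<in>torus n. (\<forall>x\<in>dense_orbit n Q X. t <#\<^bsub>SL n\<^esub> x = x) \<longrightarrow> \<chi> t = 1}"

text \<open>
  \<open>N \<otimes> \<real>\<close> is \<open>Hom(M, \<real>)\<close>, where \<open>Hom(M, \<int>)\<close> is the lattice \<open>N\<close> of one-parameter subgroups: \<open>\<lambda>\<close> corresponds
  to the map sending \<open>\<chi>\<close> to the exponent \<open>k\<close> in \<open>\<chi>(\<lambda>(z)) = z\<^sup>k\<close>.  Homomorphisms are extended by \<open>0\<close> outside \<open>M\<close>.
  When two varieties have the same \<open>M\<close>, that is, their dense tori are the same quotient of the maximal torus,
  their spaces \<open>N \<otimes> \<real>\<close> coincide.
\<close>
definition N_real :: "('a \<Rightarrow> complex) set \<Rightarrow> (('a \<Rightarrow> complex) \<Rightarrow> real) set" where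
  "N_real M = {\<nu>. (\<forall>\<chi>. \<chi> \<notin> M \<longrightarrow> \<nu> \<chi> = 0) \<and>
     (\<forall>\<chi>\<in>M. \<forall>\<psi>\<in>M. \<nu> (\<lambda>t. \<chi> t * \<psi> t) = \<nu> \<chi> + \<nu> \<psi>)}"

definition N_lattice :: "('a \<Rightarrow> complex) set \<Rightarrow> (('a \<Rightarrow> complex) \<Rightarrow> real) set" where
  "N_lattice M = {\<nu> \<in> N_real M. \<forall>\<chi>\<in>M. \<nu> \<chi> \<in> \<int>}"


subsection \<open>Fans\<close>

definition gen_cone :: "('b \<Rightarrow> real) set \<Rightarrow> ('b \<Rightarrow> real) set" where
  "gen_cone R = {(\<lambda>\<chi>. \<Sum>\<rho>\<in>R. c \<rho> * \<rho> \<chi>) | c. \<forall>\<rho>\<in>R. 0 \<le> c \<rho>}"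

definition strongly_convex_rational_cone ::
    "('a \<Rightarrow> complex) set \<Rightarrow> (('a \<Rightarrow> complex) \<Rightarrow> real) set \<Rightarrow> bool" where
  "strongly_convex_rational_cone M \<sigma> \<longleftrightarrow>
     (\<exists>R. finite R \<and> R \<subseteq> N_lattice M \<and> \<sigma> = gen_cone R) \<and>
     (\<forall>\<nu>\<in>\<sigma>. (\<lambda>\<chi>. - \<nu> \<chi>) \<in> \<sigma> \<longrightarrow> \<nu> = (\<lambda>_. 0))"

definition dual_monoid ::
    "('a \<Rightarrow> complex) set \<Rightarrow> (('a \<Rightarrow> complex) \<Rightarrow> real) set \<Rightarrow> ('a \<Rightarrow> complex) set" where
  "dual_monoid M \<sigma> = {\<chi> \<in> M. \<forall>\<nu>\<in>\<sigma>. 0 \<le> \<nu> \<chi>}"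

text \<open>The supporting hyperplane of a face of a rational cone can be chosen in \<open>M\<close>.\<close>
definition is_face ::
    "('a \<Rightarrow> complex) set \<Rightarrow> (('a \<Rightarrow> complex) \<Rightarrow> real) set \<Rightarrow> (('a \<Rightarrow> complex) \<Rightarrow> real) set \<Rightarrow> bool" where
  "is_face M \<tau> \<sigma> \<longleftrightarrow> (\<exists>\<chi>\<in>dual_monoid M \<sigma>. \<tau> = {\<nu> \<in> \<sigma>. \<nu> \<chi> = 0})"

definition is_fan :: "('a \<Rightarrow> complex) set \<Rightarrow> (('a \<Rightarrow> complex) \<Rightarrow> real) set set \<Rightarrow> bool" where
  "is_fan M \<Sigma> \<longleftrightarrow> finite \<Sigma> \<and>
     (\<forall>\<sigma>\<in>\<Sigma>. strongly_convex_rational_cone M \<sigma>) \<and>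
     (\<forall>\<sigma>\<in>\<Sigma>. \<forall>\<tau>. is_face M \<tau> \<sigma> \<longrightarrow> \<tau> \<in> \<Sigma>) \<and>
     (\<forall>\<sigma>\<in>\<Sigma>. \<forall>\<tau>\<in>\<Sigma>. is_face M (\<sigma> \<inter> \<tau>) \<sigma> \<and> is_face M (\<sigma> \<inter> \<tau>) \<tau>)"


subsection \<open>The fan of a toric variety\<close>

text \<open>
  The semigroup algebra of \<open>S \<subseteq> M\<close>, as an algebra of functions on the dense orbit \<open>D\<close>.  The functions
  \<open>e \<chi>\<close> of weight \<open>\<chi>\<close> on \<open>D\<close> are the scalar multiples of \<open>\<chi>\<close> once \<open>D\<close> is identified with the dense torus by the
  choice of a base point, so no base point needs to be chosen.
\<close>
definition semigroup_algebra ::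
    "nat \<Rightarrow> complex mat set set \<Rightarrow> (complex mat \<Rightarrow> complex) set \<Rightarrow> (complex mat set \<Rightarrow> complex) set" where
  "semigroup_algebra n D S =
     {h. \<exists>F e. finite F \<and> F \<subseteq> S \<and>
        (\<forall>\<chi>\<in>F. \<forall>t\<in>torus n. \<forall>x\<in>D. e \<chi> (t <#\<^bsub>SL n\<^esub> x) = \<chi> t * e \<chi> x) \<and>
        (\<forall>x\<in>D. h x = (\<Sum>\<chi>\<in>F. e \<chi> x))}"

text \<open>
  \<open>U\<close> is the affine toric chart \<open>Spec \<complex>[\<sigma>\<^sup>\<or> \<inter> M]\<close> of \<open>X\<close>: an affine torus-stable open subset whose coordinate
  ring, restricted to the dense orbit, is the semigroup algebra of \<open>\<sigma>\<^sup>\<or> \<inter> M\<close>.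
\<close>
definition toric_chart ::
    "nat \<Rightarrow> complex mat set \<Rightarrow> complex mat set set \<Rightarrow>
      ((complex mat \<Rightarrow> complex) \<Rightarrow> real) set \<Rightarrow> complex mat set set \<Rightarrow> bool" where
  "toric_chart n Q X \<sigma> U \<longleftrightarrow>
     openin (subtopology (homog_topology n Q) X) U \<and>
     dense_orbit n Q X \<subseteq> U \<and>
     (\<forall>t\<in>torus n. \<forall>x\<in>U. t <#\<^bsub>SL n\<^esub> x \<in> U) \<and>
     affine_variety n Q U \<and>
     (\<forall>f. homog_regular n Q U f \<longrightarrow>
        f \<in> semigroup_algebra n (dense_orbit n Q X) (dual_monoid (char_lattice n Q X) \<sigma>)) \<and>
     (\<forall>h\<in>semigroup_algebra n (dense_orbit n Q X) (dual_monoid (char_lattice n Q X) \<sigma>).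
        \<exists>f. homog_regular n Q U f \<and> (\<forall>x\<in>dense_orbit n Q X. f x = h x))"

text \<open>\<open>X\<close> is glued from the charts \<open>Spec \<complex>[\<sigma>\<^sup>\<or> \<inter> M]\<close> as prescribed by the fan \<open>\<Sigma>\<close>.\<close>
definition is_fan_of ::
    "nat \<Rightarrow> complex mat set \<Rightarrow> complex mat set set \<Rightarrow>
      ((complex mat \<Rightarrow> complex) \<Rightarrow> real) set set \<Rightarrow> bool" where
  "is_fan_of n Q X \<Sigma> \<longleftrightarrow>
     is_fan (char_lattice n Q X) \<Sigma> \<and>
     (\<exists>U. (\<forall>\<sigma>\<in>\<Sigma>. toric_chart n Q X \<sigma> (U \<sigma>)) \<and> (\<Union>\<sigma>\<in>\<Sigma>. U \<sigma>) = X \<and>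
        (\<forall>\<sigma>\<in>\<Sigma>. \<forall>\<tau>\<in>\<Sigma>. U \<sigma> \<inter> U \<tau> = U (\<sigma> \<inter> \<tau>)))"

text \<open>
  The maximal cone of the fan corresponding to the torus-fixed point \<open>x\<close>: a fixed point lies in the chart of
  a maximal cone \<open>\<sigma>\<close> iff it is the closed orbit of that chart, hence the orbit corresponding to \<open>\<sigma>\<close>.
\<close>
definition fixed_point_cone ::
    "nat \<Rightarrow> complex mat set \<Rightarrow> complex mat set set \<Rightarrow>
      ((complex mat \<Rightarrow> complex) \<Rightarrow> real) set set \<Rightarrow> complex mat set \<Rightarrow>
      ((complex mat \<Rightarrow> complex) \<Rightarrow> real) set" where
  "fixed_point_cone n Q X \<Sigma> x =
     (THE \<sigma>. \<sigma> \<in> \<Sigma> \<and> (\<forall>\<tau>\<in>\<Sigma>. \<sigma> \<subseteq> \<tau> \<longrightarrow> \<tau> = \<sigma>) \<and> (\<exists>U. toric_chart n Q X \<sigma> U \<and> x \<in> U))"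


section \<open>The symmetric group\<close>

definition parabolic_subgroup :: "nat \<Rightarrow> nat \<Rightarrow> (nat \<Rightarrow> nat) set" where
  "parabolic_subgroup n d = generate (sym_group n) {transpose i (i + 1) | i. 1 \<le> i \<and> i < n \<and> i \<noteq> d}"

definition min_coset_reps :: "nat \<Rightarrow> nat \<Rightarrow> (nat \<Rightarrow> nat) set" where
  "min_coset_reps n d =
     {w \<in> carrier (sym_group n). strict_mono_on {1..d} w \<and> strict_mono_on {d+1..n} w}"

text \<open>The Coxeter length of a permutation is its number of inversions.\<close>
definition perm_length :: "nat \<Rightarrow> (nat \<Rightarrow> nat) \<Rightarrow> nat" where
  "perm_length n w = card {(i, j). 1 \<le> i \<and> i < j \<and> j \<le> n \<and> w j < w i}"

definition bruhat_step :: "nat \<Rightarrow> (nat \<Rightarrow> nat) \<Rightarrow> (nat \<Rightarrow> nat) \<Rightarrow> bool" where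
  "bruhat_step n u w \<longleftrightarrow>
     (\<exists>a\<in>{1..n}. \<exists>b\<in>{1..n}. a \<noteq> b \<and> w = u \<circ> transpose a b) \<and> perm_length n u < perm_length n w"

definition bruhat_le :: "nat \<Rightarrow> (nat \<Rightarrow> nat) \<Rightarrow> (nat \<Rightarrow> nat) \<Rightarrow> bool" where
  "bruhat_le n = (bruhat_step n)\<^sup>*\<^sup>*"

text \<open>This is the set \<open>[v]\<close>; the usual notation suppresses \<open>w\<close>.\<close>
definition coset_below :: "nat \<Rightarrow> nat \<Rightarrow> (nat \<Rightarrow> nat) \<Rightarrow> (nat \<Rightarrow> nat) \<Rightarrow> (nat \<Rightarrow> nat) set" where
  "coset_below n d w v =
     {u \<in> carrier (sym_group n). bruhat_le n u w \<and>
        u <#\<^bsub>sym_group n\<^esub> parabolic_subgroup n d = v <#\<^bsub>sym_group n\<^esub> parabolic_subgroup n d}"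

end

theory Submission
  imports Defs
begin

text \<open>
  A flag minor of a matrix is a maximal minor of its first \<open>k\<close> columns; up to a common factor the flag minors
  with rows \<open>r\<close> are functions on \<open>G/Q\<close>, and the torus acts on them with weight \<open>t\<^sup>r = \<Prod> t\<^bsub>r a\<^esub>\<close>.  The proof
  rests on a description of the maximal cone at a fixed point \<open>x\<close> that is the same for \<open>G/P\<close> and \<open>G/B\<close>
  (\<open>chart_cone_eq\<close>): it consists of the \<open>\<nu>\<close> with \<open>\<nu>(t\<^sup>r / t\<^sup>x) \<ge> 0\<close> for all flag minors \<open>r\<close> that do not vanish
  on the dense orbit, where \<open>k\<close> runs through the levels of the flags.  In other words it is the normal cone of
  the moment polytope at the vertex \<open>x\<close>.

  Why is this so?  The minor with rows \<open>x\<close> has no zeros on an affine chart containing \<open>x\<close>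
  (\<open>stable_closed_empty\<close>), so the ratios of minors are regular on the chart and their weights lie in the dual
  monoid of its cone.  Conversely every weight of a regular function is a product of such weights
  (\<open>dual_monoid_generated\<close>): this is seen on representatives of the dense orbit whose entries are ratios of minors,
  by the independence of characters.  As a rational cone is determined by its dual monoid
  (\<open>rational_cone_double_dual\<close>), the cone is the stated one.

  Since \<open>w\<close> is a minimal coset representative, \<open>G/B \<rightarrow> G/P\<close> is an isomorphism on the cells of \<open>w\<close>.  Hence the
  dense orbit lifts to \<open>G/B\<close> with the same stabilizer (\<open>dense_orbit_lift\<close>), both fans live in the same space, and
  the inequalities of both kinds of cones are given by the minors of one and the same matrix \<open>h\<close>.

  What remains is linear programming on flags.  The inequalities for \<open>v\<close> are the ones of level \<open>d\<close> for
  every \<open>u \<in> [v]\<close>, so the cones of all \<open>u \<in> [v]\<close> lie in the cone of \<open>v\<close>.  Conversely let \<open>\<nu>\<close> be in the cone of \<open>v\<close>.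
  It is given by real weights \<open>a\<close> of the rows (\<open>N_real_weights\<close>).  Order the rows by \<open>a\<close>, ties being broken in favour of
  the rows \<open>v 1, \<dots>, v d\<close>, and reduce the columns of \<open>h\<close> in this order (\<open>column_echelon_exists\<close>).  The leading
  rows form a permutation \<open>u\<close> that minimises the weight at all levels simultaneously, so \<open>\<nu>\<close> lies in the
  cone of \<open>u\<close>; at level \<open>d\<close> the rows of \<open>v\<close> are minimal too, and the choice among ties makes the two row sets equal.
  Finally \<open>u \<le> w\<close>, because a one-parameter subgroup degenerates \<open>hB\<close> to \<open>uB\<close> (\<open>initial_fixed_point\<close>) and the
  fixed points of a Schubert variety lie below \<open>w\<close> by the tableau criterion (\<open>fixed_point_imp_bruhat_le\<close>).
\<close>

section \<open>Polynomial functions and the Zariski topology\<close>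

lemma poly_funs_diff:
  assumes "f \<in> poly_funs C" "g \<in> poly_funs C"
  shows "(\<lambda>x. f x - g x) \<in> poly_funs C"
  using poly_funs.add[OF assms(1) poly_funs.mult[OF poly_funs.const[of "-1"] assms(2)]] by simp

text \<open>
  Formulas such as matrix products describe polynomials only on matrices of the right size, so
  polynomial functions are compared on the square matrices of size \<open>n\<close>.
\<close>
definition poly_fun :: "nat \<Rightarrow> (complex mat \<Rightarrow> complex) \<Rightarrow> bool" where
  "poly_fun n h \<longleftrightarrow> (\<exists>F\<in>poly_funs (mat_coords n). \<forall>g\<in>carrier_mat n n. h g = F g)"

lemma poly_funI: "F \<in> poly_funs (mat_coords n) \<Longrightarrow> poly_fun n F"
  unfolding poly_fun_def by blast

lemma poly_fun_entry: "i < n \<Longrightarrow> j < n \<Longrightarrow> poly_fun n (\<lambda>g. g $$ (i, j))"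
  by (rule poly_funI, rule poly_funs.coord) (auto simp: mat_coords_def)

lemma poly_fun_const: "poly_fun n (\<lambda>_. c)"
  by (rule poly_funI, rule poly_funs.const)

lemma poly_fun_cong:
  assumes "poly_fun n f" "\<And>g. g \<in> carrier_mat n n \<Longrightarrow> h g = f g"
  shows "poly_fun n h"
  using assms unfolding poly_fun_def by simp

lemma poly_fun_add: "poly_fun n f \<Longrightarrow> poly_fun n h \<Longrightarrow> poly_fun n (\<lambda>g. f g + h g)"
  unfolding poly_fun_def by (metis (no_types, lifting) poly_funs.add)

lemma poly_fun_mult: "poly_fun n f \<Longrightarrow> poly_fun n h \<Longrightarrow> poly_fun n (\<lambda>g. f g * h g)"
  unfolding poly_fun_def by (metis (no_types, lifting) poly_funs.mult)

lemma poly_fun_diff: "poly_fun n f \<Longrightarrow> poly_fun n h \<Longrightarrow> poly_fun n (\<lambda>g. f g - h g)"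
  unfolding poly_fun_def by (metis (no_types, lifting) poly_funs_diff)

lemma poly_fun_power: "poly_fun n f \<Longrightarrow> poly_fun n (\<lambda>g. f g ^ k)"
  by (induction k) (auto intro: poly_fun_mult poly_fun_const)

lemma poly_fun_sum:
  assumes "finite I" "\<And>i. i \<in> I \<Longrightarrow> poly_fun n (f i)"
  shows "poly_fun n (\<lambda>x. \<Sum>i\<in>I. f i x)"
  using assms
  by (induction I rule: finite_induct) (auto intro: poly_fun_add poly_fun_const)

lemma poly_fun_prod:
  assumes "finite I" "\<And>i. i \<in> I \<Longrightarrow> poly_fun n (f i)"
  shows "poly_fun n (\<lambda>x. \<Prod>i\<in>I. f i x)"
  using assms
  by (induction I rule: finite_induct) (auto intro: poly_fun_mult poly_fun_const)

lemma poly_fun_compose: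
  assumes f: "f \<in> poly_funs (mat_coords m)"
    and \<phi>: "\<And>i j. i < m \<Longrightarrow> j < m \<Longrightarrow> poly_fun n (\<lambda>g. \<phi> g $$ (i, j))"
  shows "poly_fun n (\<lambda>g. f (\<phi> g))"
  using f
proof induction
  case (coord x)
  then show ?case using \<phi> by (auto simp: mat_coords_def)
qed (auto intro: poly_fun_add poly_fun_mult poly_fun_const)

lemma poly_fun_left_mult:
  assumes "f \<in> poly_funs (mat_coords n)" "a \<in> carrier_mat n n"
  shows "poly_fun n (\<lambda>g. f (a * g))"
proof (rule poly_fun_compose[OF assms(1)])
  fix i j assume ij: "i < n" "j < n"
  have "poly_fun n (\<lambda>g. \<Sum>k<n. a $$ (i, k) * g $$ (k, j))"
    by (intro poly_fun_sum poly_fun_mult poly_fun_const poly_fun_entry) (use ij in auto)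
  then show "poly_fun n (\<lambda>g. (a * g) $$ (i, j))"
    by (rule poly_fun_cong) (use ij assms(2) in \<open>auto simp: scalar_prod_def atLeast0LessThan\<close>)
qed

lemma poly_fun_right_mult:
  assumes "f \<in> poly_funs (mat_coords n)" "a \<in> carrier_mat n n"
  shows "poly_fun n (\<lambda>g. f (g * a))"
proof (rule poly_fun_compose[OF assms(1)])
  fix i j assume ij: "i < n" "j < n"
  have "poly_fun n (\<lambda>g. \<Sum>k<n. g $$ (i, k) * a $$ (k, j))"
    by (intro poly_fun_sum poly_fun_mult poly_fun_const poly_fun_entry) (use ij in auto)
  then show "poly_fun n (\<lambda>g. (g * a) $$ (i, j))"
    by (rule poly_fun_cong) (use ij assms(2) in \<open>auto simp: scalar_prod_def atLeast0LessThan\<close>)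
qed

lemma poly_fun_det:
  assumes "\<And>g. g \<in> carrier_mat n n \<Longrightarrow> \<phi> g \<in> carrier_mat k k"
    and "\<And>i j. i < k \<Longrightarrow> j < k \<Longrightarrow> poly_fun n (\<lambda>g. \<phi> g $$ (i, j))"
  shows "poly_fun n (\<lambda>g. det (\<phi> g))"
proof -
  have "poly_fun n (\<lambda>g. \<Sum>p\<in>{p. p permutes {0..<k}}. signof p * (\<Prod>i = 0..<k. \<phi> g $$ (i, p i)))"
    by (intro poly_fun_sum poly_fun_mult poly_fun_const poly_fun_prod assms(2))
       (auto simp: finite_permutations permutes_in_image)
  then show ?thesis
    by (rule poly_fun_cong) (use assms(1) det_def' in blast)
qed

text \<open>
  The principal open sets are closed under intersection, because a product of polynomial functions is one;
  so they form a basis.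
\<close>
lemma openin_zariski:
  "openin (zariski C S) V \<longleftrightarrow>
     V \<subseteq> S \<and> (\<forall>x\<in>V. \<exists>f\<in>poly_funs C. f x \<noteq> 0 \<and> (\<forall>y\<in>S. f y \<noteq> 0 \<longrightarrow> y \<in> V))"
proof
  assume "openin (zariski C S) V"
  then obtain T where T: "openin (topology_generated_by {{x. f x \<noteq> 0} | f. f \<in> poly_funs C}) T"
    and V: "V = T \<inter> S"
    unfolding zariski_def openin_subtopology by auto
  have "generate_topology_on {{x. f x \<noteq> 0} | f. f \<in> poly_funs C} T"
    using T by (simp add: openin_topology_generated_by_iff)
  then have "\<forall>x\<in>T. \<exists>f\<in>poly_funs C. f x \<noteq> 0 \<and> (\<forall>y. f y \<noteq> 0 \<longrightarrow> y \<in> T)"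
  proof induction
    case (Int a b)
    show ?case
    proof
      fix x assume "x \<in> a \<inter> b"
      then obtain f g where "f \<in> poly_funs C" "g \<in> poly_funs C" "f x \<noteq> 0" "g x \<noteq> 0"
        "\<forall>y. f y \<noteq> 0 \<longrightarrow> y \<in> a" "\<forall>y. g y \<noteq> 0 \<longrightarrow> y \<in> b"
        using Int.IH by blast
      then show "\<exists>f\<in>poly_funs C. f x \<noteq> 0 \<and> (\<forall>y. f y \<noteq> 0 \<longrightarrow> y \<in> a \<inter> b)"
        by (intro bexI[of _ "\<lambda>x. f x * g x"]) (auto intro: poly_funs.mult)
    qed
  next
    case (UN K)
    show ?case
    proof
      fix x assume "x \<in> \<Union>K"
      then obtain k where k: "k \<in> K" "x \<in> k" by blast
      then obtain f where "f \<in> poly_funs C" "f x \<noteq> 0" "\<forall>y. f y \<noteq> 0 \<longrightarrow> y \<in> k"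
        using UN.IH[OF k(1)] by blast
      then show "\<exists>f\<in>poly_funs C. f x \<noteq> 0 \<and> (\<forall>y. f y \<noteq> 0 \<longrightarrow> y \<in> \<Union>K)"
        using k(1) by blast
    qed
  qed auto
  then show "V \<subseteq> S \<and> (\<forall>x\<in>V. \<exists>f\<in>poly_funs C. f x \<noteq> 0 \<and> (\<forall>y\<in>S. f y \<noteq> 0 \<longrightarrow> y \<in> V))"
    unfolding V by blast
next
  assume A: "V \<subseteq> S \<and> (\<forall>x\<in>V. \<exists>f\<in>poly_funs C. f x \<noteq> 0 \<and> (\<forall>y\<in>S. f y \<noteq> 0 \<longrightarrow> y \<in> V))"
  define K where "K = {{x. f x \<noteq> 0} | f. f \<in> poly_funs C \<and> (\<forall>y\<in>S. f y \<noteq> 0 \<longrightarrow> y \<in> V)}"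
  have "openin (topology_generated_by {{x. f x \<noteq> 0} | f. f \<in> poly_funs C}) (\<Union>K)"
    by (rule openin_Union) (auto simp: K_def intro!: topology_generated_by_Basis)
  moreover have "V = \<Union>K \<inter> S"
  proof
    show "V \<subseteq> \<Union>K \<inter> S"
    proof
      fix x assume x: "x \<in> V"
      then obtain f where f: "f \<in> poly_funs C" "f x \<noteq> 0" "\<forall>y\<in>S. f y \<noteq> 0 \<longrightarrow> y \<in> V"
        using A by blast
      then have "{x. f x \<noteq> 0} \<in> K" unfolding K_def by blast
      then show "x \<in> \<Union>K \<inter> S" using x f A by blast
    qed
  qed (auto simp: K_def)
  ultimately show "openin (zariski C S) V"
    unfolding zariski_def openin_subtopology by blast
qed

lemma topspace_zariski [simp]: "topspace (zariski C S) = S"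
proof -
  have "openin (zariski C S) S"
    unfolding openin_zariski by (auto intro!: bexI[of _ "\<lambda>_. 1"] poly_funs.const)
  then show ?thesis
    by (metis openin_subset openin_topspace openin_zariski subset_antisym)
qed

section \<open>Cosets in the special linear group\<close>

lemma SL_simps [simp]:
  "carrier (SL n) = {A \<in> carrier_mat n n. det A = 1}" "mult (SL n) = (*)" "one (SL n) = 1\<^sub>m n"
  by (simp_all add: SL_def)

lemma group_SL: "group (SL n)"
proof (rule groupI)
  fix A assume "A \<in> carrier (SL n)"
  then have A: "A \<in> carrier_mat n n" "det A = 1" by auto
  obtain B where B: "B \<in> carrier_mat n n" "B * A = 1\<^sub>m n"
    using det_non_zero_imp_unit[OF A(1), where b = "()"] A(2)
    by (auto simp: Units_def ring_mat_def)
  then have "det B = 1" using det_mult[OF B(1) A(1)] A(2) by simp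
  then show "\<exists>y\<in>carrier (SL n). y \<otimes>\<^bsub>SL n\<^esub> A = \<one>\<^bsub>SL n\<^esub>" using B by auto
qed (auto simp: det_mult)

lemma SL_carrier_mat: "A \<in> carrier (SL n) \<Longrightarrow> A \<in> carrier_mat n n"
  by simp

locale homogeneous_space =
  fixes n :: nat and Q :: "complex mat set"
  assumes subgroup: "subgroup Q (SL n)" and torus_le: "torus n \<subseteq> Q"
begin

interpretation group "SL n" by (rule group_SL)

abbreviation pt :: "complex mat \<Rightarrow> complex mat set" where
  "pt g \<equiv> g <#\<^bsub>SL n\<^esub> Q"

definition points :: "complex mat set set" where
  "points = pt ` carrier (SL n)"

lemma Q_carrier: "q \<in> Q \<Longrightarrow> q \<in> carrier (SL n)"
  using subgroup.mem_carrier[OF subgroup] .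

lemma torus_carrier: "t \<in> torus n \<Longrightarrow> t \<in> carrier (SL n)"
  unfolding torus_def by simp

lemma pt_mult:
  assumes "g \<in> carrier (SL n)" "q \<in> Q"
  shows "pt (g * q) = pt g"
proof -
  have "g * q \<in> pt g" using assms(2) by (auto simp: l_coset_def)
  then show ?thesis
    using l_repr_independence[OF _ assms(1) subgroup] by simp
qed

lemma pt_eq_iff:
  assumes "g \<in> carrier (SL n)" "h \<in> carrier (SL n)"
  shows "pt g = pt h \<longleftrightarrow> (\<exists>q\<in>Q. g = h * q)"
proof
  assume "pt g = pt h"
  moreover have "g \<in> pt g" unfolding l_coset_def using assms(1) subgroup.one_closed[OF subgroup]
    by (intro UN_I[of "1\<^sub>m n"]) auto
  ultimately have "g \<in> pt h" by simp
  then show "\<exists>q\<in>Q. g = h * q" by (auto simp: l_coset_def)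
next
  assume "\<exists>q\<in>Q. g = h * q"
  then show "pt g = pt h" using pt_mult assms by auto
qed

lemma left_mult_pt:
  assumes "a \<in> carrier (SL n)" "g \<in> carrier (SL n)"
  shows "a <#\<^bsub>SL n\<^esub> pt g = pt (a * g)"
  using lcos_m_assoc[of Q a g] assms subgroup.subset[OF subgroup] by simp

lemma openin_homog:
  "openin (homog_topology n Q) U \<longleftrightarrow>
     U \<subseteq> points \<and> openin (zariski (mat_coords n) (carrier (SL n))) {g \<in> carrier (SL n). pt g \<in> U}"
  unfolding homog_topology_def openin_quotient_topology points_def by simp

lemma topspace_homog [simp]: "topspace (homog_topology n Q) = points"
proof -
  have "{g \<in> carrier (SL n). pt g \<in> points} = topspace (zariski (mat_coords n) (carrier (SL n)))"
    by (auto simp: points_def)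
  then have "openin (homog_topology n Q) points"
    unfolding openin_homog by (metis (no_types, lifting) openin_topspace subset_refl)
  then show ?thesis
    by (metis openin_homog openin_subset openin_topspace subset_antisym)
qed

text \<open>
  The closed subsets of \<open>G/Q\<close> correspond to the closed subsets of \<open>G\<close> stable under right multiplication
  by \<open>Q\<close>, and the closure of a stable subset of \<open>G\<close> is again stable.  So closures in \<open>G/Q\<close> are tested by
  polynomial functions on \<open>G\<close>, invariant or not.
\<close>
lemma homog_closure_iff:
  assumes g: "g \<in> carrier (SL n)"
  shows "pt g \<in> homog_topology n Q closure_of S \<longleftrightarrow>
     (\<forall>f\<in>poly_funs (mat_coords n). (\<forall>s\<in>carrier (SL n). pt s \<in> S \<longrightarrow> f s = 0) \<longrightarrow> f g = 0)"
    (is "?L \<longleftrightarrow> ?R")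
proof
  assume L: ?L
  show ?R
  proof (intro ballI impI, rule ccontr)
    fix f assume f: "f \<in> poly_funs (mat_coords n)"
      and zero: "\<forall>s\<in>carrier (SL n). pt s \<in> S \<longrightarrow> f s = 0" and fg: "f g \<noteq> 0"
    define V where "V = {h \<in> carrier (SL n). \<exists>q\<in>Q. f (h * q) \<noteq> 0}"
    have preimage: "{h \<in> carrier (SL n). pt h \<in> pt ` V} = V"
    proof
      show "{h \<in> carrier (SL n). pt h \<in> pt ` V} \<subseteq> V"
      proof
        fix h assume "h \<in> {h \<in> carrier (SL n). pt h \<in> pt ` V}"
        then obtain k q where h: "h \<in> carrier (SL n)" and k: "k \<in> carrier (SL n)" "pt k = pt h"
          and q: "q \<in> Q" "f (k * q) \<noteq> 0"
          unfolding V_def by auto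
        obtain r where r: "r \<in> Q" "k = h * r" using pt_eq_iff[OF k(1) h] k(2) by auto
        have "k * q = h * (r * q)"
          unfolding r(2) using m_assoc[of h r q] h Q_carrier r(1) q(1) by simp
        moreover have "r * q \<in> Q" using subgroup.m_closed[OF subgroup r(1) q(1)] by simp
        ultimately show "h \<in> V" unfolding V_def using h q(2) by auto
      qed
    qed (auto simp: V_def)
    have "openin (zariski (mat_coords n) (carrier (SL n))) V"
      unfolding openin_zariski
    proof (intro conjI ballI)
      fix h assume "h \<in> V"
      then obtain q where h: "h \<in> carrier (SL n)" and q: "q \<in> Q" "f (h * q) \<noteq> 0"
        unfolding V_def by auto
      obtain F where F: "F \<in> poly_funs (mat_coords n)" "\<forall>g\<in>carrier_mat n n. f (g * q) = F g"
        using poly_fun_right_mult[OF f, of q] Q_carrier[OF q(1)] unfolding poly_fun_def by auto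
      have "F h \<noteq> 0" using F(2) SL_carrier_mat[OF h] q(2) by simp
      moreover have "y \<in> V" if "y \<in> carrier (SL n)" "F y \<noteq> 0" for y
      proof -
        have "f (y * q) \<noteq> 0" using F(2) SL_carrier_mat[OF that(1)] that(2) by simp
        then show ?thesis unfolding V_def using that(1) q(1) by blast
      qed
      ultimately show "\<exists>f\<in>poly_funs (mat_coords n). f h \<noteq> 0 \<and> (\<forall>y\<in>carrier (SL n). f y \<noteq> 0 \<longrightarrow> y \<in> V)"
        using F(1) by blast
    qed (auto simp: V_def)
    then have "openin (homog_topology n Q) (pt ` V)"
      unfolding openin_homog preimage by (auto simp: points_def V_def)
    moreover have "g \<in> V" unfolding V_def 
      using g fg subgroup.one_closed[OF subgroup] by (auto intro!: bexI[of _ "1\<^sub>m n"])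
    moreover have "\<forall>T. pt g \<in> T \<and> openin (homog_topology n Q) T \<longrightarrow> (\<exists>y. y \<in> S \<and> y \<in> T)"
      using L unfolding in_closure_of by simp
    ultimately have "\<exists>y. y \<in> S \<and> y \<in> pt ` V"
      by (meson imageI)
    then obtain h where hV: "h \<in> V" and hS: "pt h \<in> S" by auto
    obtain q where h: "h \<in> carrier (SL n)" and q: "q \<in> Q" "f (h * q) \<noteq> 0"
      using hV unfolding V_def by blast
    have "pt (h * q) \<in> S" using pt_mult[OF h q(1)] hS by simp
    moreover have "h * q \<in> carrier (SL n)" using m_closed[OF h Q_carrier[OF q(1)]] by simp
    ultimately show False using zero q(2) by blast
  qed
next
  assume R: ?R
  show ?L
    unfolding in_closure_of
  proof (intro conjI allI impI)
    show "pt g \<in> topspace (homog_topology n Q)" using g by (auto simp: points_def)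
    fix T assume T: "pt g \<in> T \<and> openin (homog_topology n Q) T"
    then have "openin (zariski (mat_coords n) (carrier (SL n))) {g \<in> carrier (SL n). pt g \<in> T}"
      unfolding openin_homog by simp
    then obtain f where f: "f \<in> poly_funs (mat_coords n)" "f g \<noteq> 0"
      "\<forall>y\<in>carrier (SL n). f y \<noteq> 0 \<longrightarrow> pt y \<in> T"
      unfolding openin_zariski using T g by auto
    then show "\<exists>y. y \<in> S \<and> y \<in> T" using R g by blast
  qed
qed

lemma closure_subset_points: "homog_topology n Q closure_of S \<subseteq> points"
  using closure_of_subset_topspace by fastforce

end

section \<open>Flag minors and parabolic subgroups\<close>

text \<open>
  A Plucker coordinate of the span of the first \<open>k\<close> columns.  Indexing by row functions instead of sets of rows avoids all
  bookkeeping of signs and sorting.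
\<close>
definition minor :: "nat \<Rightarrow> (nat \<Rightarrow> nat) \<Rightarrow> complex mat \<Rightarrow> complex" where
  "minor k r g = det (mat k k (\<lambda>(i, j). g $$ (r i, j)))"

text \<open>
  The sum of \<open>\<rho>\<close> over \<open>S\<close> is invariant under \<open>\<pi>\<close>, so no value can drop.  This is how a triangular shape of
  a matrix, with respect to any order of its rows, leaves only one term in the Leibniz formula.
\<close>
lemma permutes_le_imp_id:
  fixes \<rho> :: "'a \<Rightarrow> nat"
  assumes "finite S" "\<pi> permutes S" "inj_on \<rho> S" "\<And>a. a \<in> S \<Longrightarrow> \<rho> (\<pi> a) \<le> \<rho> a"
  shows "\<pi> = id"
proof -
  have s: "(\<Sum>a\<in>S. \<rho> (\<pi> a)) = (\<Sum>a\<in>S. \<rho> a)"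
    using sum.permute[OF assms(2), of \<rho>] by (simp add: comp_def)
  have "\<rho> (\<pi> a) = \<rho> a" if "a \<in> S" for a
  proof (rule ccontr)
    assume "\<rho> (\<pi> a) \<noteq> \<rho> a"
    then have "\<rho> (\<pi> a) < \<rho> a" using assms(4) that by (simp add: order_less_le)
    then have "(\<Sum>a\<in>S. \<rho> (\<pi> a)) < (\<Sum>a\<in>S. \<rho> a)"
      using assms(1,4) that by (intro sum_strict_mono_ex1) auto
    then show False using s by simp
  qed
  then have "\<pi> a = a" for a
    using assms(2,3) permutes_in_image[OF assms(2), of a] permutes_not_in[OF assms(2), of a]
    by (cases "a \<in> S") (auto dest: inj_onD)
  then show ?thesis by (simp add: fun_eq_iff)
qed

lemma det_unique_transversal:
  fixes A :: "complex mat"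
  assumes A: "A \<in> carrier_mat k k"
    and id: "\<And>\<pi>. \<pi> permutes {..<k} \<Longrightarrow> (\<And>i. i < k \<Longrightarrow> A $$ (i, \<pi> i) \<noteq> 0) \<Longrightarrow> \<pi> = id"
  shows "det A = (\<Prod>i<k. A $$ (i, i))"
proof -
  have "(\<Sum>p\<in>{p. p permutes {0..<k}}. signof p * (\<Prod>i = 0..<k. A $$ (i, p i)))
      = (\<Sum>p\<in>{id}. signof p * (\<Prod>i = 0..<k. A $$ (i, p i)))"
  proof (rule sum.mono_neutral_right)
    show "\<forall>p\<in>{p. p permutes {0..<k}} - {id}. signof p * (\<Prod>i = 0..<k. A $$ (i, p i)) = 0"
    proof
      fix p assume p: "p \<in> {p. p permutes {0..<k}} - {id}"
      then obtain i where "i < k" "A $$ (i, p i) = 0"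
        using id[of p] by (auto simp: atLeast0LessThan)
      then have "(\<Prod>i = 0..<k. A $$ (i, p i)) = 0" by (intro prod_zero) auto
      then show "signof p * (\<Prod>i = 0..<k. A $$ (i, p i)) = 0" by simp
    qed
  qed (auto simp: finite_permutations permutes_id)
  then show ?thesis using det_def'[OF A] by (simp add: atLeast0LessThan)
qed

lemma det_upper_triangular_prod:
  fixes A :: "complex mat"
  assumes A: "A \<in> carrier_mat n n" and zero: "\<And>i j. i < n \<Longrightarrow> j < i \<Longrightarrow> A $$ (i, j) = 0"
  shows "det A = (\<Prod>i<n. A $$ (i, i))"
proof (rule det_unique_transversal[OF A])
  fix \<pi> assume \<pi>: "\<pi> permutes {..<n}" and nz: "\<And>i. i < n \<Longrightarrow> A $$ (i, \<pi> i) \<noteq> 0"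
  show "\<pi> = id"
  proof (rule permutes_le_imp_id[OF _ \<pi>, of "\<lambda>a. n - a"])
    fix a assume "a \<in> {..<n}"
    then show "n - \<pi> a \<le> n - a" using zero[of a "\<pi> a"] nz[of a] by fastforce
  qed (auto simp: inj_on_def)
qed

lemma minor_transversal:
  assumes "minor k r g \<noteq> 0"
  obtains \<pi> where "\<pi> permutes {..<k}" "\<And>i. i < k \<Longrightarrow> g $$ (r i, \<pi> i) \<noteq> 0"
proof -
  let ?A = "mat k k (\<lambda>(i, j). g $$ (r i, j))"
  have "(\<Sum>p\<in>{p. p permutes {0..<k}}. signof p * (\<Prod>i = 0..<k. ?A $$ (i, p i))) \<noteq> 0"
    using assms det_def'[of ?A k] unfolding minor_def by simp
  then obtain p where p: "p permutes {0..<k}" "(\<Prod>i = 0..<k. ?A $$ (i, p i)) \<noteq> 0"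
    by (metis (no_types, lifting) mem_Collect_eq mult_eq_0_iff sum.neutral)
  show ?thesis
  proof (rule that[of p])
    show "p permutes {..<k}" using p(1) by (simp add: atLeast0LessThan)
    fix i assume "i < k"
    moreover have "p i < k" using permutes_in_image[OF p(1), of i] \<open>i < k\<close> by simp
    moreover have "mat k k (\<lambda>(i, j). g $$ (r i, j)) $$ (i, p i) \<noteq> 0"
      using p(2) \<open>i < k\<close> by (simp add: prod_zero_iff)
    ultimately show "g $$ (r i, p i) \<noteq> 0" by simp
  qed
qed

lemma minor_unique_transversal:
  assumes "\<And>\<pi>. \<pi> permutes {..<k} \<Longrightarrow> (\<And>i. i < k \<Longrightarrow> g $$ (r i, \<pi> i) \<noteq> 0) \<Longrightarrow> \<pi> = id"
  shows "minor k r g = (\<Prod>i<k. g $$ (r i, i))"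
proof -
  have "minor k r g = (\<Prod>i<k. mat k k (\<lambda>(i, j). g $$ (r i, j)) $$ (i, i))"
    unfolding minor_def
  proof (rule det_unique_transversal)
    fix \<pi> assume \<pi>: "\<pi> permutes {..<k}"
      and nz: "\<And>i. i < k \<Longrightarrow> mat k k (\<lambda>(i, j). g $$ (r i, j)) $$ (i, \<pi> i) \<noteq> 0"
    show "\<pi> = id"
    proof (rule assms[OF \<pi>])
      fix i assume "i < k"
      then show "g $$ (r i, \<pi> i) \<noteq> 0" using nz[of i] permutes_in_image[OF \<pi>, of i] by auto
    qed
  qed simp
  then show ?thesis by simp
qed

lemma poly_fun_minor:
  assumes "k \<le> n" "\<And>i. i < k \<Longrightarrow> r i < n"
  shows "poly_fun n (minor k r)"
proof -
  have "poly_fun n (\<lambda>g. det (mat k k (\<lambda>(i, j). g $$ (r i, j))))"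
    by (rule poly_fun_det) (use assms in \<open>auto intro!: poly_fun_entry\<close>)
  then show ?thesis by (simp add: minor_def[abs_def])
qed

lemma minor_permutes:
  assumes "x permutes {..<n}" "g \<in> carrier_mat n n"
  shows "minor n x g = signof x * det g"
  using det_permute_rows[of g n x] assms unfolding minor_def by (simp add: atLeast0LessThan)

definition flag_stab :: "nat \<Rightarrow> nat set \<Rightarrow> complex mat set" where
  "flag_stab n \<Delta> = {A \<in> carrier (SL n). \<forall>k\<in>\<Delta>. \<forall>i<n. \<forall>j<k. k \<le> i \<longrightarrow> A $$ (i, j) = 0}"

lemma parabolic_eq: "parabolic n d = flag_stab n {d}"
  unfolding parabolic_def flag_stab_def by auto

lemma borel_eq: "borel n = flag_stab n {1..<n}"
proof -
  have "(\<forall>i<n. \<forall>j<i. A $$ (i, j) = 0) \<longleftrightarrow> (\<forall>k\<in>{1..<n}. \<forall>i<n. \<forall>j<k. k \<le> i \<longrightarrow> A $$ (i, j) = 0)"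
    for A :: "complex mat"
    by (auto, metis One_nat_def Suc_leI atLeastLessThan_iff le_refl less_nat_zero_code neq0_conv)
  then show ?thesis unfolding borel_def flag_stab_def by auto
qed

lemma minor_mult:
  assumes g: "g \<in> carrier_mat n n" and q: "q \<in> flag_stab n \<Delta>" and k: "k \<in> \<Delta>" "k \<le> n"
    and r: "\<And>i. i < k \<Longrightarrow> r i < n"
  shows "minor k r (g * q) = minor k r g * minor k id q"
proof -
  have q': "q \<in> carrier_mat n n" using q by (simp add: flag_stab_def)
  have "mat k k (\<lambda>(i, j). (g * q) $$ (r i, j))
      = mat k k (\<lambda>(i, j). g $$ (r i, j)) * mat k k (\<lambda>(i, j). q $$ (id i, j))" (is "?L = ?R")
  proof (rule eq_matI)
    fix i j assume "i < dim_row ?R" "j < dim_col ?R"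
    then have ij: "i < k" "j < k" by auto
    have "(g * q) $$ (r i, j) = (\<Sum>l<n. g $$ (r i, l) * q $$ (l, j))"
      using g q' r[OF ij(1)] ij k(2) by (auto simp: scalar_prod_def atLeast0LessThan)
    also have "\<dots> = (\<Sum>l<k. g $$ (r i, l) * q $$ (l, j))"
      by (rule sum.mono_neutral_right) (use k q ij in \<open>auto simp: flag_stab_def\<close>)
    finally show "?L $$ (i, j) = ?R $$ (i, j)"
      using ij by (auto simp: scalar_prod_def atLeast0LessThan)
  qed auto
  then show ?thesis
    unfolding minor_def by (simp add: det_mult[of _ k])
qed

text \<open>
  A vector in the kernel of the leading block, extended by zeros, would lie in the kernel of the whole
  matrix.
\<close>
lemma minor_flag_stab_nonzero:
  assumes q: "q \<in> flag_stab n \<Delta>" and k: "k \<in> \<Delta>" "k \<le> n"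
  shows "minor k id q \<noteq> 0"
proof
  assume "minor k id q = 0"
  let ?A = "mat k k (\<lambda>(i, j). q $$ (id i, j))"
  obtain v where v: "v \<in> carrier_vec k" "v \<noteq> 0\<^sub>v k" "?A *\<^sub>v v = 0\<^sub>v k"
    using \<open>minor k id q = 0\<close> det_0_iff_vec_prod_zero_field[of ?A k] unfolding minor_def by auto
  define v' where "v' = vec n (\<lambda>i. if i < k then v $ i else 0)"
  have q': "q \<in> carrier_mat n n" "det q = 1" using q by (simp_all add: flag_stab_def)
  have "q *\<^sub>v v' = 0\<^sub>v n"
  proof (rule eq_vecI)
    fix i assume "i < dim_vec (0\<^sub>v n :: complex vec)"
    then have i: "i < n" by simp
    have "(q *\<^sub>v v') $ i = (\<Sum>l<n. q $$ (i, l) * (if l < k then v $ l else 0))"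
      using i q' by (simp add: scalar_prod_def v'_def atLeast0LessThan)
    also have "\<dots> = (\<Sum>l<k. q $$ (i, l) * v $ l)"
      by (rule sum.mono_neutral_cong_right) (use k in auto)
    also have "\<dots> = 0"
    proof (cases "i < k")
      case True
      have "(?A *\<^sub>v v) $ i = (\<Sum>l<k. q $$ (i, l) * v $ l)"
        using True v(1) by (auto simp: scalar_prod_def atLeast0LessThan)
      then show ?thesis unfolding v(3) using True by simp
    next
      case False
      then show ?thesis using q k i by (intro sum.neutral) (auto simp: flag_stab_def)
    qed
    finally show "(q *\<^sub>v v') $ i = 0\<^sub>v n $ i" using i by simp
  qed (use q' in auto)
  moreover have "v' \<noteq> 0\<^sub>v n"
  proof
    assume *: "v' = 0\<^sub>v n"
    have "v = 0\<^sub>v k"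
    proof (rule eq_vecI)
      fix i assume "i < dim_vec (0\<^sub>v k :: complex vec)"
      then have "i < k" by simp
      moreover have "v' $ i = 0" using * \<open>i < k\<close> k by simp
      ultimately show "v $ i = 0\<^sub>v k $ i" using k by (simp add: v'_def)
    qed (use v in auto)
    then show False using v by simp
  qed
  moreover have "v' \<in> carrier_vec n" by (simp add: v'_def)
  ultimately have "det q = 0"
    using det_0_iff_vec_prod_zero_field[OF q'(1)] by blast
  then show False using q' by simp
qed

lemma right_inverse_mat:
  fixes A :: "complex mat"
  assumes "A \<in> carrier_mat k k" "det A \<noteq> 0"
  obtains C where "C \<in> carrier_mat k k" "A * C = 1\<^sub>m k"
  using det_non_zero_imp_unit[OF assms, where b = "()"] by (auto simp: Units_def ring_mat_def)

lemma subgroup_flag_stab: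
  assumes \<Delta>: "\<Delta> \<subseteq> {..n}"
  shows "subgroup (flag_stab n \<Delta>) (SL n)"
proof (rule group.subgroupI[OF group_SL])
  show "flag_stab n \<Delta> \<subseteq> carrier (SL n)" by (auto simp: flag_stab_def)
  have "1\<^sub>m n \<in> flag_stab n \<Delta>" using \<Delta> by (auto simp: flag_stab_def)
  then show "flag_stab n \<Delta> \<noteq> {}" by blast
next
  fix A assume A: "A \<in> flag_stab n \<Delta>"
  then have AG: "A \<in> carrier (SL n)" by (simp add: flag_stab_def)
  define B where "B = inv\<^bsub>SL n\<^esub> A"
  have BG: "B \<in> carrier (SL n)" and BA: "B * A = 1\<^sub>m n"
    using group.inv_closed[OF group_SL AG] group.l_inv[OF group_SL AG] by (simp_all add: B_def)
  have "B $$ (i, m) = 0" if k: "k \<in> \<Delta>" "i < n" "m < k" "k \<le> i" for k i m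
  proof -
    have kn: "k \<le> n" using \<Delta> k by auto
    obtain C where C: "C \<in> carrier_mat k k" "mat k k (\<lambda>(i, j). A $$ (id i, j)) * C = 1\<^sub>m k"
      using right_inverse_mat[of "mat k k (\<lambda>(i, j). A $$ (id i, j))" k]
        minor_flag_stab_nonzero[OF A k(1) kn] unfolding minor_def by auto
    have AC: "(\<Sum>j<k. A $$ (l, j) * C $$ (j, m)) = (if l = m then 1 else 0)" if "l < k" for l
    proof -
      have "(mat k k (\<lambda>(i, j). A $$ (id i, j)) * C) $$ (l, m) = (\<Sum>j<k. A $$ (l, j) * C $$ (j, m))"
        using that k(3) C(1) by (auto simp: scalar_prod_def atLeast0LessThan)
      then show ?thesis using C(2) that k(3) by simp
    qed
    have row: "(\<Sum>l<k. B $$ (i, l) * A $$ (l, j)) = 0" if "j < k" for j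
    proof -
      have "(B * A) $$ (i, j) = (\<Sum>l<n. B $$ (i, l) * A $$ (l, j))"
        using AG BG that k kn by (auto simp: scalar_prod_def atLeast0LessThan)
      also have "\<dots> = (\<Sum>l<k. B $$ (i, l) * A $$ (l, j))"
        by (rule sum.mono_neutral_right) (use k kn A that in \<open>auto simp: flag_stab_def\<close>)
      finally show ?thesis using BA that k kn by simp
    qed
    have "B $$ (i, m) = (\<Sum>l<k. B $$ (i, l) * (if l = m then 1 else 0))"
      using k by (simp add: if_distrib[of "(*) _"] sum.delta cong: if_cong)
    also have "\<dots> = (\<Sum>l<k. B $$ (i, l) * (\<Sum>j<k. A $$ (l, j) * C $$ (j, m)))"
      using AC by simp
    also have "\<dots> = (\<Sum>j<k. (\<Sum>l<k. B $$ (i, l) * A $$ (l, j)) * C $$ (j, m))"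
      by (simp add: sum_distrib_left sum_distrib_right mult.assoc) (rule sum.swap)
    also have "\<dots> = 0" using row by simp
    finally show ?thesis .
  qed
  then show "inv\<^bsub>SL n\<^esub> A \<in> flag_stab n \<Delta>"
    using BG unfolding B_def flag_stab_def by blast
next
  fix A B assume A: "A \<in> flag_stab n \<Delta>" and B: "B \<in> flag_stab n \<Delta>"
  have "(A * B) $$ (i, j) = 0" if k: "k \<in> \<Delta>" "i < n" "j < k" "k \<le> i" for k i j
  proof -
    have "(A * B) $$ (i, j) = (\<Sum>l<n. A $$ (i, l) * B $$ (l, j))"
      using A B k \<Delta> by (auto simp: scalar_prod_def atLeast0LessThan flag_stab_def)
    also have "\<dots> = 0"
    proof (rule sum.neutral, rule ballI)
      fix l assume "l \<in> {..<n}"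
      then show "A $$ (i, l) * B $$ (l, j) = 0"
        using A B k by (cases "l < k") (auto simp: flag_stab_def)
    qed
    finally show ?thesis .
  qed
  then show "A \<otimes>\<^bsub>SL n\<^esub> B \<in> flag_stab n \<Delta>"
    using A B det_mult[of A n B] unfolding flag_stab_def by auto
qed

lemma torus_le_flag_stab: "\<Delta> \<subseteq> {..n} \<Longrightarrow> torus n \<subseteq> flag_stab n \<Delta>"
  unfolding torus_def flag_stab_def by fastforce

lemma homogeneous_space_flag_stab: "\<Delta> \<subseteq> {..n} \<Longrightarrow> homogeneous_space n (flag_stab n \<Delta>)"
  by (rule homogeneous_space.intro) (rule subgroup_flag_stab torus_le_flag_stab; assumption)+

subsection \<open>Diagonal matrices\<close>

definition diag :: "nat \<Rightarrow> (nat \<Rightarrow> complex) \<Rightarrow> complex mat" where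
  "diag n c = mat n n (\<lambda>(i, j). if i = j then c i else 0)"

lemma diag_carrier [simp]: "diag n c \<in> carrier_mat n n"
  by (simp add: diag_def)

lemma det_diag: "det (diag n c) = (\<Prod>i<n. c i)"
  using det_upper_triangular_prod[OF diag_carrier, of n c] by (simp add: diag_def)

lemma diag_in_torus: "(\<Prod>i<n. c i) = 1 \<Longrightarrow> diag n c \<in> torus n"
  unfolding torus_def by (auto simp: det_diag) (auto simp: diag_def)

lemma torus_eq_diag:
  assumes "t \<in> torus n"
  shows "t = diag n (\<lambda>i. t $$ (i, i))"
  using assms by (intro eq_matI) (auto simp: torus_def diag_def)

lemma torus_prod:
  assumes "t \<in> torus n"
  shows "(\<Prod>i<n. t $$ (i, i)) = 1"
  using det_diag[of n "\<lambda>i. t $$ (i, i)"] torus_eq_diag[OF assms] assms by (simp add: torus_def)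

lemma torus_nonzero: "t \<in> torus n \<Longrightarrow> i < n \<Longrightarrow> t $$ (i, i) \<noteq> 0"
  using torus_prod[of t n] by (metis finite_lessThan lessThan_iff prod_zero zero_neq_one)

lemma torus_carrier_mat: "t \<in> torus n \<Longrightarrow> t \<in> carrier_mat n n"
  by (simp add: torus_def)

lemma diag_mult_index:
  assumes "g \<in> carrier_mat n n" "i < n" "j < n"
  shows "(diag n c * g) $$ (i, j) = c i * g $$ (i, j)"
proof -
  have "(diag n c * g) $$ (i, j) = (\<Sum>l<n. (if i = l then c i else 0) * g $$ (l, j))"
    using assms by (auto simp: scalar_prod_def atLeast0LessThan diag_def)
  also have "\<dots> = (\<Sum>l<n. if i = l then c i * g $$ (l, j) else 0)"
    by (intro sum.cong) auto
  finally show ?thesis using assms by simp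
qed

lemma mult_diag_index:
  assumes "g \<in> carrier_mat n n" "i < n" "j < n"
  shows "(g * diag n c) $$ (i, j) = g $$ (i, j) * c j"
proof -
  have "(g * diag n c) $$ (i, j) = (\<Sum>l<n. g $$ (i, l) * (if l = j then c l else 0))"
    using assms by (auto simp: scalar_prod_def atLeast0LessThan diag_def)
  also have "\<dots> = (\<Sum>l<n. if j = l then g $$ (i, l) * c l else 0)"
    by (intro sum.cong) auto
  finally show ?thesis using assms by simp
qed

lemma torus_mult_index:
  assumes "t \<in> torus n" "g \<in> carrier_mat n n" "i < n" "j < n"
  shows "(t * g) $$ (i, j) = t $$ (i, i) * g $$ (i, j)"
  using diag_mult_index[OF assms(2-4), of "\<lambda>i. t $$ (i, i)"] torus_eq_diag[OF assms(1)] by simp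

lemma minor_torus_mult:
  assumes t: "t \<in> torus n" and g: "g \<in> carrier_mat n n" and "k \<le> n" "\<And>i. i < k \<Longrightarrow> r i < n"
  shows "minor k r (t * g) = (\<Prod>i<k. t $$ (r i, r i)) * minor k r g"
proof -
  have "mat k k (\<lambda>(i, j). (t * g) $$ (r i, j))
      = diag k (\<lambda>i. t $$ (r i, r i)) * mat k k (\<lambda>(i, j). g $$ (r i, j))" (is "?L = ?R")
  proof (rule eq_matI)
    fix i j assume "i < dim_row ?R" "j < dim_col ?R"
    then have ij: "i < k" "j < k" by (auto simp: diag_def)
    then have "?L $$ (i, j) = t $$ (r i, r i) * g $$ (r i, j)"
      using torus_mult_index[OF t g] assms(3,4) by simp
    then show "?L $$ (i, j) = ?R $$ (i, j)"
      using diag_mult_index[of "mat k k (\<lambda>(i, j). g $$ (r i, j))" k i j] ij by simp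
  qed (auto simp: diag_def)
  then show ?thesis unfolding minor_def by (simp add: det_mult[of _ k] det_diag)
qed

lemma torus_mult_closed: "s \<in> torus n \<Longrightarrow> t \<in> torus n \<Longrightarrow> s * t \<in> torus n"
  using torus_mult_index[of s n t] torus_carrier_mat[of t n] torus_carrier_mat[of s n] det_mult[of s n t]
  by (auto simp: torus_def)

lemma torus_diag_inverse:
  assumes "t \<in> torus n"
  shows "diag n (\<lambda>i. inverse (t $$ (i, i))) \<in> torus n"
  using prod_inversef[of "\<lambda>i. t $$ (i, i)" "{..<n}"] torus_prod[OF assms]
  by (intro diag_in_torus) (simp add: comp_def)

lemma torus_commute:
  assumes "s \<in> torus n" "t \<in> torus n"
  shows "s * t = t * s"
proof (rule eq_matI)
  fix i j assume "i < dim_row (t * s)" "j < dim_col (t * s)"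
  then have "i < n" "j < n" using assms torus_carrier_mat by auto
  then show "(s * t) $$ (i, j) = (t * s) $$ (i, j)"
    using torus_mult_index[OF assms(1) torus_carrier_mat[OF assms(2)], of i j]
      torus_mult_index[OF assms(2) torus_carrier_mat[OF assms(1)], of i j] assms
    by (cases "i = j") (auto simp: torus_def)
qed (use torus_carrier_mat[OF assms(1)] torus_carrier_mat[OF assms(2)] in auto)

lemma torus_conjugate:
  assumes "x permutes {..<n}" "t \<in> torus n"
  shows "diag n (\<lambda>j. inverse (t $$ (x j, x j))) \<in> torus n"
proof -
  have "(\<Prod>j<n. t $$ (x j, x j)) = 1"
    using prod.permute[OF assms(1), of "\<lambda>j. t $$ (j, j)"] torus_prod[OF assms(2)] by (simp add: comp_def)
  then show ?thesis
    using prod_inversef[of "\<lambda>j. t $$ (x j, x j)" "{..<n}"] by (intro diag_in_torus) (simp add: comp_def)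
qed

lemma torus_inverse_mult:
  assumes "t \<in> torus n"
  shows "diag n (\<lambda>i. inverse (t $$ (i, i))) * t = 1\<^sub>m n"
proof (rule eq_matI)
  fix i j assume "i < dim_row (1\<^sub>m n :: complex mat)" "j < dim_col (1\<^sub>m n :: complex mat)"
  then have "i < n" "j < n" by auto
  then show "(diag n (\<lambda>i. inverse (t $$ (i, i))) * t) $$ (i, j) = 1\<^sub>m n $$ (i, j)"
    using diag_mult_index[OF torus_carrier_mat[OF assms], of i j] torus_nonzero[OF assms] assms
    by (cases "i = j") (auto simp: torus_def)
qed (use assms torus_carrier_mat in \<open>auto simp: diag_def\<close>)


subsection \<open>Block echelon forms\<close>

text \<open>
  The shape, with respect to the row order \<open>x 0, x 1, \<dots>\<close>, of the representatives of the points of the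
  big cell centred at the fixed point \<open>x\<close>: block lower triangular with diagonal diagonal blocks.
\<close>
definition cell_shape :: "nat \<Rightarrow> nat set \<Rightarrow> (nat \<Rightarrow> nat) \<Rightarrow> complex mat \<Rightarrow> bool" where
  "cell_shape n \<Delta> x h \<longleftrightarrow>
     (\<forall>i<n. \<forall>j<n. h $$ (x i, j) \<noteq> 0 \<longrightarrow> i = j \<or> (\<exists>k\<in>\<Delta>. j < k \<and> k \<le> i))"

lemma cell_shapeD:
  "cell_shape n \<Delta> x h \<Longrightarrow> i < n \<Longrightarrow> j < n \<Longrightarrow> h $$ (x i, j) \<noteq> 0 \<Longrightarrow> i \<noteq> j \<Longrightarrow> \<exists>k\<in>\<Delta>. j < k \<and> k \<le> i"
  unfolding cell_shape_def by blast

lemma minor_cell_shape: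
  assumes h: "cell_shape n \<Delta> x h" and "k \<le> n"
  shows "minor k x h = (\<Prod>a<k. h $$ (x a, a))"
proof (rule minor_unique_transversal)
  fix \<pi> assume \<pi>: "\<pi> permutes {..<k}" and nz: "\<And>i. i < k \<Longrightarrow> h $$ (x i, \<pi> i) \<noteq> 0"
  show "\<pi> = id"
  proof (rule permutes_le_imp_id[OF _ \<pi>, of "\<lambda>a. a"])
    fix a assume a: "a \<in> {..<k}"
    then have "\<pi> a < k" using permutes_in_image[OF \<pi>, of a] by simp
    then show "\<pi> a \<le> a"
      using cell_shapeD[OF h, of a "\<pi> a"] nz[of a] a \<open>k \<le> n\<close> by fastforce
  qed auto
qed

lemma cell_shape_diagonal_nonzero:
  assumes h: "cell_shape n \<Delta> x h" and x: "x permutes {..<n}"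
    and "h \<in> carrier_mat n n" "det h \<noteq> 0" "j < n"
  shows "h $$ (x j, j) \<noteq> 0"
proof -
  have "(\<Prod>a<n. h $$ (x a, a)) = signof x * det h"
    using minor_cell_shape[OF h, of n] minor_permutes[OF x assms(3)] by simp
  moreover have "signof x * det h \<noteq> 0" using assms by (simp add: sign_def)
  ultimately show ?thesis using \<open>j < n\<close> by (metis finite_lessThan lessThan_iff prod_zero)
qed

text \<open>
  In the rows other than \<open>x j\<close> the echelon form forces a transversal onto the diagonal: this holds for the rows
  before \<open>x j\<close> by induction, and the rows after \<open>x j\<close> belong to the block of \<open>j\<close>, the level \<open>k\<close> being the
  smallest one that contains column \<open>j\<close>.  So the exchange of \<open>x j\<close> for \<open>x i\<close> isolates one entry, and the
  coordinates of the big cell are ratios of flag minors.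
\<close>
lemma minor_exchange:
  assumes h: "cell_shape n \<Delta> x h"
    and ij: "i < n" "j < k" "k \<le> i" and k: "k \<in> \<Delta>" and least: "\<And>l. l \<in> \<Delta> \<Longrightarrow> j < l \<Longrightarrow> k \<le> l"
  shows "minor k (x(j := x i)) h = h $$ (x i, j) * (\<Prod>a\<in>{..<k} - {j}. h $$ (x a, a))"
proof -
  have "minor k (x(j := x i)) h = (\<Prod>a<k. h $$ ((x(j := x i)) a, a))"
  proof (rule minor_unique_transversal)
    fix \<pi> assume \<pi>: "\<pi> permutes {..<k}" and nz: "\<And>a. a < k \<Longrightarrow> h $$ ((x(j := x i)) a, \<pi> a) \<noteq> 0"
    have moved: "\<pi> a < j \<and> \<pi> a < a" if a: "a < k" "a \<noteq> j" "\<pi> a \<noteq> a" for a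
    proof -
      have "\<pi> a < k" "a < n" using permutes_in_image[OF \<pi>, of a] a ij by auto
      then obtain l where l: "l \<in> \<Delta>" "\<pi> a < l" "l \<le> a"
        using cell_shapeD[OF h, of a "\<pi> a"] nz[of a] a ij by auto
      then have "l \<le> j" using least[of l] a by fastforce
      then show ?thesis using l by simp
    qed
    have below: "\<pi> a = a" if "a < j" for a
      using that
    proof (induction a rule: less_induct)
      case (less a)
      show ?case
      proof (rule ccontr)
        assume ne: "\<pi> a \<noteq> a"
        then have "\<pi> a < a" using moved[of a] less.prems ij by simp
        then have "\<pi> (\<pi> a) = \<pi> a" using less by simp
        then show False using ne permutes_inj[OF \<pi>] by (metis injD)
      qed
    qed
    have fix_a: "\<pi> a = a" if "a \<noteq> j" for a
    proof (cases "a < k")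
      case True
      show ?thesis
      proof (rule ccontr)
        assume ne: "\<pi> a \<noteq> a"
        then have "\<pi> (\<pi> a) = \<pi> a" using moved[of a] True that below by simp
        then show False using ne permutes_inj[OF \<pi>] by (metis injD)
      qed
    next
      case False
      then show ?thesis using permutes_not_in[OF \<pi>, of a] by simp
    qed
    have "\<pi> j = j"
      using fix_a[of "\<pi> j"] permutes_inj[OF \<pi>] by (metis injD)
    then show "\<pi> = id" using fix_a by (metis eq_id_iff)
  qed
  also have "\<dots> = h $$ (x i, j) * (\<Prod>a\<in>{..<k} - {j}. h $$ (x a, a))"
    using ij by (subst prod.remove[of _ j]) (auto intro!: prod.cong)
  finally show ?thesis .
qed

lemma cell_shape_minor_nonzero:
  assumes h: "cell_shape n \<Delta> x h" and diag: "\<And>a. a < n \<Longrightarrow> h $$ (x a, a) \<noteq> 0"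
    and ij: "i < n" "j < n" "i \<noteq> j" "h $$ (x i, j) \<noteq> 0"
  obtains k where "k \<in> \<Delta>" "j < k" "k \<le> i" "minor k (x(j := x i)) h \<noteq> 0"
proof -
  define k where "k = (LEAST k. k \<in> \<Delta> \<and> j < k)"
  obtain k' where k': "k' \<in> \<Delta>" "j < k'" "k' \<le> i" using cell_shapeD[OF h ij(1,2,4,3)] by blast
  have k: "k \<in> \<Delta>" "j < k" using LeastI[of "\<lambda>k. k \<in> \<Delta> \<and> j < k" k'] k' unfolding k_def by auto
  have least: "k \<le> l" if "l \<in> \<Delta>" "j < l" for l
    unfolding k_def using that by (intro Least_le) simp
  have ki: "k \<le> i" using least[OF k'(1,2)] k'(3) by simp
  have "minor k (x(j := x i)) h = h $$ (x i, j) * (\<Prod>a\<in>{..<k} - {j}. h $$ (x a, a))"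
    using minor_exchange[OF h ij(1) k(2) ki k(1) least] by blast
  moreover have "(\<Prod>a\<in>{..<k} - {j}. h $$ (x a, a)) \<noteq> 0" using diag ki ij(1) by auto
  ultimately show ?thesis using that[OF k ki] ij(4) by simp
qed

text \<open>
  The block LU decomposition.  The column \<open>j\<close> of the right factor is supported in the first \<open>lev j\<close>
  rows, where \<open>lev j\<close> is the level of the block of \<open>j\<close>, and is there the column \<open>j\<close> of the inverse of
  the corresponding flag minor.
\<close>
lemma cell_shape_exists:
  assumes \<Delta>: "\<Delta> \<subseteq> {..n}" and n: "0 < n" and g: "g \<in> carrier (SL n)" and x: "x permutes {..<n}"
    and nz: "\<And>k. k \<in> \<Delta> \<Longrightarrow> minor k x g \<noteq> 0"
  obtains q where "q \<in> flag_stab n \<Delta>" "cell_shape n \<Delta> x (g * q)"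
proof -
  define lev where "lev j = (LEAST k. k \<in> insert n \<Delta> \<and> j < k)" for j
  have lev: "lev j \<in> insert n \<Delta> \<and> j < lev j" if "j < n" for j
    unfolding lev_def by (rule LeastI[of _ n]) (use that in simp)
  have lev_le: "lev j \<le> k" if "k \<in> insert n \<Delta>" "j < k" for j k
    unfolding lev_def using that by (simp add: Least_le)
  have lev_n: "lev j \<le> n" if "j < n" for j using lev_le that by simp
  have xlt: "x i < n" if "i < n" for i using permutes_in_image[OF x, of i] that by simp
  have g': "g \<in> carrier_mat n n" "det g = 1" using g by auto
  have "\<exists>C. C \<in> carrier_mat k k \<and> mat k k (\<lambda>(i, j). g $$ (x i, j)) * C = 1\<^sub>m k" if "k \<in> insert n \<Delta>" for k
  proof -
    have "minor k x g \<noteq> 0" using that nz minor_permutes[OF x g'(1)] g'(2) by (auto simp: sign_def split: if_splits)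
    then show ?thesis
      using right_inverse_mat[of "mat k k (\<lambda>(i, j). g $$ (x i, j))" k] unfolding minor_def by auto
  qed
  then obtain C where C: "\<And>k. k \<in> insert n \<Delta> \<Longrightarrow> C k \<in> carrier_mat k k"
      "\<And>k. k \<in> insert n \<Delta> \<Longrightarrow> mat k k (\<lambda>(i, j). g $$ (x i, j)) * C k = 1\<^sub>m k"
    by metis
  define q0 where "q0 = mat n n (\<lambda>(i, j). if i < lev j then C (lev j) $$ (i, j) else 0)"
  have q0: "q0 \<in> carrier_mat n n" by (simp add: q0_def)
  have h0: "(g * q0) $$ (x a, j) = (if a = j then 1 else 0)" if "j < n" "a < lev j" for a j
  proof -
    let ?k = "lev j"
    have k: "?k \<in> insert n \<Delta>" "j < ?k" "?k \<le> n" using lev[OF that(1)] lev_n[OF that(1)] by auto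
    have "(g * q0) $$ (x a, j) = (\<Sum>l<n. g $$ (x a, l) * q0 $$ (l, j))"
      using g' q0 that k xlt by (auto simp: scalar_prod_def atLeast0LessThan)
    also have "\<dots> = (\<Sum>l<?k. g $$ (x a, l) * C ?k $$ (l, j))"
      by (rule sum.mono_neutral_cong_right) (use k that in \<open>auto simp: q0_def\<close>)
    also have "\<dots> = (mat ?k ?k (\<lambda>(i, j). g $$ (x i, j)) * C ?k) $$ (a, j)"
      using that k C(1)[OF k(1)] by (auto simp: scalar_prod_def atLeast0LessThan)
    finally show ?thesis using C(2)[OF k(1)] that k by simp
  qed
  have shape0: "cell_shape n \<Delta> x (g * q0)"
    unfolding cell_shape_def
  proof (intro allI impI)
    fix i j assume ij: "i < n" "j < n" "(g * q0) $$ (x i, j) \<noteq> 0"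
    show "i = j \<or> (\<exists>k\<in>\<Delta>. j < k \<and> k \<le> i)"
    proof (cases "i < lev j")
      case True
      then show ?thesis using h0[OF ij(2) True] ij(3) by (auto split: if_splits)
    next
      case False
      then show ?thesis using lev[OF ij(2)] ij(1) by auto
    qed
  qed
  have "minor n x (g * q0) = 1"
  proof -
    have "minor n x (g * q0) = (\<Prod>a<n. (g * q0) $$ (x a, a))" using minor_cell_shape[OF shape0] by simp
    also have "\<dots> = 1" using h0 lev by (intro prod.neutral) auto
    finally show ?thesis .
  qed
  then have "det (g * q0) \<noteq> 0" using minor_permutes[OF x, of "g * q0"] g' q0 by auto
  then have dq: "det q0 \<noteq> 0" using det_mult[OF g'(1) q0] by simp
  \<comment> \<open>scaling one column makes the determinant of the right factor \<open>1\<close>\<close>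
  define c where "c i = (if i = 0 then inverse (det q0) else 1)" for i :: nat
  have c: "c i \<noteq> 0" "(\<Prod>i<n. c i) = inverse (det q0)" for i
    using n dq unfolding c_def by (auto simp: prod.delta)
  define q where "q = q0 * diag n c"
  have q: "q \<in> carrier_mat n n" "det q = 1"
    using q0 c dq det_mult[OF q0, of "diag n c"] by (auto simp: q_def det_diag)
  show ?thesis
  proof (rule that[of q])
    have "q $$ (i, j) = 0" if "k \<in> \<Delta>" "i < n" "j < k" "k \<le> i" for k i j
    proof -
      have "lev j \<le> i" using lev_le[of k j] that by simp
      moreover have "j < n" using that by simp
      ultimately show ?thesis
        unfolding q_def using mult_diag_index[OF q0, of i j c] that by (simp add: q0_def)
    qed
    then show "q \<in> flag_stab n \<Delta>" using q by (auto simp: flag_stab_def)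
    have "(g * q) $$ (x i, j) = (g * q0) $$ (x i, j) * c j" if "i < n" "j < n" for i j
    proof -
      have "g * q = (g * q0) * diag n c"
        unfolding q_def using g' q0 by (simp add: assoc_mult_mat[of _ n n _ n _ n])
      then show ?thesis using mult_diag_index[of "g * q0" n "x i" j c] that g' q0 xlt by simp
    qed
    then show "cell_shape n \<Delta> x (g * q)"
      using shape0 unfolding cell_shape_def by auto
  qed
qed

subsection \<open>Fixed points\<close>

text \<open>Rows of matrices are counted from \<open>0\<close>, whereas permutations act on \<open>{1..n}\<close>.\<close>
definition row_perm :: "(nat \<Rightarrow> nat) \<Rightarrow> nat \<Rightarrow> nat" where
  "row_perm w i = w (Suc i) - 1"

lemma row_perm_permutes:
  assumes "w permutes {1..n}"
  shows "row_perm w permutes {..<n}"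
proof -
  have pos: "1 \<le> w (Suc i)" "w (Suc i) \<le> n \<longleftrightarrow> i < n" for i
    using permutes_in_image[OF assms, of "Suc i"] permutes_not_in[OF assms, of "Suc i"]
    by (cases "Suc i \<le> n"; auto)+
  have "inj (row_perm w)"
  proof (rule injI)
    fix i j assume "row_perm w i = row_perm w j"
    then have "w (Suc i) = w (Suc j)" using pos(1)[of i] pos(1)[of j] by (simp add: row_perm_def)
    then show "i = j" using permutes_inj[OF assms] by (metis injD nat.inject)
  qed
  moreover have "row_perm w i = i" if "i \<notin> {..<n}" for i
    using that permutes_not_in[OF assms, of "Suc i"] by (simp add: row_perm_def)
  moreover have "row_perm w ` {..<n} = {..<n}"
  proof (rule endo_inj_surj)
    show "row_perm w ` {..<n} \<subseteq> {..<n}"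
    proof (rule image_subsetI)
      fix i assume "i \<in> {..<n}"
      then show "row_perm w i \<in> {..<n}" using pos[of i] by (auto simp: row_perm_def)
    qed
    show "inj_on (row_perm w) {..<n}" using \<open>inj (row_perm w)\<close> by (rule inj_on_subset) simp
  qed simp
  moreover have "inj_on (row_perm w) {..<n}"
    using \<open>inj (row_perm w)\<close> by (rule inj_on_subset) simp
  ultimately show ?thesis
    by (intro bij_imp_permutes bij_betw_imageI) blast+
qed

lemma Suc_row_perm: "w permutes {1..n} \<Longrightarrow> Suc (row_perm w i) = w (Suc i)"
  using permutes_in_image[of w "{1..n}" "Suc i"] permutes_not_in[of w "{1..n}" "Suc i"]
  by (cases "Suc i \<le> n") (auto simp: row_perm_def)

lemma weyl_coset_row_perm:
  assumes "w permutes {1..n}"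
  shows "weyl_coset n w = {A \<in> carrier (SL n). \<forall>i<n. \<forall>j<n. A $$ (i, j) \<noteq> 0 \<longleftrightarrow> i = row_perm w j}"
  unfolding weyl_coset_def Suc_row_perm[OF assms, symmetric] by simp

definition monomial :: "nat \<Rightarrow> (nat \<Rightarrow> nat) \<Rightarrow> (nat \<Rightarrow> complex) \<Rightarrow> complex mat" where
  "monomial n x c = mat n n (\<lambda>(i, j). if i = x j then c j else 0)"

lemma monomial_carrier [simp]: "monomial n x c \<in> carrier_mat n n"
  by (simp add: monomial_def)

lemma cell_shape_monomial: "x permutes {..<n} \<Longrightarrow> cell_shape n \<Delta> x (monomial n x c)"
  unfolding cell_shape_def monomial_def
  using permutes_in_image[of x "{..<n}"] permutes_inj[of x "{..<n}"]
  by (auto simp: inj_eq)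

lemma monomial_index:
  "x permutes {..<n} \<Longrightarrow> i < n \<Longrightarrow> j < n \<Longrightarrow> monomial n x c $$ (x i, j) = (if i = j then c j else 0)"
  unfolding monomial_def using permutes_in_image[of x "{..<n}" i] permutes_inj[of x "{..<n}"]
  by (auto simp: inj_eq)

lemma det_monomial:
  assumes "x permutes {..<n}"
  shows "signof x * det (monomial n x c) = (\<Prod>i<n. c i)"
  using minor_cell_shape[OF cell_shape_monomial[OF assms, of "{}" c], of n]
    minor_permutes[OF assms monomial_carrier] monomial_index[OF assms, of _ _ c] by simp

lemma weyl_coset_nonempty:
  assumes w: "w permutes {1..n}" and n: "0 < n"
  obtains A where "A \<in> weyl_coset n w"
proof -
  \<comment> \<open>one entry absorbs the sign of the permutation\<close>
  define c :: "nat \<Rightarrow> complex" where "c i = (if i = 0 then signof (row_perm w) else 1)" for i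
  have c: "c i \<noteq> 0" "(\<Prod>i<n. c i) = signof (row_perm w)" for i
    using n unfolding c_def by (auto simp: prod.delta sign_def)
  have "det (monomial n (row_perm w) c) = 1"
    using det_monomial[OF row_perm_permutes[OF w], of c] c(2) by (auto simp: sign_def split: if_splits)
  then have "monomial n (row_perm w) c \<in> weyl_coset n w"
    unfolding weyl_coset_row_perm[OF w] using c(1) by (auto simp: monomial_def)
  then show ?thesis by (rule that)
qed

lemma minor_weyl_nonzero:
  assumes w: "w permutes {1..n}" and A: "A \<in> weyl_coset n w" and k: "k \<le> n"
  shows "minor k (row_perm w) A \<noteq> 0"
proof -
  have x: "row_perm w permutes {..<n}" by (rule row_perm_permutes[OF w])
  have xlt: "row_perm w i < n" if "i < n" for i using permutes_in_image[OF x, of i] that by simp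
  have pat: "A $$ (i, j) \<noteq> 0 \<longleftrightarrow> i = row_perm w j" if "i < n" "j < n" for i j
    using A that unfolding weyl_coset_row_perm[OF w] by blast
  have "cell_shape n {} (row_perm w) A"
    unfolding cell_shape_def using pat xlt permutes_inj[OF x] by (auto simp: inj_eq)
  then have "minor k (row_perm w) A = (\<Prod>a<k. A $$ (row_perm w a, a))" using minor_cell_shape k by blast
  also have "\<dots> \<noteq> 0" using pat xlt k by auto
  finally show ?thesis .
qed

lemma mult_weyl_index:
  assumes w: "w permutes {1..n}" and A: "A \<in> weyl_coset n w" and b: "b \<in> carrier_mat n n"
    and ij: "i < n" "j < n"
  shows "(b * A) $$ (i, j) = b $$ (i, row_perm w j) * A $$ (row_perm w j, j)"
proof -
  have x: "row_perm w permutes {..<n}" by (rule row_perm_permutes[OF w])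
  have xj: "row_perm w j < n" using permutes_in_image[OF x, of j] ij by simp
  have pat: "A $$ (l, j) \<noteq> 0 \<longleftrightarrow> l = row_perm w j" if "l < n" for l
    using A that ij unfolding weyl_coset_row_perm[OF w] by blast
  have Am: "A \<in> carrier_mat n n" using A by (simp add: weyl_coset_def)
  have "(b * A) $$ (i, j) = (\<Sum>l<n. b $$ (i, l) * A $$ (l, j))"
    using b Am ij by (auto simp: scalar_prod_def atLeast0LessThan)
  also have "\<dots> = (\<Sum>l\<in>{row_perm w j}. b $$ (i, l) * A $$ (l, j))"
    by (rule sum.mono_neutral_right) (use pat xj in auto)
  finally show ?thesis by simp
qed

lemma weyl_coset_torus:
  assumes w: "w permutes {1..n}" and A: "A \<in> weyl_coset n w" and B: "B \<in> weyl_coset n w"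
  shows "\<exists>t\<in>torus n. B = A * t"
proof -
  let ?x = "row_perm w"
  have x: "?x permutes {..<n}" by (rule row_perm_permutes[OF w])
  have xlt: "?x j < n" if "j < n" for j using permutes_in_image[OF x, of j] that by simp
  define c where "c j = B $$ (?x j, j) / A $$ (?x j, j)" for j
  have nz: "i < n \<Longrightarrow> j < n \<Longrightarrow> A $$ (i, j) \<noteq> 0 \<longleftrightarrow> i = ?x j"
    "i < n \<Longrightarrow> j < n \<Longrightarrow> B $$ (i, j) \<noteq> 0 \<longleftrightarrow> i = ?x j" for i j
    using A B unfolding weyl_coset_row_perm[OF w] by auto
  have carr: "A \<in> carrier_mat n n" "B \<in> carrier_mat n n" "det A = 1" "det B = 1"
    using A B by (auto simp: weyl_coset_def)
  have eq: "B = A * diag n c"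
  proof (rule eq_matI)
    fix i j assume "i < dim_row (A * diag n c)" "j < dim_col (A * diag n c)"
    then have ij: "i < n" "j < n" using carr by (auto simp: diag_def)
    show "B $$ (i, j) = (A * diag n c) $$ (i, j)"
      using mult_diag_index[OF carr(1) ij, of c] nz(1)[OF ij] nz(2)[OF ij] by (auto simp: c_def)
  qed (use carr in \<open>auto simp: diag_def\<close>)
  then have "det (diag n c) = 1" using det_mult[OF carr(1), of "diag n c"] carr by simp
  then have "diag n c \<in> torus n" by (intro diag_in_torus) (simp add: det_diag)
  then show ?thesis using eq by blast
qed

context homogeneous_space begin

text \<open>
  Two representatives of a Weyl group element differ by an element of the torus, which is contained in \<open>Q\<close>.
\<close>
lemma fixed_point_eq_pt:
  assumes w: "w permutes {1..n}" and A: "A \<in> weyl_coset n w"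
  shows "fixed_point n Q w = pt A"
proof -
  have "B * q \<in> pt A" if "B \<in> weyl_coset n w" "q \<in> Q" for B q
  proof -
    obtain t where t: "t \<in> torus n" "B = A * t" using weyl_coset_torus[OF w A \<open>B \<in> weyl_coset n w\<close>] by blast
    have "B * q = A * (t * q)"
      using t A \<open>q \<in> Q\<close> Q_carrier[OF \<open>q \<in> Q\<close>] torus_carrier_mat[OF t(1)]
      by (auto simp: weyl_coset_def assoc_mult_mat[of _ n n _ n _ n])
    moreover have "t * q \<in> Q" using subgroup.m_closed[OF subgroup, of t q] torus_le t \<open>q \<in> Q\<close> by auto
    ultimately show ?thesis by (auto simp: l_coset_def)
  qed
  then show ?thesis
    using A unfolding fixed_point_def set_mult_def l_coset_def by auto
qed

lemma schubert_variety_eq: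
  assumes w: "w permutes {1..n}" and A: "A \<in> weyl_coset n w"
  shows "schubert_variety n Q w = homog_topology n Q closure_of ((\<lambda>b. pt (b * A)) ` borel n)"
proof -
  have "b <#\<^bsub>SL n\<^esub> fixed_point n Q w = pt (b * A)" if "b \<in> borel n" for b
    unfolding fixed_point_eq_pt[OF w A]
    using left_mult_pt[of b A] that A by (auto simp: borel_def weyl_coset_def)
  then show ?thesis unfolding schubert_variety_def by (metis (no_types, lifting) image_cong)
qed

end

section \<open>Characters of the torus\<close>

definition torus_char :: "nat \<Rightarrow> (nat \<Rightarrow> int) \<Rightarrow> complex mat \<Rightarrow> complex" where
  "torus_char n e t = (if t \<in> torus n then \<Prod>i<n. t $$ (i, i) powi e i else 0)"

lemma characters_eq: "characters n = range (torus_char n)"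
  unfolding characters_def torus_char_def[abs_def] by auto

lemma torus_char_mult: "torus_char n e t * torus_char n f t = torus_char n (\<lambda>i. e i + f i) t"
  by (auto simp: torus_char_def power_int_add torus_nonzero prod.distrib)

lemma one_torus: "1\<^sub>m n \<in> torus n"
  by (auto simp: torus_def)

lemma characters_hom:
  assumes "\<chi> \<in> characters n" "s \<in> torus n" "t \<in> torus n"
  shows "\<chi> (s * t) = \<chi> s * \<chi> t"
proof -
  obtain e where \<chi>: "\<chi> = torus_char n e" using assms(1) by (auto simp: characters_eq)
  have "(s * t) $$ (i, i) = s $$ (i, i) * t $$ (i, i)" if "i < n" for i
    using torus_mult_index[OF assms(2) torus_carrier_mat[OF assms(3)] that that] .
  then show ?thesis
    unfolding \<chi> torus_char_def using assms torus_mult_closed[OF assms(2,3)]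
    by (simp add: power_int_mult_distrib prod.distrib)
qed

lemma characters_nonzero: "\<chi> \<in> characters n \<Longrightarrow> t \<in> torus n \<Longrightarrow> \<chi> t \<noteq> 0"
  by (auto simp: characters_eq torus_char_def torus_nonzero)

lemma characters_one: "\<chi> \<in> characters n \<Longrightarrow> \<chi> (1\<^sub>m n) = 1"
  by (auto simp: characters_eq torus_char_def one_torus)

lemma characters_outside: "\<chi> \<in> characters n \<Longrightarrow> t \<notin> torus n \<Longrightarrow> \<chi> t = 0"
  by (auto simp: characters_eq torus_char_def)

lemma characters_mult_closed: "\<chi> \<in> characters n \<Longrightarrow> \<psi> \<in> characters n \<Longrightarrow> (\<lambda>t. \<chi> t * \<psi> t) \<in> characters n"
  by (auto simp: characters_eq torus_char_mult)

text \<open>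
  Dedekind's argument: the difference of a linear relation and its translate by an element on which two of
  the characters differ is a shorter relation.
\<close>
lemma characters_independent:
  assumes "finite F" "F \<subseteq> characters n" "\<And>t. t \<in> torus n \<Longrightarrow> (\<Sum>\<chi>\<in>F. c \<chi> * \<chi> t) = 0"
  shows "\<forall>\<chi>\<in>F. c \<chi> = 0"
  using assms
proof (induction F arbitrary: c rule: finite_induct)
  case (insert \<psi> F)
  have zero: "c \<chi> = 0" if \<chi>: "\<chi> \<in> F" for \<chi>
  proof -
    have "\<exists>s\<in>torus n. \<chi> s \<noteq> \<psi> s"
    proof (rule ccontr)
      assume "\<not> ?thesis"
      then have "\<chi> t = \<psi> t" for t
        using characters_outside[of \<chi> n t] characters_outside[of \<psi> n t] insert.prems(1) \<chi>
        by (cases "t \<in> torus n") auto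
      then have "\<chi> = \<psi>" by (rule ext)
      then show False using \<chi> insert.hyps by auto
    qed
    then obtain s where s: "s \<in> torus n" "\<chi> s \<noteq> \<psi> s" by blast
    have "\<forall>\<xi>\<in>F. c \<xi> * (\<xi> s - \<psi> s) = 0"
    proof (rule insert.IH)
      fix t assume t: "t \<in> torus n"
      have "(\<Sum>\<xi>\<in>insert \<psi> F. c \<xi> * \<xi> (s * t)) - \<psi> s * (\<Sum>\<xi>\<in>insert \<psi> F. c \<xi> * \<xi> t) = 0"
        using insert.prems(2)[OF torus_mult_closed[OF s(1) t]] insert.prems(2)[OF t] by simp
      moreover have "(\<Sum>\<xi>\<in>insert \<psi> F. c \<xi> * \<xi> (s * t)) = (\<Sum>\<xi>\<in>insert \<psi> F. c \<xi> * (\<xi> s * \<xi> t))"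
      proof (rule sum.cong[OF refl])
        fix \<xi> assume "\<xi> \<in> insert \<psi> F"
        then have "\<xi> (s * t) = \<xi> s * \<xi> t"
          using characters_hom[OF _ s(1) t] insert.prems(1) by blast
        then show "c \<xi> * \<xi> (s * t) = c \<xi> * (\<xi> s * \<xi> t)" by simp
      qed
      ultimately have "(\<Sum>\<xi>\<in>insert \<psi> F. c \<xi> * (\<xi> s * \<xi> t) - \<psi> s * (c \<xi> * \<xi> t)) = 0"
        by (simp only: sum_subtractf sum_distrib_left)
      moreover have "c \<psi> * (\<psi> s * \<psi> t) - \<psi> s * (c \<psi> * \<psi> t) = 0" by simp
      ultimately have "(\<Sum>\<xi>\<in>F. c \<xi> * (\<xi> s * \<xi> t) - \<psi> s * (c \<xi> * \<xi> t)) = 0"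
        using insert.hyps by simp
      then show "(\<Sum>\<xi>\<in>F. c \<xi> * (\<xi> s - \<psi> s) * \<xi> t) = 0"
        by (simp add: algebra_simps)
    qed (use insert.prems in auto)
    then show ?thesis using \<chi> s(2) by auto
  qed
  have "(\<Sum>\<chi>\<in>insert \<psi> F. c \<chi> * \<chi> (1\<^sub>m n)) = 0" using insert.prems(2) one_torus by blast
  then have "c \<psi> = 0"
    using insert.hyps zero characters_one[of \<psi> n] insert.prems(1) by simp
  then show ?case using zero by blast
qed simp

text \<open>The exponents of \<open>\<Prod> t\<^bsub>r a\<^esub> / t\<^bsub>x a\<^esub>\<close>, the weight of a ratio of two flag minors.\<close>
definition weight_exp :: "nat \<Rightarrow> (nat \<Rightarrow> nat) \<Rightarrow> (nat \<Rightarrow> nat) \<Rightarrow> nat \<Rightarrow> int" where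
  "weight_exp k r x i = (\<Sum>a<k. of_bool (r a = i) - of_bool (x a = i))"

lemma torus_char_weight_exp:
  assumes t: "t \<in> torus n" and "\<And>a. a < k \<Longrightarrow> r a < n" "\<And>a. a < k \<Longrightarrow> x a < n"
  shows "torus_char n (weight_exp k r x) t = (\<Prod>a<k. t $$ (r a, r a) / t $$ (x a, x a))"
  using assms(2,3)
proof (induction k)
  case 0
  then show ?case using t by (simp add: torus_char_def weight_exp_def)
next
  case (Suc k)
  have single: "(\<Prod>i<n. t $$ (i, i) powi of_bool (b = i)) = t $$ (b, b)" if "b < n" for b
  proof -
    have "(\<Prod>i<n. t $$ (i, i) powi of_bool (b = i)) = (\<Prod>i<n. if b = i then t $$ (i, i) else 1)"
      by (intro prod.cong) auto
    then show ?thesis using that by (simp add: prod.delta)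
  qed
  have "(\<Prod>i<n. t $$ (i, i) powi (of_bool (r k = i) - of_bool (x k = i))) = t $$ (r k, r k) / t $$ (x k, x k)"
    using single[of "r k"] single[of "x k"] Suc.prems
    by (simp add: power_int_diff torus_nonzero[OF t] prod_dividef)
  then show ?case
    using Suc t by (simp add: torus_char_def weight_exp_def power_int_add torus_nonzero[OF t] prod.distrib)
qed

lemma sum_weight_exp:
  fixes a :: "nat \<Rightarrow> real"
  assumes "\<And>b. b < k \<Longrightarrow> r b < n" "\<And>b. b < k \<Longrightarrow> x b < n"
  shows "(\<Sum>i<n. a i * real_of_int (weight_exp k r x i)) = (\<Sum>b<k. a (r b)) - (\<Sum>b<k. a (x b))"
proof -
  have single: "(\<Sum>i<n. a i * of_bool (b = i)) = a b" if "b < n" for b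
  proof -
    have "(\<Sum>i<n. a i * of_bool (b = i)) = (\<Sum>i<n. if b = i then a i else 0)"
      by (intro sum.cong) auto
    then show ?thesis using that by (simp add: sum.delta)
  qed
  have "(\<Sum>i<n. a i * real_of_int (weight_exp k r x i))
      = (\<Sum>b<k. \<Sum>i<n. a i * of_bool (r b = i) - a i * of_bool (x b = i))"
    unfolding weight_exp_def by (simp add: sum_distrib_left right_diff_distrib) (rule sum.swap)
  then show ?thesis using single assms by (simp add: sum_subtractf)
qed

section \<open>Rational cones and their duals\<close>

text \<open>
  Farkas' lemma for a real functional \<open>\<nu>\<close>, with integral generators and only lattice points as test vectors.
  In the induction step a test vector on which all generators but the new one are nonnegative and \<open>\<nu>\<close>
  is negative projects the problem onto the kernel of the new generator; the coefficients of the projection are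
  values of an integral functional, so the projection stays in the lattice.  The operation \<open>comb\<close> forms
  integral linear combinations in a lattice that may be written multiplicatively.
\<close>
lemma integral_farkas:
  fixes \<rho> :: "'i \<Rightarrow> 'h \<Rightarrow> real" and \<nu> :: "'h \<Rightarrow> real" and comb :: "int \<Rightarrow> 'h \<Rightarrow> int \<Rightarrow> 'h \<Rightarrow> 'h"
  assumes "finite I"
    and closed: "\<And>a x b y. x \<in> H \<Longrightarrow> y \<in> H \<Longrightarrow> comb a x b y \<in> H"
    and "\<And>i a x b y. i \<in> I \<Longrightarrow> x \<in> H \<Longrightarrow> y \<in> H \<Longrightarrow> \<rho> i (comb a x b y) = of_int a * \<rho> i x + of_int b * \<rho> i y"
    and "\<And>i x. i \<in> I \<Longrightarrow> x \<in> H \<Longrightarrow> \<rho> i x \<in> \<int>"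
    and "\<And>a x b y. x \<in> H \<Longrightarrow> y \<in> H \<Longrightarrow> \<nu> (comb a x b y) = of_int a * \<nu> x + of_int b * \<nu> y"
    and "\<And>x. x \<in> H \<Longrightarrow> (\<forall>i\<in>I. 0 \<le> \<rho> i x) \<Longrightarrow> 0 \<le> \<nu> x"
  shows "\<exists>c. (\<forall>i\<in>I. 0 \<le> c i) \<and> (\<forall>x\<in>H. \<nu> x = (\<Sum>i\<in>I. c i * \<rho> i x))"
  using assms(1,3-)
proof (induction I arbitrary: \<rho> \<nu> rule: finite_induct)
  case empty
  have "\<nu> x = 0" if x: "x \<in> H" for x
  proof -
    have "0 \<le> \<nu> x" using empty.prems(4)[OF x] by simp
    moreover have "0 \<le> - \<nu> x"
      using empty.prems(4)[OF closed[OF x x, of "-1" 0]] empty.prems(3)[OF x x, of "-1" 0] by simp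
    ultimately show ?thesis by simp
  qed
  then show ?case by simp
next
  case (insert k I)
  show ?case
  proof (cases "\<forall>x\<in>H. (\<forall>i\<in>I. 0 \<le> \<rho> i x) \<longrightarrow> 0 \<le> \<nu> x")
    case True
    have "\<exists>c. (\<forall>i\<in>I. 0 \<le> c i) \<and> (\<forall>x\<in>H. \<nu> x = (\<Sum>i\<in>I. c i * \<rho> i x))"
    proof (rule insert.IH)
      fix x assume "x \<in> H" "\<forall>i\<in>I. 0 \<le> \<rho> i x"
      then show "0 \<le> \<nu> x" using True by blast
    qed (use insert.prems in auto)
    then obtain c where c: "\<forall>i\<in>I. 0 \<le> c i" "\<forall>x\<in>H. \<nu> x = (\<Sum>i\<in>I. c i * \<rho> i x)" by blast
    have "(\<Sum>i\<in>I. (c(k := 0)) i * \<rho> i x) = (\<Sum>i\<in>I. c i * \<rho> i x)" for x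
      using insert.hyps by (intro sum.cong) auto
    then show ?thesis
      using c insert.hyps by (intro exI[of _ "c(k := 0)"]) auto
  next
    case False
    then obtain z where z: "z \<in> H" "\<forall>i\<in>I. 0 \<le> \<rho> i z" "\<nu> z < 0" by force
    then have neg: "\<rho> k z < 0" using insert.prems(4)[OF z(1)] by force
    obtain b :: int where b: "\<rho> k z = - of_int b"
      using insert.prems(2)[of k z] z(1) by (metis Ints_cases insertI1 minus_minus of_int_minus)
    have b0: "real_of_int b > 0" using neg b by simp
    define \<rho>' where "\<rho>' i x = of_int b * \<rho> i x + \<rho> k x * \<rho> i z" for i x
    define \<nu>' where "\<nu>' x = of_int b * \<nu> x + \<rho> k x * \<nu> z" for x
    have "\<exists>c. (\<forall>i\<in>I. 0 \<le> c i) \<and> (\<forall>x\<in>H. \<nu>' x = (\<Sum>i\<in>I. c i * \<rho>' i x))"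
    proof (rule insert.IH)
      fix x assume x: "x \<in> H" "\<forall>i\<in>I. 0 \<le> \<rho>' i x"
      obtain m :: int where m: "\<rho> k x = of_int m"
        using insert.prems(2)[of k x] x(1) by (metis Ints_cases insertI1)
      let ?y = "comb b x m z"
      have \<rho>y: "\<rho> i ?y = \<rho>' i x" if "i \<in> insert k I" for i
        using insert.prems(1)[OF that x(1) z(1), of b m] by (simp add: \<rho>'_def m)
      have "\<rho> k ?y = 0" using \<rho>y[of k] by (simp add: \<rho>'_def m b)
      then have "0 \<le> \<nu> ?y"
        using insert.prems(4)[OF closed[OF x(1) z(1)], of b m] \<rho>y x(2) by auto
      then show "0 \<le> \<nu>' x"
        using insert.prems(3)[OF x(1) z(1), of b m] by (simp add: \<nu>'_def m)
    next
      fix i x assume "i \<in> I" "x \<in> H"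
      then show "\<rho>' i x \<in> \<int>" unfolding \<rho>'_def using insert.prems(2) z(1) by auto
    qed (use insert.prems(1,3) in \<open>auto simp: \<rho>'_def \<nu>'_def algebra_simps\<close>)
    then obtain c where c: "\<forall>i\<in>I. 0 \<le> c i" "\<forall>x\<in>H. \<nu>' x = (\<Sum>i\<in>I. c i * \<rho>' i x)" by blast
    define ck where "ck = ((\<Sum>i\<in>I. c i * \<rho> i z) - \<nu> z) / of_int b"
    have "0 \<le> (\<Sum>i\<in>I. c i * \<rho> i z)" using c(1) z(2) by (intro sum_nonneg) auto
    then have "0 \<le> ck" unfolding ck_def using z(3) b0 by simp
    moreover have "\<nu> x = ck * \<rho> k x + (\<Sum>i\<in>I. c i * \<rho> i x)" if x: "x \<in> H" for x
    proof -
      have "of_int b * \<nu> x + \<rho> k x * \<nu> z = (\<Sum>i\<in>I. c i * (of_int b * \<rho> i x + \<rho> k x * \<rho> i z))"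
        using c(2) x by (simp add: \<nu>'_def \<rho>'_def)
      also have "\<dots> = of_int b * (\<Sum>i\<in>I. c i * \<rho> i x) + \<rho> k x * (\<Sum>i\<in>I. c i * \<rho> i z)"
        by (simp add: sum_distrib_left sum.distrib algebra_simps)
      finally show ?thesis using b0 unfolding ck_def by (simp add: field_simps)
    qed
    moreover have "(\<Sum>i\<in>I. (c(k := ck)) i * \<rho> i x) = (\<Sum>i\<in>I. c i * \<rho> i x)" for x
      using insert.hyps by (intro sum.cong) auto
    ultimately show ?thesis
      using c(1) insert.hyps by (intro exI[of _ "c(k := ck)"]) auto
  qed
qed

text \<open>
  The real numbers are divisible, so a homomorphism from a subgroup of \<open>\<int>\<^sup>m\<close> to the real numbers extends to
  \<open>\<int>\<^sup>m\<close>.  In the induction step the last coordinates of the elements of the subgroup form a cyclic group, and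
  the value on an element whose last coordinate is a generator determines the new coefficient.
\<close>
lemma additive_extends:
  fixes \<phi> :: "(nat \<Rightarrow> int) \<Rightarrow> real"
  assumes closed: "\<And>a b e f. e \<in> H \<Longrightarrow> f \<in> H \<Longrightarrow> (\<lambda>i. a * e i + b * f i) \<in> H"
    and lin: "\<And>a b e f. e \<in> H \<Longrightarrow> f \<in> H \<Longrightarrow> \<phi> (\<lambda>i. a * e i + b * f i) = of_int a * \<phi> e + of_int b * \<phi> f"
  shows "\<exists>a. \<forall>e\<in>H. (\<forall>i\<ge>m. e i = 0) \<longrightarrow> \<phi> e = (\<Sum>i<m. a i * of_int (e i))"
proof (induction m)
  case 0
  have zero: "\<phi> e = 0" if e: "e \<in> H" "\<forall>i. e i = 0" for e
  proof -
    have "(\<lambda>i. 0 * e i + 0 * e i) = e" using e(2) by auto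
    then show ?thesis using lin[OF e(1) e(1), of 0 0] by simp
  qed
  show ?case
  proof (intro exI[of _ "\<lambda>_. 0"] ballI impI)
    fix e assume "e \<in> H" "\<forall>i\<ge>0. e i = 0"
    then have "\<phi> e = 0" using zero by blast
    then show "\<phi> e = (\<Sum>i<0. 0 * real_of_int (e i))" by simp
  qed
next
  case (Suc m)
  then obtain a where a: "\<And>e. e \<in> H \<Longrightarrow> \<forall>i\<ge>m. e i = 0 \<Longrightarrow> \<phi> e = (\<Sum>i<m. a i * of_int (e i))" by blast
  define K where "K = {e \<in> H. \<forall>i\<ge>Suc m. e i = 0}"
  show ?case
  proof (cases "\<exists>e\<in>K. 0 < e m")
    case True
    then obtain p where p: "p \<in> K" "0 < p m" and least: "\<And>e. e \<in> K \<Longrightarrow> 0 < e m \<Longrightarrow> nat (p m) \<le> nat (e m)"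
      using ex_has_least_nat[of "\<lambda>e. e \<in> K \<and> 0 < e m" _ "\<lambda>e. nat (e m)"] by blast
    define am where "am = (\<phi> p - (\<Sum>i<m. a i * of_int (p i))) / of_int (p m)"
    have "\<phi> e = (\<Sum>i<m. a i * of_int (e i)) + am * of_int (e m)" if e: "e \<in> K" for e
    proof -
      let ?q = "e m div p m"
      define e' where "e' = (\<lambda>i. 1 * e i + (- ?q) * p i)"
      have HK: "e \<in> H" "p \<in> H" using e p by (auto simp: K_def)
      have e'H: "e' \<in> H" unfolding e'_def by (rule closed[OF HK])
      have e'K: "e' \<in> K" using e'H e p by (auto simp: K_def e'_def)
      have "e' m = e m mod p m" unfolding e'_def by (simp add: minus_div_mult_eq_mod algebra_simps)
      moreover have "0 \<le> e m mod p m" "e m mod p m < p m" using p(2) by auto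
      ultimately have e'm: "e' m = 0" using least[OF e'K] by force
      have "\<forall>i\<ge>m. e' i = 0"
        using e'K e'm unfolding K_def by (metis (mono_tags, lifting) le_antisym mem_Collect_eq not_less_eq_eq)
      then have "\<phi> e' = (\<Sum>i<m. a i * of_int (e' i))" using a[OF e'H] by blast
      also have "\<dots> = (\<Sum>i<m. a i * of_int (e i)) - of_int ?q * (\<Sum>i<m. a i * of_int (p i))"
        unfolding e'_def by (simp add: sum_distrib_left sum_subtractf algebra_simps)
      finally have "\<phi> e = (\<Sum>i<m. a i * of_int (e i)) + of_int ?q * (\<phi> p - (\<Sum>i<m. a i * of_int (p i)))"
        using lin[OF HK, of 1 "- ?q"] unfolding e'_def by (simp add: algebra_simps)
      moreover have "real_of_int (e m) = of_int ?q * of_int (p m)"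
        using e'm unfolding e'_def by (simp flip: of_int_mult)
      moreover have "real_of_int (p m) \<noteq> 0" using p(2) by simp
      ultimately show ?thesis unfolding am_def by simp
    qed
    moreover have "(\<Sum>i<m. (a(m := am)) i * of_int (e i)) = (\<Sum>i<m. a i * of_int (e i))" for e :: "nat \<Rightarrow> int"
      by (intro sum.cong) auto
    ultimately show ?thesis by (intro exI[of _ "a(m := am)"]) (auto simp: K_def)
  next
    case False
    have "e m = 0" if e: "e \<in> K" for e
    proof (rule ccontr)
      assume "e m \<noteq> 0"
      have eH: "e \<in> H" using e by (simp add: K_def)
      have K: "(\<lambda>i. (-1) * e i + 0 * e i) \<in> K" using closed[OF eH eH, of "-1" 0] e by (auto simp: K_def)
      have "\<forall>f\<in>K. \<not> 0 < f m" using False by blast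
      from bspec[OF this K] bspec[OF this e] \<open>e m \<noteq> 0\<close> show False by simp
    qed
    then have "\<forall>i\<ge>m. e i = 0" if "e \<in> K" for e
      using that unfolding K_def by (metis (mono_tags, lifting) le_antisym mem_Collect_eq not_less_eq_eq that)
    then have "\<phi> e = (\<Sum>i<m. (a(m := 0)) i * of_int (e i)) + 0" if "e \<in> K" for e
      using a that by (auto simp: K_def intro!: sum.cong)
    then show ?thesis by (intro exI[of _ "a(m := 0)"]) (auto simp: K_def)
  qed
qed

definition annihilator :: "nat \<Rightarrow> complex mat set \<Rightarrow> (complex mat \<Rightarrow> complex) set" where
  "annihilator n S = {\<chi> \<in> characters n. \<forall>t\<in>S. \<chi> t = 1}"

lemma power_int_prod_lessThan: "(\<Prod>i<n. f i) powi a = (\<Prod>i<n. (f i :: complex) powi a)" for n :: nat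
  by (induction n) (simp_all add: power_int_mult_distrib)

lemma torus_char_comb:
  "t \<in> torus n \<Longrightarrow> torus_char n (\<lambda>i. a * e i + b * f i) t = torus_char n e t powi a * torus_char n f t powi b"
  by (simp add: torus_char_def power_int_add torus_nonzero prod.distrib power_int_mult
      mult.commute[of a] mult.commute[of b] power_int_prod_lessThan)

lemma annihilator_comb:
  assumes "S \<subseteq> torus n" "torus_char n e \<in> annihilator n S" "torus_char n f \<in> annihilator n S"
  shows "torus_char n (\<lambda>i. a * e i + b * f i) \<in> annihilator n S"
proof -
  have "torus_char n (\<lambda>i. a * e i + b * f i) t = 1" if t: "t \<in> S" for t
    using assms t torus_char_comb[of t n a e b f] unfolding annihilator_def by auto
  then show ?thesis unfolding annihilator_def characters_eq by auto
qed

lemma N_real_comb: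
  assumes S: "S \<subseteq> torus n" and \<nu>: "\<nu> \<in> N_real (annihilator n S)"
    and e: "torus_char n e \<in> annihilator n S" and f: "torus_char n f \<in> annihilator n S"
  shows "\<nu> (torus_char n (\<lambda>i. a * e i + b * f i)) = of_int a * \<nu> (torus_char n e) + of_int b * \<nu> (torus_char n f)"
proof -
  define M where "M = annihilator n S"
  have add: "\<nu> (torus_char n (\<lambda>i. e i + f i)) = \<nu> (torus_char n e) + \<nu> (torus_char n f)"
    if "torus_char n e \<in> M" "torus_char n f \<in> M" for e f
  proof -
    have "\<nu> (\<lambda>t. torus_char n e t * torus_char n f t) = \<nu> (torus_char n e) + \<nu> (torus_char n f)"
      using \<nu> that unfolding N_real_def M_def by blast
    then show ?thesis by (simp add: torus_char_mult)
  qed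
  have mem: "torus_char n (\<lambda>i. a * e i) \<in> M" if "torus_char n e \<in> M" for a e
    using annihilator_comb[OF S, of e e a 0] that by (simp add: M_def)
  have nat_mult: "\<nu> (torus_char n (\<lambda>i. int k * e i)) = real k * \<nu> (torus_char n e)"
    if "torus_char n e \<in> M" for k e
  proof (induction k)
    case 0
    have "torus_char n (\<lambda>i. 0) \<in> M" using mem[OF that, of 0] by simp
    then show ?case using add[of "\<lambda>_. 0" "\<lambda>_. 0"] by simp
  next
    case (Suc k)
    have "(\<lambda>i. int (Suc k) * e i) = (\<lambda>i. int k * e i + e i)" by (auto simp: algebra_simps)
    then show ?case using add[OF mem[OF that, of "int k"] that] Suc by (simp add: algebra_simps)
  qed
  have mult: "\<nu> (torus_char n (\<lambda>i. a * e i)) = of_int a * \<nu> (torus_char n e)"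
    if "torus_char n e \<in> M" for a e
  proof (cases "0 \<le> a")
    case True
    then show ?thesis using nat_mult[OF that, of "nat a"] by simp
  next
    case False
    have "torus_char n (\<lambda>i. 0) \<in> M" using mem[OF that, of 0] by simp
    then have z: "\<nu> (torus_char n (\<lambda>i. 0)) = 0" using nat_mult[of "\<lambda>_. 0" 0] by simp
    have "(\<lambda>i. a * e i + int (nat (- a)) * e i) = (\<lambda>i. 0)" using False by (auto simp: algebra_simps)
    then have "\<nu> (torus_char n (\<lambda>i. a * e i)) + real (nat (- a)) * \<nu> (torus_char n e) = 0"
      using add[OF mem[OF that, of a] mem[OF that, of "int (nat (- a))"]] nat_mult[OF that, of "nat (- a)"] z
      by simp
    then show ?thesis using False by (simp add: algebra_simps)
  qed
  show ?thesis
    using add[OF mem[of e a] mem[of f b]] mult[of e a] mult[of f b] e f by (simp add: M_def)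
qed

lemma gen_cone_subset_N_real:
  assumes "finite R" "R \<subseteq> N_lattice M"
  shows "gen_cone R \<subseteq> N_real M"
proof
  fix \<nu> assume "\<nu> \<in> gen_cone R"
  then obtain c where \<nu>: "\<nu> = (\<lambda>\<chi>. \<Sum>\<rho>\<in>R. c \<rho> * \<rho> \<chi>)" by (auto simp: gen_cone_def)
  have R: "\<rho> \<in> N_real M" if "\<rho> \<in> R" for \<rho> using that assms by (auto simp: N_lattice_def)
  have "\<nu> \<chi> = 0" if "\<chi> \<notin> M" for \<chi>
    unfolding \<nu> using R that by (intro sum.neutral) (auto simp: N_real_def)
  moreover have "\<nu> (\<lambda>t. \<chi> t * \<psi> t) = \<nu> \<chi> + \<nu> \<psi>" if "\<chi> \<in> M" "\<psi> \<in> M" for \<chi> \<psi>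
  proof -
    have "(\<Sum>\<rho>\<in>R. c \<rho> * \<rho> (\<lambda>t. \<chi> t * \<psi> t)) = (\<Sum>\<rho>\<in>R. c \<rho> * \<rho> \<chi> + c \<rho> * \<rho> \<psi>)"
    proof (rule sum.cong[OF refl])
      fix \<rho> assume "\<rho> \<in> R"
      then have "\<rho> (\<lambda>t. \<chi> t * \<psi> t) = \<rho> \<chi> + \<rho> \<psi>"
        using R[of \<rho>] that by (simp add: N_real_def)
      then show "c \<rho> * \<rho> (\<lambda>t. \<chi> t * \<psi> t) = c \<rho> * \<rho> \<chi> + c \<rho> * \<rho> \<psi>" by (simp add: distrib_left)
    qed
    then show ?thesis unfolding \<nu> by (simp add: sum.distrib)
  qed
  ultimately show "\<nu> \<in> N_real M" by (simp add: N_real_def)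
qed

lemma strongly_convex_rational_cone_subset:
  "strongly_convex_rational_cone M \<sigma> \<Longrightarrow> \<sigma> \<subseteq> N_real M"
  unfolding strongly_convex_rational_cone_def using gen_cone_subset_N_real by blast

text \<open>Farkas' lemma for the generators of the cone, tested on the characters of the lattice.\<close>
lemma rational_cone_double_dual:
  assumes S: "S \<subseteq> torus n" and M: "M = annihilator n S" and \<sigma>: "strongly_convex_rational_cone M \<sigma>"
    and \<nu>: "\<nu> \<in> N_real M" "\<And>\<chi>. \<chi> \<in> dual_monoid M \<sigma> \<Longrightarrow> 0 \<le> \<nu> \<chi>"
  shows "\<nu> \<in> \<sigma>"
proof -
  obtain R where R: "finite R" "R \<subseteq> N_lattice M" "\<sigma> = gen_cone R"
    using \<sigma> unfolding strongly_convex_rational_cone_def by blast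
  have RN: "\<rho> \<in> N_real M" "\<And>\<chi>. \<chi> \<in> M \<Longrightarrow> \<rho> \<chi> \<in> \<int>" if "\<rho> \<in> R" for \<rho>
    using that R(2) by (auto simp: N_lattice_def)
  define H where "H = {e. torus_char n e \<in> M}"
  have "\<exists>c. (\<forall>\<rho>\<in>R. 0 \<le> c \<rho>) \<and> (\<forall>e\<in>H. \<nu> (torus_char n e) = (\<Sum>\<rho>\<in>R. c \<rho> * \<rho> (torus_char n e)))"
  proof (rule integral_farkas[where comb = "\<lambda>a e b f i. a * e i + b * f i"])
    fix e assume e: "e \<in> H" "\<forall>\<rho>\<in>R. 0 \<le> \<rho> (torus_char n e)"
    have "0 \<le> \<mu> (torus_char n e)" if "\<mu> \<in> gen_cone R" for \<mu>
      using that e(2) by (auto simp: gen_cone_def intro!: sum_nonneg)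
    then show "0 \<le> \<nu> (torus_char n e)"
      using e(1) \<nu>(2) by (auto simp: H_def dual_monoid_def R(3))
  next
    fix \<rho> a e b f assume "\<rho> \<in> R" "e \<in> H" "f \<in> H"
    then show "\<rho> (torus_char n (\<lambda>i. a * e i + b * f i)) =
        of_int a * \<rho> (torus_char n e) + of_int b * \<rho> (torus_char n f)"
      using N_real_comb[OF S, of \<rho> e f a b] RN(1) M by (simp add: H_def)
  next
    fix a e b f assume "e \<in> H" "f \<in> H"
    then show "\<nu> (torus_char n (\<lambda>i. a * e i + b * f i)) =
        of_int a * \<nu> (torus_char n e) + of_int b * \<nu> (torus_char n f)"
      using N_real_comb[OF S, of \<nu> e f a b] \<nu>(1) M by (simp add: H_def)
  qed (use R RN annihilator_comb[OF S] in \<open>auto simp: H_def M\<close>)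
  then obtain c where c: "\<forall>\<rho>\<in>R. 0 \<le> c \<rho>"
    "\<And>e. e \<in> H \<Longrightarrow> \<nu> (torus_char n e) = (\<Sum>\<rho>\<in>R. c \<rho> * \<rho> (torus_char n e))" by blast
  have "\<nu> \<chi> = (\<Sum>\<rho>\<in>R. c \<rho> * \<rho> \<chi>)" for \<chi>
  proof (cases "\<chi> \<in> M")
    case True
    then obtain e where "\<chi> = torus_char n e" by (auto simp: M annihilator_def characters_eq)
    then show ?thesis using c(2)[of e] True by (simp add: H_def)
  next
    case False
    then have "(\<Sum>\<rho>\<in>R. c \<rho> * \<rho> \<chi>) = 0" using RN(1) by (intro sum.neutral) (auto simp: N_real_def)
    then show ?thesis using False \<nu>(1) by (simp add: N_real_def)
  qed
  then show ?thesis unfolding R(3) gen_cone_def using c(1) by blast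
qed

text \<open>
  The exponents of the lattice form a subgroup of \<open>\<int>\<^sup>n\<close>, so \<open>\<nu>\<close> extends to a real linear form; its
  coefficients are the weights \<open>a\<close> of the rows.
\<close>
lemma N_real_weights:
  assumes S: "S \<subseteq> torus n" and \<nu>: "\<nu> \<in> N_real (annihilator n S)"
  obtains a where "\<And>k r x. (\<And>b. b < k \<Longrightarrow> r b < n) \<Longrightarrow> (\<And>b. b < k \<Longrightarrow> x b < n) \<Longrightarrow>
    torus_char n (weight_exp k r x) \<in> annihilator n S \<Longrightarrow>
    \<nu> (torus_char n (weight_exp k r x)) = (\<Sum>b<k. a (r b)) - (\<Sum>b<k. a (x b))"
proof -
  define H where "H = {e. torus_char n e \<in> annihilator n S}"
  have "\<exists>a. \<forall>e\<in>H. (\<forall>i\<ge>n. e i = 0) \<longrightarrow> \<nu> (torus_char n e) = (\<Sum>i<n. a i * of_int (e i))"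
    by (rule additive_extends) (use annihilator_comb[OF S] N_real_comb[OF S \<nu>] in \<open>auto simp: H_def\<close>)
  then obtain a where a: "\<And>e. e \<in> H \<Longrightarrow> \<forall>i\<ge>n. e i = 0 \<Longrightarrow> \<nu> (torus_char n e) = (\<Sum>i<n. a i * of_int (e i))"
    by blast
  show ?thesis
  proof (rule that[of a])
    fix k r x assume *: "\<And>b. b < k \<Longrightarrow> r b < n" "\<And>b. b < k \<Longrightarrow> x b < n"
      and mem: "torus_char n (weight_exp k r x) \<in> annihilator n S"
    have "weight_exp k r x i = 0" if "i \<ge> n" for i
      unfolding weight_exp_def using * that by (intro sum.neutral) (auto simp: of_bool_def, fastforce+)
    then show "\<nu> (torus_char n (weight_exp k r x)) = (\<Sum>b<k. a (r b)) - (\<Sum>b<k. a (x b))"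
      using a[of "weight_exp k r x"] mem sum_weight_exp[of k r n x a, OF *] by (simp add: H_def)
  qed
qed

section \<open>Dense torus orbits and affine toric charts\<close>

lemma regular_onI_poly:
  assumes "p \<in> poly_funs C" "\<And>y. y \<in> V \<Longrightarrow> f y = p y"
  shows "regular_on C V f"
  unfolding regular_on_def using assms
  by (intro ballI bexI[of _ p] bexI[of _ "\<lambda>_. 1"]) (auto intro: poly_funs.const)

lemma regular_on_add:
  assumes "regular_on C V f" "regular_on C V g"
  shows "regular_on C V (\<lambda>x. f x + g x)"
  unfolding regular_on_def
proof
  fix x assume x: "x \<in> V"
  obtain p q where pq: "p \<in> poly_funs C" "q \<in> poly_funs C" "q x \<noteq> 0" "\<forall>y\<in>V. q y \<noteq> 0 \<longrightarrow> f y = p y / q y"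
    using assms(1) x unfolding regular_on_def by blast
  obtain r s where rs: "r \<in> poly_funs C" "s \<in> poly_funs C" "s x \<noteq> 0" "\<forall>y\<in>V. s y \<noteq> 0 \<longrightarrow> g y = r y / s y"
    using assms(2) x unfolding regular_on_def by blast
  show "\<exists>p\<in>poly_funs C. \<exists>q\<in>poly_funs C. q x \<noteq> 0 \<and> (\<forall>y\<in>V. q y \<noteq> 0 \<longrightarrow> f y + g y = p y / q y)"
    by (rule bexI[of _ "\<lambda>y. p y * s y + r y * q y"], rule bexI[of _ "\<lambda>y. q y * s y"])
       (use pq rs in \<open>auto intro!: poly_funs.add poly_funs.mult simp: add_frac_eq\<close>)
qed

lemma regular_on_cmult:
  assumes "regular_on C V f"
  shows "regular_on C V (\<lambda>x. c * f x)"
  unfolding regular_on_def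
proof
  fix x assume x: "x \<in> V"
  obtain p q where pq: "p \<in> poly_funs C" "q \<in> poly_funs C" "q x \<noteq> 0" "\<forall>y\<in>V. q y \<noteq> 0 \<longrightarrow> f y = p y / q y"
    using assms(1) x unfolding regular_on_def by blast
  show "\<exists>p\<in>poly_funs C. \<exists>q\<in>poly_funs C. q x \<noteq> 0 \<and> (\<forall>y\<in>V. q y \<noteq> 0 \<longrightarrow> c * f y = p y / q y)"
    by (rule bexI[of _ "\<lambda>y. c * p y"], rule bexI[of _ q])
       (use pq in \<open>auto intro!: poly_funs.mult poly_funs.const\<close>)
qed

lemma regular_on_sum:
  assumes "finite I" "\<And>i. i \<in> I \<Longrightarrow> regular_on C V (f i)"
  shows "regular_on C V (\<lambda>x. \<Sum>i\<in>I. f i x)"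
  using assms
proof (induction I rule: finite_induct)
  case empty
  then show ?case by (auto intro: regular_onI_poly[OF poly_funs.const[of 0]])
next
  case (insert i I)
  then show ?case using regular_on_add[of C V "f i" "\<lambda>x. \<Sum>i\<in>I. f i x"] by simp
qed

context homogeneous_space begin

interpretation group "SL n" by (rule group_SL)

abbreviation dense :: "complex mat set set \<Rightarrow> complex mat set set" where
  "dense X \<equiv> dense_orbit n Q X"

lemma mult_SL: "g \<in> carrier (SL n) \<Longrightarrow> h \<in> carrier (SL n) \<Longrightarrow> g * h \<in> carrier (SL n)"
  using m_closed[of g h] by simp

lemma torus_pt: "t \<in> torus n \<Longrightarrow> g \<in> carrier (SL n) \<Longrightarrow> t <#\<^bsub>SL n\<^esub> pt g = pt (t * g)"
  using left_mult_pt torus_carrier by blast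

lemma assoc_SL:
  "a \<in> carrier (SL n) \<Longrightarrow> b \<in> carrier (SL n) \<Longrightarrow> c \<in> carrier (SL n) \<Longrightarrow> a * b * c = a * (b * c)"
  using m_assoc[of a b c] by simp

lemma pt_in_points: "g \<in> carrier (SL n) \<Longrightarrow> pt g \<in> points"
  by (simp add: points_def)

lemma pointsE:
  assumes "x \<in> points"
  obtains g where "g \<in> carrier (SL n)" "x = pt g"
  using assms unfolding points_def by blast

lemma torus_torus_points:
  assumes "s \<in> torus n" "t \<in> torus n" "x \<in> points"
  shows "s <#\<^bsub>SL n\<^esub> (t <#\<^bsub>SL n\<^esub> x) = (s * t) <#\<^bsub>SL n\<^esub> x"
proof -
  obtain g where g: "g \<in> carrier (SL n)" "x = pt g" using assms(3) by (rule pointsE)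
  then show ?thesis
    using assms torus_pt mult_SL torus_carrier torus_mult_closed assoc_SL by simp
qed

lemma one_pt: "x \<in> points \<Longrightarrow> 1\<^sub>m n <#\<^bsub>SL n\<^esub> x = x"
  using torus_pt[OF one_torus] by (auto elim!: pointsE)

lemma dense_subset: "dense X \<subseteq> X"
  by (auto simp: dense_orbit_def)

lemma dense_imp_closure:
  "y \<in> dense X \<Longrightarrow> X = homog_topology n Q closure_of ((\<lambda>t. t <#\<^bsub>SL n\<^esub> y) ` torus n)"
  by (simp add: dense_orbit_def)

lemma dense_imp_points: "y \<in> dense X \<Longrightarrow> X \<subseteq> points"
  using dense_imp_closure closure_subset_points by metis

text \<open>
  Vanishing on the dense orbit is inherited by the whole variety; this is the form in which the density of
  an orbit is used.
\<close>
lemma dense_vanish: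
  assumes g: "g \<in> carrier (SL n)" "pt g \<in> dense X"
    and h: "h \<in> carrier (SL n)" "pt h \<in> X"
    and F: "poly_fun n F" "\<And>t q. t \<in> torus n \<Longrightarrow> q \<in> Q \<Longrightarrow> F (t * g * q) = 0"
  shows "F h = 0"
proof -
  obtain f where f: "f \<in> poly_funs (mat_coords n)" "\<forall>g\<in>carrier_mat n n. F g = f g"
    using F(1) unfolding poly_fun_def by blast
  have "f s = 0" if s: "s \<in> carrier (SL n)" "pt s \<in> (\<lambda>t. t <#\<^bsub>SL n\<^esub> pt g) ` torus n" for s
  proof -
    obtain t where t: "t \<in> torus n" "pt s = pt (t * g)" using s(2) torus_pt g(1) by auto
    have "t * g \<in> carrier (SL n)" using mult_SL[OF torus_carrier[OF t(1)] g(1)] .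
    then obtain q where q: "q \<in> Q" "s = t * g * q" using pt_eq_iff s(1) t(2) by metis
    then show ?thesis using F(2)[OF t(1) q(1)] f(2) s(1) by auto
  qed
  then have "f h = 0"
    using homog_closure_iff[OF h(1)] h(2) f(1) dense_imp_closure[OF g(2)] by metis
  then show ?thesis using f(2) h(1) by auto
qed

lemma dense_torus:
  assumes y: "y \<in> dense X" and t: "t \<in> torus n"
  shows "t <#\<^bsub>SL n\<^esub> y \<in> dense X"
proof -
  have yp: "y \<in> points" using dense_imp_points[OF y] dense_subset y by blast
  let ?O = "\<lambda>y. (\<lambda>t. t <#\<^bsub>SL n\<^esub> y) ` torus n"
  have "s <#\<^bsub>SL n\<^esub> y \<in> points" if "s \<in> torus n" for s
    using yp that torus_pt mult_SL torus_carrier by (auto elim!: pointsE intro!: pt_in_points)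
  then have "?O y \<subseteq> X"
    using closure_of_subset[of "?O y" "homog_topology n Q"] dense_imp_closure[OF y] by auto
  moreover have "?O (t <#\<^bsub>SL n\<^esub> y) = ?O y"
  proof
    show "?O (t <#\<^bsub>SL n\<^esub> y) \<subseteq> ?O y"
      using torus_torus_points[OF _ t yp] torus_mult_closed t by auto
    show "?O y \<subseteq> ?O (t <#\<^bsub>SL n\<^esub> y)"
    proof
      fix z assume "z \<in> ?O y"
      then obtain s where s: "s \<in> torus n" "z = s <#\<^bsub>SL n\<^esub> y" by blast
      let ?u = "diag n (\<lambda>i. inverse (t $$ (i, i)))"
      have u: "?u \<in> torus n" by (rule torus_diag_inverse[OF t])
      have "(s * ?u) * t = s * (?u * t)"
        using assoc_SL torus_carrier s(1) u t by blast
      then have "(s * ?u) * t = s"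
        using torus_inverse_mult[OF t] torus_carrier_mat[OF s(1)] by simp
      then have "z = (s * ?u) <#\<^bsub>SL n\<^esub> (t <#\<^bsub>SL n\<^esub> y)"
        using torus_torus_points[OF torus_mult_closed[OF s(1) u] t yp] s(2) by simp
      then show "z \<in> ?O (t <#\<^bsub>SL n\<^esub> y)" using torus_mult_closed[OF s(1) u] by blast
    qed
  qed
  ultimately show ?thesis using t dense_imp_closure[OF y] unfolding dense_orbit_def by auto
qed

lemma openin_subtopology_nbhd:
  assumes U: "openin (subtopology (homog_topology n Q) X) U" and h: "h \<in> carrier (SL n)" "pt h \<in> U"
  obtains f where "f \<in> poly_funs (mat_coords n)" "f h \<noteq> 0"
    "\<And>y. y \<in> carrier (SL n) \<Longrightarrow> f y \<noteq> 0 \<Longrightarrow> pt y \<in> X \<Longrightarrow> pt y \<in> U"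
proof -
  obtain T where T: "openin (homog_topology n Q) T" "U = T \<inter> X"
    using U unfolding openin_subtopology by blast
  then have "openin (zariski (mat_coords n) (carrier (SL n))) {g \<in> carrier (SL n). pt g \<in> T}"
    unfolding openin_homog by simp
  then obtain f where "f \<in> poly_funs (mat_coords n)" "f h \<noteq> 0"
      "\<forall>y\<in>carrier (SL n). f y \<noteq> 0 \<longrightarrow> pt y \<in> T"
    unfolding openin_zariski using h T by auto
  then show ?thesis using that[of f] T(2) by blast
qed

lemma homog_regularD:
  assumes "homog_regular n Q U f" "h \<in> carrier (SL n)" "pt h \<in> U"
  obtains p q where "p \<in> poly_funs (mat_coords n)" "q \<in> poly_funs (mat_coords n)" "q h \<noteq> 0"
    "\<And>y. y \<in> carrier (SL n) \<Longrightarrow> pt y \<in> U \<Longrightarrow> q y \<noteq> 0 \<Longrightarrow> f (pt y) = p y / q y"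
proof -
  have "h \<in> {g \<in> carrier (SL n). pt g \<in> U}" using assms by blast
  then obtain p q where "p \<in> poly_funs (mat_coords n)" "q \<in> poly_funs (mat_coords n)" "q h \<noteq> 0"
    "\<forall>y\<in>{g \<in> carrier (SL n). pt g \<in> U}. q y \<noteq> 0 \<longrightarrow> f (pt y) = p y / q y"
    using bspec[OF assms(1)[unfolded homog_regular_def regular_on_def]] by blast
  then show ?thesis by (intro that[of p q]) auto
qed

text \<open>
  Near a given point both functions are fractions of polynomials.  Their cross-multiplied difference, times a
  polynomial that vanishes outside of the open set \<open>U\<close>, is zero on the dense orbit, hence at the point.
\<close>
lemma regular_eq_on_dense:
  assumes g: "g \<in> carrier (SL n)" "pt g \<in> dense X"
    and U: "openin (subtopology (homog_topology n Q) X) U"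
    and f: "homog_regular n Q U f1" "homog_regular n Q U f2"
    and eq: "\<And>t. t \<in> torus n \<Longrightarrow> f1 (t <#\<^bsub>SL n\<^esub> pt g) = f2 (t <#\<^bsub>SL n\<^esub> pt g)"
    and y: "y \<in> U"
  shows "f1 y = f2 y"
proof -
  have UX: "U \<subseteq> X" using openin_imp_subset[OF U] .
  obtain h where h: "h \<in> carrier (SL n)" "y = pt h"
    using y UX dense_imp_points[OF g(2)] by (blast elim: pointsE)
  have hU: "pt h \<in> U" using y h by simp
  obtain a where a: "a \<in> poly_funs (mat_coords n)" "a h \<noteq> 0"
    "\<And>y. y \<in> carrier (SL n) \<Longrightarrow> a y \<noteq> 0 \<Longrightarrow> pt y \<in> X \<Longrightarrow> pt y \<in> U"
    using openin_subtopology_nbhd[OF U h(1) hU] by blast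
  obtain p q where pq: "p \<in> poly_funs (mat_coords n)" "q \<in> poly_funs (mat_coords n)" "q h \<noteq> 0"
    "\<And>y. y \<in> carrier (SL n) \<Longrightarrow> pt y \<in> U \<Longrightarrow> q y \<noteq> 0 \<Longrightarrow> f1 (pt y) = p y / q y"
    using homog_regularD[OF f(1) h(1) hU] by blast
  obtain r s where rs: "r \<in> poly_funs (mat_coords n)" "s \<in> poly_funs (mat_coords n)" "s h \<noteq> 0"
    "\<And>y. y \<in> carrier (SL n) \<Longrightarrow> pt y \<in> U \<Longrightarrow> s y \<noteq> 0 \<Longrightarrow> f2 (pt y) = r y / s y"
    using homog_regularD[OF f(2) h(1) hU] by blast
  define F where "F z = a z * (q z * s z * (p z * s z - r z * q z))" for z
  have "poly_fun n F" unfolding F_def[abs_def]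
    by (intro poly_fun_mult poly_fun_diff poly_funI a pq rs)
  moreover have "F (t * g * u) = 0" if t: "t \<in> torus n" and u: "u \<in> Q" for t u
  proof -
    let ?z = "t * g * u"
    have tg: "t * g \<in> carrier (SL n)" using mult_SL torus_carrier t g by blast
    have z: "?z \<in> carrier (SL n)" using mult_SL tg Q_carrier u by blast
    have ptz: "pt ?z = t <#\<^bsub>SL n\<^esub> pt g" using pt_mult[OF tg u] torus_pt t g by simp
    have zX: "pt ?z \<in> X" using dense_torus[OF g(2) t] dense_subset ptz by auto
    show ?thesis
    proof (cases "a ?z = 0 \<or> q ?z = 0 \<or> s ?z = 0")
      case False
      then have "pt ?z \<in> U" using a(3)[OF z _ zX] by blast
      then have "p ?z / q ?z = r ?z / s ?z"
        using pq(4)[OF z] rs(4)[OF z] False eq[OF t] ptz by metis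
      then have "p ?z * s ?z - r ?z * q ?z = 0" using False by (simp add: field_simps)
      then show ?thesis by (simp add: F_def)
    qed (auto simp: F_def)
  qed
  moreover have "pt h \<in> X" using hU UX by blast
  ultimately have "F h = 0" using dense_vanish[OF g h(1)] by blast
  then have "p h * s h = r h * q h" using a(2) pq(3) rs(3) by (simp add: F_def)
  then have "p h / q h = r h / s h" using pq(3) rs(3) by (simp add: field_simps)
  then show ?thesis using pq(4)[OF h(1) hU pq(3)] rs(4)[OF h(1) hU rs(3)] h(2) by simp
qed

lemma homog_regular_translate:
  assumes f: "homog_regular n Q U f" and t: "t \<in> torus n"
    and stable: "\<And>x. x \<in> U \<Longrightarrow> t <#\<^bsub>SL n\<^esub> x \<in> U"
  shows "homog_regular n Q U (\<lambda>x. f (t <#\<^bsub>SL n\<^esub> x))"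
  unfolding homog_regular_def regular_on_def
proof
  fix h assume h: "h \<in> {g \<in> carrier (SL n). pt g \<in> U}"
  have moved: "t * y \<in> carrier (SL n)" "pt (t * y) = t <#\<^bsub>SL n\<^esub> pt y" if "y \<in> carrier (SL n)" for y
    using that mult_SL torus_carrier t torus_pt by auto
  have "pt (t * h) \<in> U" using stable h moved[of h] by auto
  then obtain p q where pq: "p \<in> poly_funs (mat_coords n)" "q \<in> poly_funs (mat_coords n)" "q (t * h) \<noteq> 0"
    "\<And>y. y \<in> carrier (SL n) \<Longrightarrow> pt y \<in> U \<Longrightarrow> q y \<noteq> 0 \<Longrightarrow> f (pt y) = p y / q y"
    using homog_regularD[OF f, of "t * h"] moved(1)[of h] h by blast
  obtain p' q' where p': "p' \<in> poly_funs (mat_coords n)" "\<forall>g\<in>carrier_mat n n. p (t * g) = p' g"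
    and q': "q' \<in> poly_funs (mat_coords n)" "\<forall>g\<in>carrier_mat n n. q (t * g) = q' g"
    using poly_fun_left_mult[OF pq(1) torus_carrier_mat[OF t]]
      poly_fun_left_mult[OF pq(2) torus_carrier_mat[OF t]] unfolding poly_fun_def by blast
  have "f (t <#\<^bsub>SL n\<^esub> pt y) = p' y / q' y" if y: "y \<in> carrier (SL n)" "pt y \<in> U" "q' y \<noteq> 0" for y
  proof -
    have yc: "y \<in> carrier_mat n n" using y(1) by simp
    have "pt (t * y) \<in> U" using stable[OF y(2)] moved[OF y(1)] by simp
    then have "f (pt (t * y)) = p (t * y) / q (t * y)"
      using pq(4)[of "t * y"] moved(1)[OF y(1)] y(3) q'(2) yc by simp
    then show ?thesis using moved(2)[OF y(1)] p'(2) q'(2) yc by simp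
  qed
  moreover have "q' h \<noteq> 0" using pq(3) q'(2) h by simp
  ultimately show "\<exists>p\<in>poly_funs (mat_coords n). \<exists>q\<in>poly_funs (mat_coords n). q h \<noteq> 0 \<and>
      (\<forall>y\<in>{g \<in> carrier (SL n). pt g \<in> U}. q y \<noteq> 0 \<longrightarrow> f (t <#\<^bsub>SL n\<^esub> pt y) = p y / q y)"
    using p'(1) q'(1) by blast
qed

end

locale chart = homogeneous_space +
  fixes X \<sigma> U g
  assumes chart: "toric_chart n Q X \<sigma> U" and base: "g \<in> carrier (SL n)" "pt g \<in> dense X"
begin

abbreviation lattice :: "(complex mat \<Rightarrow> complex) set" where
  "lattice \<equiv> char_lattice n Q X"

lemma U_open: "openin (subtopology (homog_topology n Q) X) U"
  and dense_U: "dense X \<subseteq> U"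
  and U_stable: "t \<in> torus n \<Longrightarrow> x \<in> U \<Longrightarrow> t <#\<^bsub>SL n\<^esub> x \<in> U"
  and U_affine: "affine_variety n Q U"
  and regular_in_algebra:
    "homog_regular n Q U f \<Longrightarrow> f \<in> semigroup_algebra n (dense X) (dual_monoid lattice \<sigma>)"
  and algebra_extends:
    "h \<in> semigroup_algebra n (dense X) (dual_monoid lattice \<sigma>) \<Longrightarrow>
      \<exists>f. homog_regular n Q U f \<and> (\<forall>x\<in>dense X. f x = h x)"
  using chart unfolding toric_chart_def by blast+

lemma U_points: "U \<subseteq> points"
  using openin_imp_subset[OF U_open] dense_imp_points[OF base(2)] by blast

lemma dual_monoid_characters: "dual_monoid lattice \<sigma> \<subseteq> characters n"
  by (auto simp: dual_monoid_def char_lattice_def)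

lemma weight_extends:
  assumes "\<chi> \<in> dual_monoid lattice \<sigma>"
    and "\<And>t x. t \<in> torus n \<Longrightarrow> x \<in> dense X \<Longrightarrow> e (t <#\<^bsub>SL n\<^esub> x) = \<chi> t * e x"
  shows "\<exists>f. homog_regular n Q U f \<and> (\<forall>x\<in>dense X. f x = e x)"
proof (rule algebra_extends)
  show "e \<in> semigroup_algebra n (dense X) (dual_monoid lattice \<sigma>)"
    unfolding semigroup_algebra_def
    by (rule CollectI, rule exI[of _ "{\<chi>}"], rule exI[of _ "\<lambda>_. e"]) (use assms in auto)
qed

lemma regular_weight:
  assumes f: "homog_regular n Q U f"
    and w: "\<And>s t. s \<in> torus n \<Longrightarrow> t \<in> torus n \<Longrightarrow>
      f (s <#\<^bsub>SL n\<^esub> (t <#\<^bsub>SL n\<^esub> pt g)) = \<chi> s * f (t <#\<^bsub>SL n\<^esub> pt g)"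
    and t: "t \<in> torus n" and x: "x \<in> U"
  shows "f (t <#\<^bsub>SL n\<^esub> x) = \<chi> t * f x"
proof (rule regular_eq_on_dense[OF base U_open _ _ _ x, where ?f1.0 = "\<lambda>x. f (t <#\<^bsub>SL n\<^esub> x)"])
  show "homog_regular n Q U (\<lambda>x. f (t <#\<^bsub>SL n\<^esub> x))"
    using homog_regular_translate[OF f t] U_stable[OF t] by blast
  show "homog_regular n Q U (\<lambda>x. \<chi> t * f x)"
    using f regular_on_cmult unfolding homog_regular_def by blast
qed (use w t in auto)

text \<open>
  The restriction of \<open>f\<close> to the dense orbit is a sum of weight functions with weights in the dual monoid; by
  the independence of characters \<open>\<chi>\<close> is one of these weights.
\<close>
lemma character_in_dual_monoid:
  assumes f: "homog_regular n Q U f" "f (pt g) \<noteq> 0" and \<chi>: "\<chi> \<in> characters n"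
    and w: "\<And>t. t \<in> torus n \<Longrightarrow> f (t <#\<^bsub>SL n\<^esub> pt g) = \<chi> t * f (pt g)"
  shows "\<chi> \<in> dual_monoid lattice \<sigma>"
proof (rule ccontr)
  assume notin: "\<chi> \<notin> dual_monoid lattice \<sigma>"
  obtain F e where F: "finite F" "F \<subseteq> dual_monoid lattice \<sigma>"
    and e: "\<forall>\<chi>\<in>F. \<forall>t\<in>torus n. \<forall>x\<in>dense X. e \<chi> (t <#\<^bsub>SL n\<^esub> x) = \<chi> t * e \<chi> x"
    and fe: "\<forall>x\<in>dense X. f x = (\<Sum>\<chi>\<in>F. e \<chi> x)"
    using regular_in_algebra[OF f(1)] unfolding semigroup_algebra_def by blast
  have notF: "\<chi> \<notin> F" using notin F(2) by blast
  define c where "c \<psi> = (if \<psi> = \<chi> then - f (pt g) else e \<psi> (pt g))" for \<psi>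
  have "\<forall>\<psi>\<in>insert \<chi> F. c \<psi> = 0"
  proof (rule characters_independent)
    show "insert \<chi> F \<subseteq> characters n" using \<chi> F(2) dual_monoid_characters by blast
    fix t assume t: "t \<in> torus n"
    have "(\<Sum>\<psi>\<in>F. c \<psi> * \<psi> t) = (\<Sum>\<psi>\<in>F. e \<psi> (t <#\<^bsub>SL n\<^esub> pt g))"
      using notF e t base(2) by (intro sum.cong) (auto simp: c_def)
    also have "\<dots> = \<chi> t * f (pt g)" using fe dense_torus[OF base(2) t] w[OF t] by simp
    finally show "(\<Sum>\<psi>\<in>insert \<chi> F. c \<psi> * \<psi> t) = 0"
      using F(1) notF by (simp add: c_def)
  qed (use F in simp)
  then show False using f(2) by (simp add: c_def)
qed

text \<open>
  As the chart is affine, a closed stable subset missing the fixed point \<open>x\<close> would be separated from \<open>x\<close> by a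
  regular function \<open>f\<close>.  In the decomposition of \<open>f\<close> into weight functions only the invariant part survives at \<open>x\<close>, and
  that part is constant, whereas all parts vanish on the stable set.  Geometrically: \<open>x\<close> lies in the closure of
  every torus orbit of the chart.
\<close>
lemma stable_closed_empty:
  assumes x: "x \<in> U" "\<And>t. t \<in> torus n \<Longrightarrow> t <#\<^bsub>SL n\<^esub> x = x"
    and Z: "Z \<subseteq> U" "x \<notin> Z" "\<And>t z. t \<in> torus n \<Longrightarrow> z \<in> Z \<Longrightarrow> t <#\<^bsub>SL n\<^esub> z \<in> Z"
    and closed: "openin (subtopology (homog_topology n Q) U) (U - Z)"
  shows "Z = {}"
proof (rule ccontr)
  assume "Z \<noteq> {}"
  then obtain z where z: "z \<in> Z" by blast
  have topU: "topspace (subtopology (homog_topology n Q) U) = U" using U_points by auto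
  obtain f where f: "homog_regular n Q U f" "f x \<noteq> 0" and fZ: "\<And>z. z \<in> Z \<Longrightarrow> f z = 0"
  proof -
    obtain k Y \<phi> where
      homeo: "homeomorphic_map (subtopology (homog_topology n Q) U)
          (subtopology (zariski (vec_coords k) (carrier_vec k)) Y) \<phi>"
      and reg: "\<forall>V h. openin (subtopology (homog_topology n Q) U) V \<longrightarrow>
           (homog_regular n Q V (h \<circ> \<phi>) \<longleftrightarrow> regular_on (vec_coords k) (\<phi> ` V) h)"
      using U_affine unfolding affine_variety_def by blast
    let ?A = "carrier_vec k \<inter> Y"
    have sub: "subtopology (zariski (vec_coords k) (carrier_vec k)) Y = zariski (vec_coords k) ?A"
      unfolding zariski_def by (simp add: subtopology_subtopology)
    have "openin (zariski (vec_coords k) ?A) (\<phi> ` (U - Z))"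
      using homeomorphic_imp_open_map[OF homeo] closed unfolding sub open_map_def by blast
    then obtain p where p: "p \<in> poly_funs (vec_coords k)" "p (\<phi> x) \<noteq> 0"
      "\<forall>y\<in>?A. p y \<noteq> 0 \<longrightarrow> y \<in> \<phi> ` (U - Z)"
      unfolding openin_zariski using x(1) Z(2) by blast
    have image: "\<phi> ` U = ?A" and inj: "inj_on \<phi> U"
      using homeomorphic_imp_surjective_map[OF homeo] homeomorphic_imp_injective_map[OF homeo]
      unfolding sub topU by simp_all
    show ?thesis
    proof (rule that[of "p \<circ> \<phi>"])
      have "regular_on (vec_coords k) (\<phi> ` U) p" by (rule regular_onI_poly[OF p(1)]) simp
      moreover have "openin (subtopology (homog_topology n Q) U) U"
        using openin_topspace[of "subtopology (homog_topology n Q) U"] topU by simp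
      ultimately show "homog_regular n Q U (p \<circ> \<phi>)" using reg by blast
      show "(p \<circ> \<phi>) x \<noteq> 0" using p(2) by simp
      fix z assume z: "z \<in> Z"
      have "\<phi> z \<notin> \<phi> ` (U - Z)" using z Z(1) inj by (auto dest: inj_onD)
      moreover have "\<phi> z \<in> ?A" using image z Z(1) by blast
      ultimately show "(p \<circ> \<phi>) z = 0" using p(3) by auto
    qed
  qed
  obtain F e where F: "finite F" "F \<subseteq> dual_monoid lattice \<sigma>"
    and e': "\<forall>\<chi>\<in>F. \<forall>t\<in>torus n. \<forall>x\<in>dense X. e \<chi> (t <#\<^bsub>SL n\<^esub> x) = \<chi> t * e \<chi> x"
    and fe': "\<forall>x\<in>dense X. f x = (\<Sum>\<chi>\<in>F. e \<chi> x)"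
    using regular_in_algebra[OF f(1)] unfolding semigroup_algebra_def by blast
  have e: "e \<chi> (t <#\<^bsub>SL n\<^esub> x) = \<chi> t * e \<chi> x" if "\<chi> \<in> F" "t \<in> torus n" "x \<in> dense X" for \<chi> t x
    using e' that by blast
  have fe: "f x = (\<Sum>\<chi>\<in>F. e \<chi> x)" if "x \<in> dense X" for x
    using fe' that by blast
  have "\<forall>\<chi>\<in>F. \<exists>h. homog_regular n Q U h \<and> (\<forall>x\<in>dense X. h x = e \<chi> x)"
  proof
    fix \<chi> assume "\<chi> \<in> F"
    then show "\<exists>h. homog_regular n Q U h \<and> (\<forall>x\<in>dense X. h x = e \<chi> x)"
      using weight_extends[of \<chi> "e \<chi>"] e[of \<chi>] F(2) by blast
  qed
  from bchoice[OF this] obtain h where "\<forall>\<chi>\<in>F. homog_regular n Q U (h \<chi>) \<and> (\<forall>x\<in>dense X. h \<chi> x = e \<chi> x)"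
    by blast
  then have h: "\<And>\<chi>. \<chi> \<in> F \<Longrightarrow> homog_regular n Q U (h \<chi>)"
    "\<And>\<chi> x. \<chi> \<in> F \<Longrightarrow> x \<in> dense X \<Longrightarrow> h \<chi> x = e \<chi> x"
    by auto
  have weight: "h \<chi> (t <#\<^bsub>SL n\<^esub> y) = \<chi> t * h \<chi> y" if "\<chi> \<in> F" "t \<in> torus n" "y \<in> U" for \<chi> t y
    by (rule regular_weight[OF h(1)[OF that(1)] _ that(2,3)])
       (use h(2)[OF that(1)] e[OF that(1)] dense_torus[OF base(2)] dense_torus in auto)
  have sum: "f y = (\<Sum>\<chi>\<in>F. h \<chi> y)" if "y \<in> U" for y
  proof (rule regular_eq_on_dense[OF base U_open f(1) _ _ that, where ?f2.0 = "\<lambda>y. \<Sum>\<chi>\<in>F. h \<chi> y"])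
    show "homog_regular n Q U (\<lambda>y. \<Sum>\<chi>\<in>F. h \<chi> y)"
      using h(1) F(1) unfolding homog_regular_def by (intro regular_on_sum) auto
  qed (use fe h(2) dense_torus[OF base(2)] in simp)
  have "\<exists>\<chi>\<in>F. h \<chi> x \<noteq> 0"
    using sum[OF x(1)] f(2) by (metis (mono_tags, lifting) sum.neutral)
  then obtain \<chi> where \<chi>: "\<chi> \<in> F" "h \<chi> x \<noteq> 0" by blast
  have trivial: "\<chi> t = 1" if "t \<in> torus n" for t
    using weight[OF \<chi>(1) that x(1)] x(2)[OF that] \<chi>(2) by simp
  have const: "h \<chi> y = h \<chi> (pt g)" if "y \<in> U" for y
  proof (rule regular_eq_on_dense[OF base U_open h(1)[OF \<chi>(1)] _ _ that, where ?f2.0 = "\<lambda>_. h \<chi> (pt g)"])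
    show "homog_regular n Q U (\<lambda>_. h \<chi> (pt g))"
      unfolding homog_regular_def by (rule regular_onI_poly[OF poly_funs.const]) simp
    fix t assume "t \<in> torus n"
    moreover have "pt g \<in> U" using base dense_U by blast
    ultimately show "h \<chi> (t <#\<^bsub>SL n\<^esub> pt g) = h \<chi> (pt g)" using weight[OF \<chi>(1)] trivial by simp
  qed
  have zU: "z \<in> U" using z Z(1) by blast
  have "\<forall>\<psi>\<in>F. h \<psi> z = 0"
  proof (rule characters_independent[OF F(1)])
    show "F \<subseteq> characters n" using F(2) dual_monoid_characters by blast
    fix t assume t: "t \<in> torus n"
    have "(\<Sum>\<psi>\<in>F. h \<psi> z * \<psi> t) = (\<Sum>\<psi>\<in>F. h \<psi> (t <#\<^bsub>SL n\<^esub> z))"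
      using weight[OF _ t zU] by (intro sum.cong) auto
    also have "\<dots> = f (t <#\<^bsub>SL n\<^esub> z)" using sum[OF U_stable[OF t zU]] by simp
    also have "\<dots> = 0" using fZ Z(3)[OF t z] by blast
    finally show "(\<Sum>\<psi>\<in>F. h \<psi> z * \<psi> t) = 0" .
  qed
  then have "h \<chi> z = 0" using \<chi>(1) by blast
  then show False using const[OF zU] const[OF x(1)] \<chi>(2) by simp
qed

end

section \<open>The cone of a chart at a fixed point\<close>

lemma poly_fun_adj_mat:
  assumes "i < n" "j < n"
  shows "poly_fun n (\<lambda>g. adj_mat g $$ (i, j))"
proof -
  have "poly_fun n (\<lambda>g. det (mat_delete g j i))"
  proof (rule poly_fun_det[of _ _ "n - 1"])
    fix a b assume ab: "a < n - 1" "b < n - 1"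
    have "poly_fun n (\<lambda>g. g $$ (if a < j then a else Suc a, if b < i then b else Suc b))"
      by (rule poly_fun_entry) (use ab in auto)
    then show "poly_fun n (\<lambda>g. mat_delete g j i $$ (a, b))"
      by (rule poly_fun_cong) (use ab in \<open>auto simp: mat_delete_def\<close>)
  qed (auto simp: mat_delete_def)
  then have "poly_fun n (\<lambda>g. (-1) ^ (j + i) * det (mat_delete g j i))"
    by (intro poly_fun_mult poly_fun_const)
  then show ?thesis
    by (rule poly_fun_cong) (use assms in \<open>auto simp: adj_mat_def cofactor_def\<close>)
qed

context homogeneous_space begin

lemma weyl_coset_torus_mult:
  assumes A: "A \<in> weyl_coset n w" and t: "t \<in> torus n"
  shows "t * A \<in> weyl_coset n w"
proof -
  have AS: "A \<in> carrier (SL n)" using A by (simp add: weyl_coset_def)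
  then have "A \<in> carrier_mat n n" by simp
  then have "(t * A) $$ (i, j) \<noteq> 0 \<longleftrightarrow> A $$ (i, j) \<noteq> 0" if "i < n" "j < n" for i j
    using torus_mult_index[OF t _ that, of A] torus_nonzero[OF t that(1)] by simp
  moreover have "t * A \<in> carrier (SL n)" using mult_SL torus_carrier t AS by blast
  ultimately show ?thesis using A by (auto simp: weyl_coset_def)
qed

lemma torus_fixed_point:
  assumes w: "w permutes {1..n}" and n: "0 < n" and t: "t \<in> torus n"
  shows "t <#\<^bsub>SL n\<^esub> fixed_point n Q w = fixed_point n Q w"
proof -
  obtain A where A: "A \<in> weyl_coset n w" using weyl_coset_nonempty[OF w n] .
  then have "A \<in> carrier (SL n)" by (simp add: weyl_coset_def)
  then have "t <#\<^bsub>SL n\<^esub> fixed_point n Q w = pt (t * A)"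
    using torus_pt[OF t] fixed_point_eq_pt[OF w A] by simp
  then show ?thesis using fixed_point_eq_pt[OF w weyl_coset_torus_mult[OF A t]] by simp
qed

end

locale flag_variety =
  fixes n :: nat and \<Delta> :: "nat set"
  assumes levels: "\<Delta> \<subseteq> {..n}" and n_pos: "0 < n"
begin

sublocale homogeneous_space n "flag_stab n \<Delta>"
  by (rule homogeneous_space_flag_stab[OF levels])

abbreviation Q :: "complex mat set" where "Q \<equiv> flag_stab n \<Delta>"

text \<open>
  As the torus is commutative, an element fixing a point of the dense orbit fixes the whole orbit; the
  condition \<open>h\<inverse> t h \<in> Q\<close> is closed, hence passes to the closure.
\<close>
lemma stabilizer_dense:
  assumes g: "g \<in> carrier (SL n)" "pt g \<in> dense X" and t: "t \<in> torus n"
    and fixed: "t <#\<^bsub>SL n\<^esub> pt g = pt g" and x: "x \<in> X"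
  shows "t <#\<^bsub>SL n\<^esub> x = x"
proof -
  interpret group "SL n" by (rule group_SL)
  note tS = torus_carrier[OF t]
  have "x \<in> points" using x dense_imp_points[OF g(2)] by blast
  then obtain h where h: "h \<in> carrier (SL n)" "x = pt h" by (rule pointsE)
  have adj: "adj_mat s \<in> carrier_mat n n" "s * adj_mat s = 1\<^sub>m n" "adj_mat s * s = 1\<^sub>m n"
    if "s \<in> carrier (SL n)" for s
    using adj_mat[of s n] that by auto
  obtain q0 where q0: "q0 \<in> Q" "t * g = g * q0"
    using fixed torus_pt[OF t g(1)] pt_eq_iff[OF mult_SL[OF tS g(1)] g(1)] by auto
  let ?F = "\<lambda>s. adj_mat s * (t * s)"
  have orbit: "?F (u * g * q) \<in> Q" if u: "u \<in> torus n" and q: "q \<in> Q" for u q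
  proof -
    let ?s = "u * g * q"
    note uS = torus_carrier[OF u] and qS = Q_carrier[OF q] and q0S = Q_carrier[OF q0(1)]
    have sS: "?s \<in> carrier (SL n)" using mult_SL uS g(1) qS by blast
    let ?c = "inv\<^bsub>SL n\<^esub> q * q0 * q"
    have qi: "inv\<^bsub>SL n\<^esub> q \<in> Q" "q * inv\<^bsub>SL n\<^esub> q = 1\<^sub>m n"
      using subgroup.m_inv_closed[OF subgroup q] r_inv[OF qS] by simp_all
    have cQ: "?c \<in> Q"
      using subgroup.m_closed[OF subgroup] qi(1) q0(1) q by simp
    have cm: "u \<in> carrier_mat n n" "g \<in> carrier_mat n n" "q \<in> carrier_mat n n" "q0 \<in> carrier_mat n n"
      "t \<in> carrier_mat n n" "inv\<^bsub>SL n\<^esub> q \<in> carrier_mat n n"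
      using uS g(1) qS q0S tS Q_carrier[OF qi(1)] by simp_all
    have "t * ?s = (t * u) * g * q" using cm by (simp add: assoc_mult_mat[of _ n n _ n _ n])
    also have "t * u = u * t" using torus_commute[OF t u] .
    also have "u * t * g * q = u * (t * g) * q" using cm by (simp add: assoc_mult_mat[of _ n n _ n _ n])
    also have "\<dots> = u * g * (1\<^sub>m n * q0) * q" unfolding q0(2) using cm by (simp add: assoc_mult_mat[of _ n n _ n _ n])
    also have "\<dots> = ?s * ?c" unfolding qi(2)[symmetric] using cm by (simp add: assoc_mult_mat[of _ n n _ n _ n])
    finally have "t * ?s = ?s * ?c" .
    then have "?F ?s = adj_mat ?s * (?s * ?c)" by simp
    also have "\<dots> = (adj_mat ?s * ?s) * ?c"
      using adj(1)[OF sS] sS Q_carrier[OF cQ] by (simp add: assoc_mult_mat[of _ n n _ n _ n])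
    also have "\<dots> = ?c"
      unfolding adj(3)[OF sS] using left_mult_one_mat[of ?c n n] Q_carrier[OF cQ] by simp
    finally show ?thesis using cQ by simp
  qed
  have hm: "h \<in> carrier_mat n n" "t \<in> carrier_mat n n" using h tS by simp_all
  have "?F h $$ (i, j) = 0" if k: "k \<in> \<Delta>" "i < n" "j < k" "k \<le> i" for k i j
  proof (rule dense_vanish[OF g h(1), where F = "\<lambda>s. ?F s $$ (i, j)"])
    show "pt h \<in> X" using x h by simp
    have jn: "j < n" using k by simp
    have "poly_fun n (\<lambda>s. \<Sum>l<n. adj_mat s $$ (i, l) * (t $$ (l, l) * s $$ (l, j)))"
      by (intro poly_fun_sum poly_fun_mult poly_fun_const poly_fun_entry poly_fun_adj_mat) (use k jn in auto)
    then show "poly_fun n (\<lambda>s. ?F s $$ (i, j))"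
    proof (rule poly_fun_cong)
      fix s :: "complex mat" assume s: "s \<in> carrier_mat n n"
      have "?F s $$ (i, j) = (\<Sum>l<n. adj_mat s $$ (i, l) * (t * s) $$ (l, j))"
        using s adj_mat(1)[OF s] k jn hm(2) by (auto simp: scalar_prod_def atLeast0LessThan)
      also have "\<dots> = (\<Sum>l<n. adj_mat s $$ (i, l) * (t $$ (l, l) * s $$ (l, j)))"
        using torus_mult_index[OF t s _ jn] by (intro sum.cong) auto
      finally show "?F s $$ (i, j) = (\<Sum>l<n. adj_mat s $$ (i, l) * (t $$ (l, l) * s $$ (l, j)))" .
    qed
    fix u q assume "u \<in> torus n" "q \<in> Q"
    then show "?F (u * g * q) $$ (i, j) = 0" using orbit[of u q] k by (auto simp: flag_stab_def)
  qed
  moreover have "?F h \<in> carrier (SL n)"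
  proof -
    have "det (adj_mat h) * det h = 1"
      using adj(3)[OF h(1)] det_mult[OF adj(1)[OF h(1)] hm(1)] by simp
    then show ?thesis
      using det_mult[OF adj(1)[OF h(1)], of "t * h"] det_mult[OF hm(2,1)] tS h(1) adj(1)[OF h(1)] mult_carrier_mat[OF hm(2,1)] by simp
  qed
  ultimately have FQ: "?F h \<in> Q" by (auto simp: flag_stab_def)
  have "h * ?F h = (h * adj_mat h) * (t * h)"
    using adj(1)[OF h(1)] hm by (simp add: assoc_mult_mat[of _ n n _ n _ n])
  then have "h * ?F h = t * h" using adj(2)[OF h(1)] hm by simp
  then show ?thesis using pt_mult[OF h(1) FQ] torus_pt[OF t h(1)] h(2) by simp
qed

lemma char_lattice_eq_annihilator:
  "char_lattice n Q X = annihilator n {t \<in> torus n. \<forall>x\<in>dense X. t <#\<^bsub>SL n\<^esub> x = x}"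
  by (auto simp: char_lattice_def annihilator_def)

lemma minor_pt:
  assumes "h \<in> carrier (SL n)" "h' \<in> carrier (SL n)" "pt h = pt h'" "k \<in> \<Delta>"
  obtains c where "c \<noteq> 0" "\<And>r. (\<And>i. i < k \<Longrightarrow> r i < n) \<Longrightarrow> minor k r h = minor k r h' * c"
proof -
  obtain q where q: "q \<in> Q" "h = h' * q" using pt_eq_iff[OF assms(1,2)] assms(3) by blast
  have k: "k \<le> n" using assms(4) levels by auto
  show ?thesis
    by (rule that[OF minor_flag_stab_nonzero[OF q(1) assms(4) k]])
       (use minor_mult[OF _ q(1) assms(4) k] assms(2) q(2) in auto)
qed

end

inductive_set semigroup_gen :: "('a \<Rightarrow> complex) set \<Rightarrow> ('a \<Rightarrow> complex) set" for E where
  base: "e \<in> E \<Longrightarrow> e \<in> semigroup_gen E"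
| mult: "a \<in> semigroup_gen E \<Longrightarrow> b \<in> semigroup_gen E \<Longrightarrow> (\<lambda>t. a t * b t) \<in> semigroup_gen E"

inductive_set lin_span :: "('a \<Rightarrow> complex) set \<Rightarrow> ('a \<Rightarrow> complex) set" for V where
  zero: "(\<lambda>_. 0) \<in> lin_span V"
| scale: "v \<in> V \<Longrightarrow> (\<lambda>t. c * v t) \<in> lin_span V"
| add: "a \<in> lin_span V \<Longrightarrow> b \<in> lin_span V \<Longrightarrow> (\<lambda>t. a t + b t) \<in> lin_span V"

lemma lin_span_mono: "a \<in> lin_span V \<Longrightarrow> V \<subseteq> W \<Longrightarrow> a \<in> lin_span W"
  by (induction rule: lin_span.induct) (auto intro: lin_span.intros)

lemma lin_span_cmult: "a \<in> lin_span V \<Longrightarrow> (\<lambda>t. c * a t) \<in> lin_span V"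
proof (induction rule: lin_span.induct)
  case (scale v d)
  then show ?case using lin_span.scale[of v V "c * d"] by (simp add: mult.assoc)
next
  case (add a b)
  then show ?case using lin_span.add[of "\<lambda>t. c * a t" V "\<lambda>t. c * b t"] by (simp add: distrib_left)
qed (use lin_span.zero in simp)

lemma lin_span_mult:
  assumes "a \<in> lin_span V" "b \<in> lin_span W" and closed: "\<And>v w. v \<in> V \<Longrightarrow> w \<in> W \<Longrightarrow> (\<lambda>t. v t * w t) \<in> Y"
  shows "(\<lambda>t. a t * b t) \<in> lin_span Y"
  using assms(1)
proof (induction rule: lin_span.induct)
  case (scale v c)
  show ?case
    using assms(2)
  proof (induction rule: lin_span.induct)
    case (scale w d)
    then show ?case
      using lin_span.scale[OF closed[OF \<open>v \<in> V\<close> scale], of "c * d"] by (simp add: mult.assoc mult.left_commute)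
  next
    case (add a b)
    then show ?case
      using lin_span.add[of "\<lambda>t. c * v t * a t" Y "\<lambda>t. c * v t * b t"] by (simp add: distrib_left)
  qed (use lin_span.zero in simp)
next
  case (add a1 a2)
  then show ?case
    using lin_span.add[of "\<lambda>t. a1 t * b t" Y "\<lambda>t. a2 t * b t"] by (simp add: distrib_right)
qed (use lin_span.zero in simp)

lemma lin_span_finite_sum:
  assumes "a \<in> lin_span V"
  shows "\<exists>F c. finite F \<and> F \<subseteq> V \<and> a = (\<lambda>t. \<Sum>v\<in>F. c v * v t)"
  using assms
proof (induction rule: lin_span.induct)
  case zero
  then show ?case by (intro exI[of _ "{}"]) simp
next
  case (scale v c)
  then show ?case by (intro exI[of _ "{v}"] exI[of _ "\<lambda>_. c"]) simp
next
  case (add a b)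
  then obtain F c G d where F: "finite F" "F \<subseteq> V" "a = (\<lambda>t. \<Sum>v\<in>F. c v * v t)"
    and G: "finite G" "G \<subseteq> V" "b = (\<lambda>t. \<Sum>v\<in>G. d v * v t)" by blast
  let ?e = "\<lambda>v. (if v \<in> F then c v else 0) + (if v \<in> G then d v else 0)"
  have "a t + b t = (\<Sum>v\<in>F \<union> G. ?e v * v t)" for t
  proof -
    have "(\<Sum>v\<in>F. c v * v t) = (\<Sum>v\<in>F \<union> G. (if v \<in> F then c v else 0) * v t)"
      using F(1) G(1) by (intro sum.mono_neutral_cong_left) auto
    moreover have "(\<Sum>v\<in>G. d v * v t) = (\<Sum>v\<in>F \<union> G. (if v \<in> G then d v else 0) * v t)"
      using F(1) G(1) by (intro sum.mono_neutral_cong_left) auto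
    ultimately show ?thesis unfolding F(3) G(3) by (simp add: distrib_right sum.distrib)
  qed
  then show ?case
    using F G by (intro exI[of _ "F \<union> G"] exI[of _ ?e]) auto
qed

lemma character_not_in_lin_span:
  assumes \<chi>: "\<chi> \<in> characters n" "\<chi> \<notin> V" and V: "V \<subseteq> characters n"
    and a: "a \<in> lin_span V" "\<And>t. t \<in> torus n \<Longrightarrow> c * \<chi> t = a t"
  shows "c = 0"
proof -
  obtain F d where F: "finite F" "F \<subseteq> V" "a = (\<lambda>t. \<Sum>v\<in>F. d v * v t)"
    using lin_span_finite_sum[OF a(1)] by blast
  have notF: "\<chi> \<notin> F" using \<chi>(2) F(2) by blast
  define e where "e v = (if v = \<chi> then - c else d v)" for v
  have "\<forall>v\<in>insert \<chi> F. e v = 0"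
  proof (rule characters_independent)
    fix t assume t: "t \<in> torus n"
    have "(\<Sum>v\<in>F. e v * v t) = a t" unfolding F(3) using notF by (intro sum.cong) (auto simp: e_def)
    then show "(\<Sum>v\<in>insert \<chi> F. e v * v t) = 0" using F(1) notF a(2)[OF t] by (simp add: e_def)
  qed (use \<chi> V F in auto)
  then show ?thesis by (simp add: e_def)
qed

text \<open>
  A one-parameter subgroup in the interior of the cone at the fixed point \<open>x\<close>, evaluated at \<open>2\<close>.  The
  exponents \<open>2 i - (n - 1)\<close> increase with \<open>i\<close> and have sum \<open>0\<close>, as required by the determinant.  It shows that the
  semigroup generated by the weights at \<open>x\<close> does not contain the trivial character.
\<close>
lemma increasing_torus_element:
  assumes x: "x permutes {..<n}"
  obtains \<tau> where "\<tau> \<in> torus n"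
    "\<And>i j. i < n \<Longrightarrow> j < i \<Longrightarrow> cmod (\<tau> $$ (x i, x i) / \<tau> $$ (x j, x j)) > 1"
proof -
  define f where "f i = (2 :: complex) powi (2 * int i - (int n - 1))" for i
  have prod_f: "(\<Prod>i<m. (2 :: complex) powi (2 * int i - c)) = 2 powi (int m * (int m - 1) - int m * c)" for m c
  proof (induction m)
    case (Suc m)
    have "int m * (int m - 1) - int m * c + (2 * int m - c) = int (Suc m) * (int (Suc m) - 1) - int (Suc m) * c"
      by (simp add: algebra_simps)
    then show ?case using Suc by (simp flip: power_int_add)
  qed simp
  define \<tau> where "\<tau> = diag n (\<lambda>y. f (inv_into UNIV x y))"
  have "(\<Prod>y<n. f (inv_into UNIV x y)) = (\<Prod>i<n. f i)"
    using prod.permute[OF permutes_inv[OF x], of f] by (simp add: comp_def)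
  also have "\<dots> = 1" using prod_f[of "int n - 1" n] by (simp add: f_def)
  finally have \<tau>: "\<tau> \<in> torus n" unfolding \<tau>_def by (rule diag_in_torus)
  have entry: "\<tau> $$ (x i, x i) = f i" if "i < n" for i
    using that permutes_in_image[OF x, of i] permutes_inverses(2)[OF x] by (simp add: \<tau>_def diag_def)
  show ?thesis
  proof (rule that[OF \<tau>])
    fix i j assume ij: "i < n" "j < i"
    have "f i / f j = 2 powi (2 * int (i - j))"
      unfolding f_def using ij by (simp flip: power_int_diff add: of_nat_diff algebra_simps)
    also have "\<dots> = 2 ^ (2 * (i - j))" by (metis of_nat_mult of_nat_numeral power_int_of_nat)
    finally have "f i / f j = 2 ^ (2 * (i - j))" .
    moreover have "cmod (2 ^ (2 * (i - j))) > 1" using ij by (simp add: norm_power)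
    ultimately show "cmod (\<tau> $$ (x i, x i) / \<tau> $$ (x j, x j)) > 1"
      using entry[of i] entry[of j] ij by simp
  qed
qed


locale flag_chart = flag_variety n \<Delta> + chart n "flag_stab n \<Delta>" X \<sigma> U g for n \<Delta> X \<sigma> U g +
  fixes w x
  assumes w: "w permutes {1..n}" and fixed_point_U: "fixed_point n (flag_stab n \<Delta>) w \<in> U"
  defines "x \<equiv> row_perm w"
begin

lemma x: "x permutes {..<n}"
  unfolding x_def by (rule row_perm_permutes[OF w])

lemma x_less: "i < n \<Longrightarrow> x i < n"
  using permutes_in_image[OF x, of i] by simp

lemma level_le: "k \<in> \<Delta> \<Longrightarrow> k \<le> n"
  using levels by auto

lemma g_U: "pt g \<in> U"
  using base(2) dense_U by blast

text \<open>
  The zeros of this minor form a closed subset of the chart that is stable under the torus and does not contain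
  the fixed point.
\<close>
lemma fixed_minor_nonzero:
  assumes k: "k \<in> \<Delta>" and h: "h \<in> carrier (SL n)" "pt h \<in> U"
  shows "minor k x h \<noteq> 0"
proof
  assume zero: "minor k x h = 0"
  have xk: "x i < n" if "i < k" for i using that level_le[OF k] x_less by simp
  define W where "W = {pt h | h. h \<in> carrier (SL n) \<and> minor k x h \<noteq> 0}"
  have W_iff: "pt h \<in> W \<longleftrightarrow> minor k x h \<noteq> 0" if h: "h \<in> carrier (SL n)" for h
  proof
    assume "pt h \<in> W"
    then obtain h' where h': "h' \<in> carrier (SL n)" "pt h = pt h'" "minor k x h' \<noteq> 0"
      unfolding W_def by blast
    obtain c where c: "c \<noteq> 0" "\<And>r. (\<And>i. i < k \<Longrightarrow> r i < n) \<Longrightarrow> minor k r h = minor k r h' * c"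
      using minor_pt[OF h h'(1,2) k] by blast
    then show "minor k x h \<noteq> 0" using c(2)[of x, OF xk] h'(3) by simp
  qed (use h W_def in blast)
  obtain p where p: "p \<in> poly_funs (mat_coords n)" "\<forall>g\<in>carrier_mat n n. minor k x g = p g"
    using poly_fun_minor[of k n x, OF level_le[OF k] xk] unfolding poly_fun_def by blast
  have W_open: "openin (homog_topology n Q) W"
    unfolding openin_homog openin_zariski
  proof (intro conjI ballI)
    show "W \<subseteq> points" unfolding W_def points_def by blast
    fix h assume h: "h \<in> {g \<in> carrier (SL n). pt g \<in> W}"
    show "\<exists>f\<in>poly_funs (mat_coords n). f h \<noteq> 0 \<and>
        (\<forall>y\<in>carrier (SL n). f y \<noteq> 0 \<longrightarrow> y \<in> {g \<in> carrier (SL n). pt g \<in> W})"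
      by (rule bexI[OF _ p(1)]) (use h W_iff p(2) in auto)
  qed blast
  have Z: "U - W = {}"
  proof (rule stable_closed_empty[OF fixed_point_U])
    obtain A where A: "A \<in> weyl_coset n w" using weyl_coset_nonempty[OF w n_pos] .
    then have AS: "A \<in> carrier (SL n)" by (simp add: weyl_coset_def)
    have "minor k x A \<noteq> 0" unfolding x_def by (rule minor_weyl_nonzero[OF w A level_le[OF k]])
    then show "fixed_point n Q w \<notin> U - W"
      using W_iff[OF AS] fixed_point_eq_pt[OF w A] by simp
    fix t z assume t: "t \<in> torus n" and z: "z \<in> U - W"
    obtain h where h: "h \<in> carrier (SL n)" "z = pt h" using z U_points by (blast elim: pointsE)
    have "minor k x (t * h) = (\<Prod>i<k. t $$ (x i, x i)) * minor k x h"
      using minor_torus_mult[OF t _ level_le[OF k] xk, of h] h(1) by simp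
    then have "minor k x (t * h) = 0" using W_iff[OF h(1)] z h(2) by simp
    then have "pt (t * h) \<notin> W" using W_iff[of "t * h"] mult_SL[OF torus_carrier[OF t] h(1)] by blast
    then show "t <#\<^bsub>SL n\<^esub> z \<in> U - W"
      using U_stable[OF t, of z] z unfolding h(2) torus_pt[OF t h(1)] by blast
  next
    have "U - (U - W) = W \<inter> U" by blast
    then show "openin (subtopology (homog_topology n Q) U) (U - (U - W))"
      unfolding openin_subtopology using W_open by blast
  qed (use torus_fixed_point[OF w n_pos] in auto)
  then show False using W_iff[OF h(1)] h(2) zero by blast
qed

text \<open>
  The ratio of the minors with rows \<open>r\<close> and \<open>x\<close> is a function on \<open>G/Q\<close> of this weight, and it is regular on the
  chart because its denominator has no zeros there.
\<close>
lemma minor_weight_in_dual_monoid: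
  assumes k: "k \<in> \<Delta>" and r: "\<And>i. i < k \<Longrightarrow> r i < n" and nz: "minor k r g \<noteq> 0"
  shows "torus_char n (weight_exp k r x) \<in> dual_monoid lattice \<sigma>"
proof -
  note kn = level_le[OF k]
  have xk: "x i < n" if "i < k" for i using that kn x_less by simp
  define f where "f c = (let h = SOME h. h \<in> carrier (SL n) \<and> pt h = c in minor k r h / minor k x h)" for c
  have f: "f (pt h) = minor k r h / minor k x h" if h: "h \<in> carrier (SL n)" for h
  proof -
    define h' where "h' = (SOME h'. h' \<in> carrier (SL n) \<and> pt h' = pt h)"
    have h': "h' \<in> carrier (SL n) \<and> pt h' = pt h"
      unfolding h'_def by (rule someI[of _ h]) (use h in simp)
    obtain c where c: "c \<noteq> 0" "\<And>r. (\<And>i. i < k \<Longrightarrow> r i < n) \<Longrightarrow> minor k r h' = minor k r h * c"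
      using minor_pt[of h' h k] h' h k by blast
    have "minor k r h' / minor k x h' = minor k r h / minor k x h"
      using c(1) c(2)[of r, OF r] c(2)[of x, OF xk] by simp
    then show ?thesis unfolding f_def h'_def[symmetric] by (simp add: Let_def)
  qed
  obtain p where p: "p \<in> poly_funs (mat_coords n)" "\<forall>g\<in>carrier_mat n n. minor k r g = p g"
    using poly_fun_minor[of k n r, OF kn r] unfolding poly_fun_def by blast
  obtain q where q: "q \<in> poly_funs (mat_coords n)" "\<forall>g\<in>carrier_mat n n. minor k x g = q g"
    using poly_fun_minor[of k n x, OF kn xk] unfolding poly_fun_def by blast
  have reg: "homog_regular n Q U f"
    unfolding homog_regular_def regular_on_def
  proof
    fix h assume "h \<in> {g \<in> carrier (SL n). pt g \<in> U}"
    then have h: "h \<in> carrier (SL n)" "pt h \<in> U" by auto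
    have "q h \<noteq> 0" using fixed_minor_nonzero[OF k h] q(2) h(1) by simp
    moreover have "f (pt y) = p y / q y" if "y \<in> carrier (SL n)" for y
      using f[OF that] p(2) q(2) that by simp
    ultimately show "\<exists>p\<in>poly_funs (mat_coords n). \<exists>q\<in>poly_funs (mat_coords n). q h \<noteq> 0 \<and>
        (\<forall>y\<in>{g \<in> carrier (SL n). pt g \<in> U}. q y \<noteq> 0 \<longrightarrow> f (pt y) = p y / q y)"
      using p(1) q(1) by blast
  qed
  show ?thesis
  proof (rule character_in_dual_monoid[OF reg])
    show "f (pt g) \<noteq> 0" using f[OF base(1)] nz fixed_minor_nonzero[OF k base(1) g_U] by simp
    show "torus_char n (weight_exp k r x) \<in> characters n" by (simp add: characters_eq)
    fix t assume t: "t \<in> torus n"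
    have gm: "g \<in> carrier_mat n n" using base(1) by simp
    have "f (t <#\<^bsub>SL n\<^esub> pt g) = minor k r (t * g) / minor k x (t * g)"
      using f[OF mult_SL[OF torus_carrier[OF t] base(1)]] torus_pt[OF t base(1)] by simp
    also have "\<dots> = torus_char n (weight_exp k r x) t * f (pt g)"
      using torus_char_weight_exp[OF t r xk] f[OF base(1)]
        minor_torus_mult[OF t gm kn, of r, OF r] minor_torus_mult[OF t gm kn, of x, OF xk]
      by (simp add: prod_dividef)
    finally show "f (t <#\<^bsub>SL n\<^esub> pt g) = torus_char n (weight_exp k r x) t * f (pt g)" .
  qed
qed


text \<open>
  A weight function of the chart is evaluated on the representatives \<open>t h (x\<inverse> t\<inverse> x)\<close> of the dense
  orbit, where \<open>h\<close> is in block echelon form.  Their entries are constants times the characters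
  \<open>t\<^bsub>x i\<^esub> / t\<^bsub>x j\<^esub>\<close> with \<open>h\<^bsub>x i, j\<^esub> \<noteq> 0\<close>, and setting these characters to \<open>0\<close> gives the fixed point, where the
  denominator does not vanish.  So the independence of characters makes the weight a product of such
  characters, as no such product is trivial.
\<close>
lemma dual_monoid_generated:
  assumes \<chi>: "\<chi> \<in> dual_monoid lattice \<sigma>"
  shows "\<chi> = torus_char n (\<lambda>_. 0) \<or>
    \<chi> \<in> semigroup_gen {torus_char n (weight_exp k r x) | k r. k \<in> \<Delta> \<and> (\<forall>i<k. r i < n) \<and> minor k r g \<noteq> 0}"
    (is "_ \<or> \<chi> \<in> semigroup_gen ?E")
proof -
  have \<chi>c: "\<chi> \<in> characters n" using \<chi> dual_monoid_characters by blast
  obtain q where q: "q \<in> Q" "cell_shape n \<Delta> x (g * q)"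
    using cell_shape_exists[OF levels n_pos base(1) x] fixed_minor_nonzero[OF _ base(1) g_U] by blast
  define h where "h = g * q"
  have h: "h \<in> carrier (SL n)" "pt h = pt g" "cell_shape n \<Delta> x h"
    using mult_SL[OF base(1) Q_carrier[OF q(1)]] pt_mult[OF base(1) q(1)] q(2) by (simp_all only: h_def)
  have hm: "h \<in> carrier_mat n n" "det h = 1" using h(1) by simp_all
  have diag_nz: "h $$ (x j, j) \<noteq> 0" if "j < n" for j
    using cell_shape_diagonal_nonzero[OF h(3) x hm(1)] hm(2) that by simp
  define \<eta> where "\<eta> i j = torus_char n (weight_exp 1 (\<lambda>_. x i) (\<lambda>_. x j))" for i j
  have \<eta>: "\<eta> i j t = t $$ (x i, x i) / t $$ (x j, x j)" if "t \<in> torus n" "i < n" "j < n" for i j t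
    unfolding \<eta>_def using torus_char_weight_exp[OF that(1), of 1 "\<lambda>_. x i" "\<lambda>_. x j"] that x_less by simp
  define E0 where "E0 = {\<eta> i j | i j. i < n \<and> j < n \<and> i \<noteq> j \<and> h $$ (x i, j) \<noteq> 0}"
  let ?M = "semigroup_gen E0"
  have E0_E: "E0 \<subseteq> ?E"
  proof
    fix e assume "e \<in> E0"
    then obtain i j where ij: "i < n" "j < n" "i \<noteq> j" "h $$ (x i, j) \<noteq> 0" "e = \<eta> i j"
      unfolding E0_def by blast
    obtain k where k: "k \<in> \<Delta>" "j < k" and nz: "minor k (x(j := x i)) h \<noteq> 0"
      using cell_shape_minor_nonzero[OF h(3) diag_nz ij(1-4)] by blast
    let ?r = "x(j := x i)"
    have rows: "?r a < n" if "a < k" for a using that ij x_less level_le[OF k(1)] by auto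
    obtain c where "minor k ?r h = minor k ?r g * c"
      using minor_pt[OF h(1) base(1) h(2) k(1)] rows by blast
    then have "minor k ?r g \<noteq> 0" using nz by auto
    moreover have "weight_exp k ?r x = weight_exp 1 (\<lambda>_. x i) (\<lambda>_. x j)"
    proof
      fix l
      have "weight_exp k ?r x l = (\<Sum>a<k. if a = j then of_bool (x i = l) - of_bool (x j = l) else 0)"
        unfolding weight_exp_def by (intro sum.cong) auto
      then show "weight_exp k ?r x l = weight_exp 1 (\<lambda>_. x i) (\<lambda>_. x j) l"
        using k(2) by (simp add: weight_exp_def sum.delta)
    qed
    ultimately show "e \<in> ?E" using ij(5) k(1) rows unfolding \<eta>_def by (intro CollectI exI[of _ k] exI[of _ ?r]) simp
  qed
  obtain \<tau> where \<tau>: "\<tau> \<in> torus n"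
    "\<And>i j. i < n \<Longrightarrow> j < i \<Longrightarrow> cmod (\<tau> $$ (x i, x i) / \<tau> $$ (x j, x j)) > 1"
    using increasing_torus_element[OF x] by blast
  have M: "m \<in> characters n \<and> cmod (m \<tau>) > 1" if "m \<in> ?M" for m
    using that
  proof (induction rule: semigroup_gen.induct)
    case (base e)
    then obtain i j where ij: "i < n" "j < n" "i \<noteq> j" "h $$ (x i, j) \<noteq> 0" "e = \<eta> i j"
      unfolding E0_def by blast
    then have "j < i" using cell_shapeD[OF h(3) ij(1,2,4,3)] by auto
    then show ?case using ij \<eta>[OF \<tau>(1)] \<tau>(2)[OF ij(1)] by (simp add: \<eta>_def characters_eq)
  next
    case (mult a b)
    have "1 * 1 < cmod (a \<tau>) * cmod (b \<tau>)" using mult.IH by (intro mult_strict_mono) auto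
    then show ?case using mult.IH characters_mult_closed by (auto simp: norm_mult)
  qed
  define D where "D t = diag n (\<lambda>j. inverse (t $$ (x j, x j)))" for t
  have D: "D t \<in> torus n" if t: "t \<in> torus n" for t unfolding D_def by (rule torus_conjugate[OF x t])
  \<comment> \<open>representatives of the dense orbit that specialise to a representative \<open>m0\<close> of the fixed point\<close>
  define H where "H t = t * h * D t" for t
  have H: "H t \<in> carrier (SL n)" "pt (H t) = t <#\<^bsub>SL n\<^esub> pt g" if t: "t \<in> torus n" for t
  proof -
    have th: "t * h \<in> carrier (SL n)" using mult_SL[OF torus_carrier[OF t] h(1)] .
    show "H t \<in> carrier (SL n)" unfolding H_def using mult_SL[OF th torus_carrier[OF D[OF t]]] .
    have "D t \<in> Q" using D[OF t] torus_le by blast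
    then show "pt (H t) = t <#\<^bsub>SL n\<^esub> pt g"
      unfolding H_def using pt_mult[OF th] torus_pt[OF t h(1)] h(2) by simp
  qed
  have H_entry: "H t $$ (x i, j) = t $$ (x i, x i) * h $$ (x i, j) * inverse (t $$ (x j, x j))"
    if "t \<in> torus n" "i < n" "j < n" for t i j
  proof -
    have "t * h \<in> carrier_mat n n" using torus_carrier_mat[OF that(1)] hm(1) by simp
    then show ?thesis unfolding H_def D_def
      using mult_diag_index[of "t * h" n "x i" j] torus_mult_index[OF that(1) hm(1), of "x i" j]
        x_less that by simp
  qed
  define m0 where "m0 = monomial n x (\<lambda>j. h $$ (x j, j))"
  have m0_entry: "m0 $$ (x i, j) = (if i = j then h $$ (x j, j) else 0)" if "i < n" "j < n" for i j
    unfolding m0_def using monomial_index[OF x that] .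
  have "signof x * det m0 = signof x * det h"
    unfolding m0_def using det_monomial[OF x] minor_cell_shape[OF h(3), of n] minor_permutes[OF x hm(1)] by simp
  then have "det m0 = 1" using hm(2) by (auto simp: sign_def split: if_splits)
  then have m0S: "m0 \<in> carrier (SL n)" by (simp add: m0_def)
  have "m0 \<in> weyl_coset n w"
    unfolding weyl_coset_row_perm[OF w] x_def[symmetric]
    using m0S diag_nz by (auto simp: m0_def monomial_def)
  then have m0U: "pt m0 \<in> U" using fixed_point_eq_pt[OF w] fixed_point_U by metis
  have expand: "\<exists>\<psi>\<in>lin_span ?M. \<forall>t\<in>torus n. p (H t) = p m0 + \<psi> t"
    if "p \<in> poly_funs (mat_coords n)" for p
    using that
  proof induction
    case (coord p)
    then obtain a j where p: "p = (\<lambda>A. A $$ (a, j))" "a < n" "j < n" by (auto simp: mat_coords_def)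
    obtain i where i: "i < n" "a = x i" using permutes_image[OF x] p(2) by (metis imageE lessThan_iff)
    show ?case
    proof (cases "i = j \<or> h $$ (x i, j) = 0")
      case True
      have *: "p (H t) = p m0 + 0" if "t \<in> torus n" for t
        unfolding p(1) i(2) using H_entry[OF that i(1) p(3)] m0_entry[OF i(1) p(3)] True
          torus_nonzero[OF that x_less[OF i(1)]] by auto
      show ?thesis by (rule bexI[OF _ lin_span.zero], rule ballI, rule *)
    next
      case False
      have *: "p (H t) = p m0 + h $$ (x i, j) * \<eta> i j t" if "t \<in> torus n" for t
        unfolding p(1) i(2) using H_entry[OF that i(1) p(3)] m0_entry[OF i(1) p(3)] False
          \<eta>[OF that i(1) p(3)] by (simp add: divide_inverse)
      have "\<eta> i j \<in> ?M" using False i(1) p(3) by (intro semigroup_gen.base) (auto simp: E0_def)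
      then have "(\<lambda>t. h $$ (x i, j) * \<eta> i j t) \<in> lin_span ?M" by (rule lin_span.scale)
      then show ?thesis by (rule bexI[rotated]) (use * in blast)
    qed
  next
    case (const c)
    show ?case by (rule bexI[OF _ lin_span.zero]) simp
  next
    case (add p1 p2)
    then obtain \<psi>1 \<psi>2 where "\<psi>1 \<in> lin_span ?M" "\<psi>2 \<in> lin_span ?M"
      "\<forall>t\<in>torus n. p1 (H t) = p1 m0 + \<psi>1 t" "\<forall>t\<in>torus n. p2 (H t) = p2 m0 + \<psi>2 t" by blast
    then show ?case by (intro bexI[of _ "\<lambda>t. \<psi>1 t + \<psi>2 t"]) (auto intro: lin_span.add)
  next
    case (mult p1 p2)
    then obtain \<psi>1 \<psi>2 where \<psi>: "\<psi>1 \<in> lin_span ?M" "\<psi>2 \<in> lin_span ?M"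
      "\<forall>t\<in>torus n. p1 (H t) = p1 m0 + \<psi>1 t" "\<forall>t\<in>torus n. p2 (H t) = p2 m0 + \<psi>2 t" by blast
    show ?case
    proof (rule bexI)
      show "\<forall>t\<in>torus n. p1 (H t) * p2 (H t) = p1 m0 * p2 m0 + (p1 m0 * \<psi>2 t + p2 m0 * \<psi>1 t + \<psi>1 t * \<psi>2 t)"
        using \<psi>(3,4) by (simp add: algebra_simps)
      show "(\<lambda>t. p1 m0 * \<psi>2 t + p2 m0 * \<psi>1 t + \<psi>1 t * \<psi>2 t) \<in> lin_span ?M"
        by (intro lin_span.add lin_span_cmult lin_span_mult[OF \<psi>(1,2)] \<psi>(1,2) semigroup_gen.mult)
    qed
  qed
  \<comment> \<open>the function of weight \<open>\<chi>\<close> on the orbit of the base point, extended by \<open>0\<close>\<close>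
  define e where "e c = (if \<exists>t\<in>torus n. c = t <#\<^bsub>SL n\<^esub> pt g
      then \<chi> (SOME t. t \<in> torus n \<and> c = t <#\<^bsub>SL n\<^esub> pt g) else 0)" for c
  let ?inv = "\<lambda>t. diag n (\<lambda>i. inverse (t $$ (i, i)))"
  have gp: "pt g \<in> points" using pt_in_points[OF base(1)] .
  have e: "e (t <#\<^bsub>SL n\<^esub> pt g) = \<chi> t" if t: "t \<in> torus n" for t
  proof -
    define s where "s = (SOME s. s \<in> torus n \<and> t <#\<^bsub>SL n\<^esub> pt g = s <#\<^bsub>SL n\<^esub> pt g)"
    have s: "s \<in> torus n" "t <#\<^bsub>SL n\<^esub> pt g = s <#\<^bsub>SL n\<^esub> pt g"
      using someI[of "\<lambda>s. s \<in> torus n \<and> t <#\<^bsub>SL n\<^esub> pt g = s <#\<^bsub>SL n\<^esub> pt g" t] t unfolding s_def by auto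
    note u = torus_diag_inverse[OF s(1)]
    have us: "?inv s * s = 1\<^sub>m n" by (rule torus_inverse_mult[OF s(1)])
    have "(?inv s * t) <#\<^bsub>SL n\<^esub> pt g = (?inv s * s) <#\<^bsub>SL n\<^esub> pt g"
      using torus_torus_points[OF u t gp] torus_torus_points[OF u s(1) gp] s(2) by simp
    also have "\<dots> = pt g" unfolding us using one_pt[OF gp] .
    finally have "\<forall>x\<in>dense X. (?inv s * t) <#\<^bsub>SL n\<^esub> x = x"
      using stabilizer_dense[OF base torus_mult_closed[OF u t]] dense_subset by blast
    then have "\<chi> (?inv s * t) = 1"
      using \<chi> torus_mult_closed[OF u t] by (auto simp: dual_monoid_def char_lattice_def)
    moreover have "\<chi> (?inv s * s) = 1" unfolding us by (rule characters_one[OF \<chi>c])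
    ultimately have "\<chi> (?inv s) * \<chi> t = \<chi> (?inv s) * \<chi> s"
      using characters_hom[OF \<chi>c u t] characters_hom[OF \<chi>c u s(1)] by simp
    then have "\<chi> t = \<chi> s" using characters_nonzero[OF \<chi>c u] mult_left_cancel by blast
    moreover have "e (t <#\<^bsub>SL n\<^esub> pt g) = \<chi> s" unfolding e_def s_def using t by auto
    ultimately show ?thesis by simp
  qed
  have e_weight: "e (t <#\<^bsub>SL n\<^esub> y) = \<chi> t * e y" if t: "t \<in> torus n" and y: "y \<in> dense X" for t y
  proof (cases "\<exists>s\<in>torus n. y = s <#\<^bsub>SL n\<^esub> pt g")
    case True
    then obtain s where s: "s \<in> torus n" "y = s <#\<^bsub>SL n\<^esub> pt g" by blast
    then show ?thesis
      using e[OF torus_mult_closed[OF t s(1)]] e[OF s(1)] torus_torus_points[OF t s(1) gp]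
        characters_hom[OF \<chi>c t s(1)] by simp
  next
    case False
    have yp: "y \<in> points" using dense_subset y dense_imp_points[OF y] by blast
    note u = torus_diag_inverse[OF t]
    have "\<not> (\<exists>s\<in>torus n. t <#\<^bsub>SL n\<^esub> y = s <#\<^bsub>SL n\<^esub> pt g)"
    proof
      assume "\<exists>s\<in>torus n. t <#\<^bsub>SL n\<^esub> y = s <#\<^bsub>SL n\<^esub> pt g"
      then obtain s where s: "s \<in> torus n" "t <#\<^bsub>SL n\<^esub> y = s <#\<^bsub>SL n\<^esub> pt g" by blast
      have "y = (?inv t * t) <#\<^bsub>SL n\<^esub> y" using torus_inverse_mult[OF t] one_pt[OF yp] by simp
      also have "\<dots> = (?inv t * s) <#\<^bsub>SL n\<^esub> pt g"
        using torus_torus_points[OF u t yp] torus_torus_points[OF u s(1) gp] s(2) by simp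
      finally show False using False torus_mult_closed[OF u s(1)] by blast
    qed
    then show ?thesis using False unfolding e_def by simp
  qed
  obtain f where f: "homog_regular n Q U f" "\<forall>x\<in>dense X. f x = e x"
    using weight_extends[OF \<chi>, of e] e_weight by blast
  obtain p r where pr: "p \<in> poly_funs (mat_coords n)" "r \<in> poly_funs (mat_coords n)" "r m0 \<noteq> 0"
    "\<And>y. y \<in> carrier (SL n) \<Longrightarrow> pt y \<in> U \<Longrightarrow> r y \<noteq> 0 \<Longrightarrow> f (pt y) = p y / r y"
    using homog_regularD[OF f(1) m0S m0U] by blast
  \<comment> \<open>the additional factor \<open>r\<close> makes the equation hold also where \<open>r\<close> vanishes\<close>
  have eq: "\<chi> t * (r (H t) * r (H t)) = p (H t) * r (H t)" if t: "t \<in> torus n" for t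
  proof (cases "r (H t) = 0")
    case False
    have "pt (H t) \<in> dense X" using H(2)[OF t] dense_torus[OF base(2) t] by simp
    moreover have "e (pt (H t)) = \<chi> t" using H(2)[OF t] e[OF t] by simp
    ultimately have "\<chi> t = p (H t) / r (H t)"
      using pr(4)[OF H(1)[OF t] _ False] f(2) dense_U by auto
    then show ?thesis using False by simp
  qed simp
  obtain \<psi>1 where \<psi>1: "\<psi>1 \<in> lin_span ?M" "\<forall>t\<in>torus n. r (H t) * r (H t) = r m0 * r m0 + \<psi>1 t"
    using expand[OF poly_funs.mult[OF pr(2,2)]] by blast
  obtain \<psi>2 where \<psi>2: "\<psi>2 \<in> lin_span ?M" "\<forall>t\<in>torus n. p (H t) * r (H t) = p m0 * r m0 + \<psi>2 t"
    using expand[OF poly_funs.mult[OF pr(1,2)]] by blast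
  let ?one = "torus_char n (\<lambda>_. 0)"
  have "\<chi> = ?one \<or> \<chi> \<in> ?M"
  proof (rule ccontr)
    assume not: "\<not> (\<chi> = ?one \<or> \<chi> \<in> ?M)"
    define V where "V = insert ?one (?M \<union> {\<lambda>t. \<chi> t * m t | m. m \<in> ?M})"
    have "r m0 * r m0 = 0"
    proof (rule character_not_in_lin_span[OF \<chi>c])
      have "\<chi> \<noteq> (\<lambda>t. \<chi> t * m t)" if "m \<in> ?M" for m
      proof
        assume "\<chi> = (\<lambda>t. \<chi> t * m t)"
        then have "\<chi> \<tau> = \<chi> \<tau> * m \<tau>" by metis
        then show False using M[OF that] characters_nonzero[OF \<chi>c \<tau>(1)] by auto
      qed
      then show "\<chi> \<notin> V" using not unfolding V_def by blast
      show "V \<subseteq> characters n"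
        unfolding V_def using M characters_mult_closed[OF \<chi>c] by (auto simp: characters_eq)
      have 1: "(\<lambda>t. (p m0 * r m0) * ?one t) \<in> lin_span V"
        by (rule lin_span.scale) (simp add: V_def)
      have 2: "\<psi>2 \<in> lin_span V" by (rule lin_span_mono[OF \<psi>2(1)]) (auto simp: V_def)
      have "(\<lambda>t. 1 * \<chi> t) \<in> lin_span {\<chi>}" by (rule lin_span.scale) simp
      then have "(\<lambda>t. (1 * \<chi> t) * \<psi>1 t) \<in> lin_span V"
        by (rule lin_span_mult[OF _ \<psi>1(1)]) (auto simp: V_def)
      from lin_span_cmult[OF this, of "-1"] have 3: "(\<lambda>t. - 1 * ((1 * \<chi> t) * \<psi>1 t)) \<in> lin_span V" .
      show "(\<lambda>t. (p m0 * r m0) * ?one t + \<psi>2 t + - 1 * ((1 * \<chi> t) * \<psi>1 t)) \<in> lin_span V"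
        by (intro lin_span.add 1 2 3)
      fix t assume t: "t \<in> torus n"
      have one: "?one t = 1" using t by (simp add: torus_char_def)
      have "\<chi> t * (r m0 * r m0 + \<psi>1 t) = p m0 * r m0 + \<psi>2 t" using eq[OF t] \<psi>1(2) \<psi>2(2) t by simp
      then show "r m0 * r m0 * \<chi> t = (p m0 * r m0) * ?one t + \<psi>2 t + - 1 * ((1 * \<chi> t) * \<psi>1 t)"
        unfolding one by (simp add: algebra_simps)
    qed
    then show False using pr(3) by simp
  qed
  moreover have "m \<in> semigroup_gen ?E" if "m \<in> ?M" for m
    using that
  proof (induction rule: semigroup_gen.induct)
    case (base e)
    then show ?case using E0_E semigroup_gen.base[of e ?E] by blast
  next
    case (mult a b)
    then show ?case by (intro semigroup_gen.mult)
  qed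
  ultimately show ?thesis by blast
qed

text \<open>
  The dual monoid of the cone contains the weights of the minors and is generated by them, and a rational
  cone is the dual of its dual monoid.  The cone therefore depends on the fixed point only, not on the chart.
\<close>
theorem chart_cone_eq:
  assumes \<sigma>: "strongly_convex_rational_cone lattice \<sigma>"
  shows "\<sigma> = {\<nu> \<in> N_real lattice. \<forall>k\<in>\<Delta>. \<forall>r. (\<forall>i<k. r i < n) \<longrightarrow> minor k r g \<noteq> 0 \<longrightarrow>
    0 \<le> \<nu> (torus_char n (weight_exp k r x))}" (is "\<sigma> = ?K")
proof
  show "\<sigma> \<subseteq> ?K"
    using minor_weight_in_dual_monoid strongly_convex_rational_cone_subset[OF \<sigma>]
    by (auto simp: dual_monoid_def)
  show "?K \<subseteq> \<sigma>"
  proof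
    fix \<nu> assume \<nu>: "\<nu> \<in> ?K"
    then have \<nu>N: "\<nu> \<in> N_real lattice" by blast
    have one: "0 \<le> \<nu> (torus_char n (\<lambda>_. 0))"
    proof -
      have "torus_char n (\<lambda>_. 0) \<in> lattice" by (auto simp: char_lattice_def characters_eq torus_char_def)
      then have "\<nu> (\<lambda>t. torus_char n (\<lambda>_. 0) t * torus_char n (\<lambda>_. 0) t)
          = \<nu> (torus_char n (\<lambda>_. 0)) + \<nu> (torus_char n (\<lambda>_. 0))"
        using \<nu>N unfolding N_real_def by blast
      then show ?thesis by (simp add: torus_char_mult)
    qed
    let ?E = "{torus_char n (weight_exp k r x) | k r. k \<in> \<Delta> \<and> (\<forall>i<k. r i < n) \<and> minor k r g \<noteq> 0}"
    have gen: "m \<in> dual_monoid lattice \<sigma> \<and> 0 \<le> \<nu> m" if "m \<in> semigroup_gen ?E" for m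
      using that
    proof (induction rule: semigroup_gen.induct)
      case (base e)
      then show ?case using minor_weight_in_dual_monoid \<nu> by blast
    next
      case (mult a b)
      have ab: "a \<in> lattice" "b \<in> lattice" using mult.IH by (auto simp: dual_monoid_def)
      have "(\<lambda>t. a t * b t) \<in> lattice"
        using ab characters_mult_closed by (auto simp: char_lattice_def)
      moreover have add: "\<mu> (\<lambda>t. a t * b t) = \<mu> a + \<mu> b" if "\<mu> \<in> N_real lattice" for \<mu>
        using that ab unfolding N_real_def by blast
      moreover have "0 \<le> \<mu> (\<lambda>t. a t * b t)" if "\<mu> \<in> \<sigma>" for \<mu>
        using add[of \<mu>] that mult.IH strongly_convex_rational_cone_subset[OF \<sigma>] by (auto simp: dual_monoid_def)
      moreover have "0 \<le> \<nu> (\<lambda>t. a t * b t)" using add[OF \<nu>N] mult.IH by simp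
      ultimately show ?case by (auto simp: dual_monoid_def)
    qed
    show "\<nu> \<in> \<sigma>"
    proof (rule rational_cone_double_dual[OF _ char_lattice_eq_annihilator \<sigma> \<nu>N])
      fix \<chi> assume "\<chi> \<in> dual_monoid lattice \<sigma>"
      then show "0 \<le> \<nu> \<chi>" using dual_monoid_generated one gen by blast
    qed blast
  qed
qed

end

section \<open>Schubert varieties\<close>

lemma borel_diagonal_nonzero:
  assumes "b \<in> borel n" "i < n"
  shows "b $$ (i, i) \<noteq> 0"
proof -
  have b: "b \<in> carrier_mat n n" "det b = 1" "\<And>i j. i < n \<Longrightarrow> j < i \<Longrightarrow> b $$ (i, j) = 0"
    using assms(1) by (auto simp: borel_def)
  have "det b = (\<Prod>i<n. b $$ (i, i))" by (rule det_upper_triangular_prod[OF b(1,3)])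
  then have "(\<Prod>i<n. b $$ (i, i)) \<noteq> 0" using b(2) by simp
  then show ?thesis using assms(2) by (metis finite_lessThan lessThan_iff prod_zero)
qed

text \<open>
  Multiplication with the inverse of \<open>A\<close> only permutes and scales the columns.
\<close>
lemma upper_shape_borel:
  assumes w: "w permutes {1..n}" and A: "A \<in> weyl_coset n w" and h: "h \<in> carrier (SL n)"
    and upper: "\<And>i j. i < n \<Longrightarrow> j < n \<Longrightarrow> h $$ (row_perm w i, j) \<noteq> 0 \<Longrightarrow> row_perm w i \<le> row_perm w j"
  shows "\<exists>b\<in>borel n. h = b * A"
proof -
  let ?x = "row_perm w"
  have x: "?x permutes {..<n}" by (rule row_perm_permutes[OF w])
  have xlt: "?x i < n" if "i < n" for i using permutes_in_image[OF x, of i] that by simp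
  have surj: "\<exists>i<n. a = ?x i" if "a < n" for a
    using permutes_image[OF x] that by (metis imageE lessThan_iff)
  have y: "inv_into UNIV ?x (?x j) = j" for j using permutes_inverses(2)[OF x] .
  have Am: "A \<in> carrier_mat n n" "det A = 1" using A by (auto simp: weyl_coset_def)
  have Anz: "A $$ (?x j, j) \<noteq> 0" if "j < n" for j
    using A that xlt[OF that] unfolding weyl_coset_row_perm[OF w] by blast
  define b where "b = mat n n (\<lambda>(a, c). h $$ (a, inv_into UNIV ?x c) / A $$ (c, inv_into UNIV ?x c))"
  have bm: "b \<in> carrier_mat n n" by (simp add: b_def)
  have hb: "h = b * A"
  proof (rule eq_matI)
    fix i j assume "i < dim_row (b * A)" "j < dim_col (b * A)"
    then have ij: "i < n" "j < n" using bm Am by auto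
    show "h $$ (i, j) = (b * A) $$ (i, j)"
      using mult_weyl_index[OF w A bm ij] ij xlt[OF ij(2)] Anz[OF ij(2)] by (simp add: b_def y)
  qed (use h bm Am in auto)
  have "det b = 1" using det_mult[OF bm Am(1)] hb h Am(2) by simp
  moreover have "b $$ (i, j) = 0" if "i < n" "j < i" for i j
  proof (rule ccontr)
    assume nz: "b $$ (i, j) \<noteq> 0"
    obtain i' where i': "i' < n" "i = ?x i'" using surj \<open>i < n\<close> by blast
    have "j < n" using that by simp
    then obtain j' where j': "j' < n" "j = ?x j'" using surj by blast
    have "h $$ (?x i', j') \<noteq> 0" using nz that i' j' xlt by (simp add: b_def y)
    then have "i \<le> j" using upper i' j' by blast
    then show False using that by simp
  qed
  ultimately have "b \<in> borel n" using bm by (auto simp: borel_def)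
  then show ?thesis using hb by blast
qed

lemma min_coset_reps_permutes: "w \<in> min_coset_reps n d \<Longrightarrow> w permutes {1..n}"
  by (simp add: min_coset_reps_def sym_group_def)

lemma min_coset_reps_descent:
  assumes w: "w \<in> min_coset_reps n d" and ij: "j < i" "i < n" "row_perm w i < row_perm w j"
  shows "j < d \<and> d \<le> i"
proof -
  have perm: "w permutes {1..n}" by (rule min_coset_reps_permutes[OF w])
  have less: "w (Suc i) < w (Suc j)"
    using ij(3) Suc_row_perm[OF perm, of i] Suc_row_perm[OF perm, of j] by linarith
  have "\<not> i < d"
  proof
    assume "i < d"
    then have "w (Suc j) < w (Suc i)"
      using w ij by (intro strict_mono_onD[of "{1..d}" w]) (auto simp: min_coset_reps_def)
    then show False using less by simp
  qed
  moreover have "\<not> d \<le> j"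
  proof
    assume "d \<le> j"
    then have "w (Suc j) < w (Suc i)"
      using w ij by (intro strict_mono_onD[of "{d+1..n}" w]) (auto simp: min_coset_reps_def)
    then show False using less by simp
  qed
  ultimately show ?thesis by simp
qed

context homogeneous_space begin

lemma schubert_vanish:
  assumes w: "w permutes {1..n}" and A: "A \<in> weyl_coset n w"
    and h: "h \<in> carrier (SL n)" "pt h \<in> schubert_variety n Q w"
    and F: "poly_fun n F" "\<And>b q. b \<in> borel n \<Longrightarrow> q \<in> Q \<Longrightarrow> F (b * A * q) = 0"
  shows "F h = 0"
proof -
  obtain f where f: "f \<in> poly_funs (mat_coords n)" "\<forall>g\<in>carrier_mat n n. F g = f g"
    using F(1) unfolding poly_fun_def by blast
  have AS: "A \<in> carrier (SL n)" using A by (simp add: weyl_coset_def)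
  have "f s = 0" if s: "s \<in> carrier (SL n)" "pt s \<in> (\<lambda>b. pt (b * A)) ` borel n" for s
  proof -
    obtain b where b: "b \<in> borel n" "pt s = pt (b * A)" using s(2) by blast
    have "b * A \<in> carrier (SL n)" using mult_SL[of b A] b(1) AS by (simp add: borel_def)
    then obtain q where q: "q \<in> Q" "s = b * A * q" using pt_eq_iff s(1) b(2) by metis
    then show ?thesis using F(2)[OF b(1) q(1)] f(2) s(1) by auto
  qed
  then have "f h = 0"
    using homog_closure_iff[OF h(1)] h(2) f(1) unfolding schubert_variety_eq[OF w A] by blast
  then show ?thesis using f(2) h(1) by auto
qed

lemma in_schubertI:
  assumes w: "w permutes {1..n}" and A: "A \<in> weyl_coset n w" and h: "h \<in> carrier (SL n)"
    and vanish: "\<And>f. f \<in> poly_funs (mat_coords n) \<Longrightarrow>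
      (\<And>b q. b \<in> borel n \<Longrightarrow> q \<in> Q \<Longrightarrow> f (b * A * q) = 0) \<Longrightarrow> f h = 0"
  shows "pt h \<in> schubert_variety n Q w"
  unfolding schubert_variety_eq[OF w A] homog_closure_iff[OF h]
proof (intro ballI impI)
  fix f assume f: "f \<in> poly_funs (mat_coords n)"
    and zero: "\<forall>s\<in>carrier (SL n). pt s \<in> (\<lambda>b. pt (b * A)) ` borel n \<longrightarrow> f s = 0"
  show "f h = 0"
  proof (rule vanish[OF f])
    fix b q assume b: "b \<in> borel n" and q: "q \<in> Q"
    have "b * A \<in> carrier (SL n)" using mult_SL[of b A] b A by (simp add: borel_def weyl_coset_def)
    then show "f (b * A * q) = 0"
      using zero mult_SL Q_carrier[OF q] pt_mult[OF _ q] b by blast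
  qed
qed

lemma cell_in_schubert:
  assumes w: "w permutes {1..n}" and A: "A \<in> weyl_coset n w" and b: "b \<in> borel n"
  shows "pt (b * A) \<in> schubert_variety n Q w"
proof (rule in_schubertI[OF w A])
  show "b * A \<in> carrier (SL n)" using mult_SL[of b A] b A by (simp add: borel_def weyl_coset_def)
  fix f assume "\<And>b q. b \<in> borel n \<Longrightarrow> q \<in> Q \<Longrightarrow> f (b * A * q) = 0"
  from this[OF b, of "1\<^sub>m n"] show "f (b * A) = 0"
    using subgroup.one_closed[OF subgroup] b A by (auto simp: borel_def weyl_coset_def)
qed

end

context flag_variety begin

text \<open>
  Being a closed condition, the vanishing of a minor has to be checked on the cell only.  There the entry in row \<open>i\<close> and
  column \<open>j\<close> of \<open>b A\<close>, with \<open>b\<close> upper triangular, is nonzero only for \<open>i \<le> x j\<close>.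
\<close>
lemma schubert_minor:
  assumes w: "w permutes {1..n}" and h: "h \<in> carrier (SL n)" "pt h \<in> schubert_variety n Q w"
    and k: "k \<in> \<Delta>" and r: "\<And>i. i < k \<Longrightarrow> r i < n" and nz: "minor k r h \<noteq> 0"
  shows "\<exists>\<pi>. \<pi> permutes {..<k} \<and> (\<forall>i<k. r i \<le> row_perm w (\<pi> i))"
proof (rule ccontr)
  assume not: "\<not> ?thesis"
  have kn: "k \<le> n" using k levels by auto
  obtain A where A: "A \<in> weyl_coset n w" using weyl_coset_nonempty[OF w n_pos] .
  have "minor k r h = 0"
  proof (rule schubert_vanish[OF w A h, where F = "minor k r"])
    show "poly_fun n (minor k r)" using poly_fun_minor[of k n r, OF kn r] .
    fix b q assume b: "b \<in> borel n" and q: "q \<in> Q"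
    have bm: "b \<in> carrier_mat n n" "b * A \<in> carrier_mat n n"
      using b A by (auto simp: borel_def weyl_coset_def)
    have "minor k r (b * A) = 0"
    proof (rule ccontr)
      assume "minor k r (b * A) \<noteq> 0"
      then obtain \<pi> where \<pi>: "\<pi> permutes {..<k}" "\<And>i. i < k \<Longrightarrow> (b * A) $$ (r i, \<pi> i) \<noteq> 0"
        using minor_transversal by blast
      have "r i \<le> row_perm w (\<pi> i)" if i: "i < k" for i
      proof (rule ccontr)
        assume "\<not> ?thesis"
        moreover have "\<pi> i < n" using permutes_in_image[OF \<pi>(1), of i] i kn by simp
        ultimately show False
          using \<pi>(2)[OF i] mult_weyl_index[OF w A bm(1) r[OF i], of "\<pi> i"] b r[OF i] by (simp add: borel_def)
      qed
      then show False using not \<pi>(1) by blast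
    qed
    then show "minor k r (b * A * q) = 0" using minor_mult[OF bm(2) q k kn, of r, OF r] by simp
  qed
  then show False using nz by simp
qed

text \<open>
  The minor in which \<open>x j\<close> is exchanged for \<open>x i\<close> is nonzero, so its rows are bounded by those of \<open>x\<close>; comparing the
  sums of the rows gives the claim.
\<close>
lemma cell_shape_schubert:
  assumes w: "w permutes {1..n}" and h: "h \<in> carrier (SL n)" "pt h \<in> schubert_variety n Q w"
    and shape: "cell_shape n \<Delta> (row_perm w) h"
    and ij: "i < n" "j < n" "i \<noteq> j" "h $$ (row_perm w i, j) \<noteq> 0"
  shows "row_perm w i < row_perm w j"
proof -
  let ?x = "row_perm w"
  have x: "?x permutes {..<n}" by (rule row_perm_permutes[OF w])
  have xlt: "?x i < n" if "i < n" for i using permutes_in_image[OF x, of i] that by simp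
  have "h $$ (?x a, a) \<noteq> 0" if "a < n" for a
    using cell_shape_diagonal_nonzero[OF shape x _ _ that] h(1) by simp
  then obtain k where k: "k \<in> \<Delta>" "j < k" and nz: "minor k (?x(j := ?x i)) h \<noteq> 0"
    using cell_shape_minor_nonzero[OF shape _ ij] by blast
  have kn: "k \<le> n" using k levels by auto
  let ?r = "?x(j := ?x i)"
  have rows: "?r a < n" if "a < k" for a using that ij xlt kn by auto
obtain \<pi> where \<pi>: "\<pi> permutes {..<k}" "\<forall>a<k. ?r a \<le> ?x (\<pi> a)"
    using schubert_minor[OF w h k(1), of ?r, OF rows nz] by blast
  have "(\<Sum>a<k. ?r a) \<le> (\<Sum>a<k. ?x (\<pi> a))" using \<pi>(2) by (intro sum_mono) auto
  also have "\<dots> = (\<Sum>a<k. ?x a)" using sum.permute[OF \<pi>(1), of ?x] by (simp add: comp_def)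
  finally have "(\<Sum>a<k. ?r a) \<le> (\<Sum>a<k. ?x a)" .
  moreover have "(\<Sum>a<k. ?r a) = ?x i + (\<Sum>a\<in>{..<k} - {j}. ?x a)"
    using k(2) by (subst sum.remove[of _ j]) (auto intro!: sum.cong)
  moreover have "(\<Sum>a<k. ?x a) = ?x j + (\<Sum>a\<in>{..<k} - {j}. ?x a)"
    using k(2) by (subst sum.remove[of _ j]) auto
  ultimately have "?x i \<le> ?x j" by simp
  moreover have "?x i \<noteq> ?x j" using permutes_inj[OF x] ij(3) by (auto simp: inj_eq)
  ultimately show ?thesis by simp
qed

end

subsection \<open>Lifting the dense orbit to the full flag variety\<close>

text \<open>
  Clearing denominators when rational functions with a common denominator \<open>\<delta>\<close> are substituted into a
  polynomial.
\<close>
lemma poly_fun_rational_subst: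
  assumes f: "f \<in> poly_funs (mat_coords n)" and \<delta>: "poly_fun n \<delta>"
    and \<rho>: "\<And>i j. i < n \<Longrightarrow> j < n \<Longrightarrow> poly_fun n (\<rho> i j)"
    and R: "\<And>g i j. g \<in> carrier_mat n n \<Longrightarrow> \<delta> g \<noteq> 0 \<Longrightarrow> i < n \<Longrightarrow> j < n \<Longrightarrow> \<rho> i j g = \<delta> g * R g $$ (i, j)"
  shows "\<exists>N G. poly_fun n G \<and> (\<forall>g\<in>carrier_mat n n. \<delta> g \<noteq> 0 \<longrightarrow> G g = \<delta> g ^ N * f (R g))"
  using f
proof induction
  case (coord p)
  then obtain i j where p: "p = (\<lambda>A. A $$ (i, j))" "i < n" "j < n" by (auto simp: mat_coords_def)
  show ?case by (rule exI[of _ 1], rule exI[of _ "\<rho> i j"]) (use p \<rho> R in auto)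
next
  case (const c)
  show ?case by (rule exI[of _ 0], rule exI[of _ "\<lambda>_. c"]) (simp add: poly_fun_const)
next
  case (add p q)
  then obtain N1 G1 N2 G2 where G: "poly_fun n G1" "poly_fun n G2"
    "\<forall>g\<in>carrier_mat n n. \<delta> g \<noteq> 0 \<longrightarrow> G1 g = \<delta> g ^ N1 * p (R g)"
    "\<forall>g\<in>carrier_mat n n. \<delta> g \<noteq> 0 \<longrightarrow> G2 g = \<delta> g ^ N2 * q (R g)" by blast
  show ?case
  proof (intro exI conjI ballI impI)
    show "poly_fun n (\<lambda>g. G1 g * \<delta> g ^ N2 + G2 g * \<delta> g ^ N1)"
      by (intro poly_fun_add poly_fun_mult poly_fun_power G \<delta>)
    fix g assume "g \<in> carrier_mat n n" "\<delta> g \<noteq> 0"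
    then show "G1 g * \<delta> g ^ N2 + G2 g * \<delta> g ^ N1 = \<delta> g ^ (N1 + N2) * (p (R g) + q (R g))"
      using G by (simp add: power_add algebra_simps)
  qed
next
  case (mult p q)
  then obtain N1 G1 N2 G2 where G: "poly_fun n G1" "poly_fun n G2"
    "\<forall>g\<in>carrier_mat n n. \<delta> g \<noteq> 0 \<longrightarrow> G1 g = \<delta> g ^ N1 * p (R g)"
    "\<forall>g\<in>carrier_mat n n. \<delta> g \<noteq> 0 \<longrightarrow> G2 g = \<delta> g ^ N2 * q (R g)" by blast
  show ?case
  proof (intro exI conjI ballI impI)
    show "poly_fun n (\<lambda>g. G1 g * G2 g)" by (intro poly_fun_mult G)
    fix g assume "g \<in> carrier_mat n n" "\<delta> g \<noteq> 0"
    then show "G1 g * G2 g = \<delta> g ^ (N1 + N2) * (p (R g) * q (R g))"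
      using G by (simp add: power_add algebra_simps)
  qed
qed

text \<open>
  The matrix of the cell of \<open>x\<close> with diagonal \<open>c\<close> in the same coset as \<open>g\<close> of the maximal parabolic
  subgroup, in terms of Plucker coordinates.
\<close>
definition cell_section :: "nat \<Rightarrow> nat \<Rightarrow> (nat \<Rightarrow> nat) \<Rightarrow> (nat \<Rightarrow> complex) \<Rightarrow> complex mat \<Rightarrow> complex mat" where
  "cell_section n d x c g = mat n n (\<lambda>(a, j). let i = inv_into UNIV x a in
     if i = j then c j else if j < d \<and> d \<le> i then c j * (minor d (x(j := x i)) g / minor d x g) else 0)"

lemma cell_section_index:
  assumes "x permutes {..<n}" "i < n" "j < n"
  shows "cell_section n d x c g $$ (x i, j) = (if i = j then c j
    else if j < d \<and> d \<le> i then c j * (minor d (x(j := x i)) g / minor d x g) else 0)"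
  using permutes_in_image[OF assms(1), of i] assms permutes_inverses(2)[OF assms(1)]
  by (simp add: cell_section_def)

lemma cell_section_eq:
  assumes x: "x permutes {..<n}" and h: "h \<in> carrier_mat n n" "cell_shape n {d} x h" "det h \<noteq> 0"
    and d: "d \<le> n" and c: "\<And>j. j < n \<Longrightarrow> h $$ (x j, j) = c j"
  shows "cell_section n d x c h = h"
proof (rule eq_matI)
  fix a j assume "a < dim_row h" "j < dim_col h"
  then have aj: "a < n" "j < n" using h(1) by auto
  obtain i where i: "i < n" "a = x i" using permutes_image[OF x] aj(1) by (metis imageE lessThan_iff)
  have nz: "h $$ (x b, b) \<noteq> 0" if "b < n" for b
    using cell_shape_diagonal_nonzero[OF h(2) x h(1,3) that] .
  show "cell_section n d x c h $$ (a, j) = h $$ (a, j)"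
  proof (cases "i = j \<or> \<not> (j < d \<and> d \<le> i)")
    case True
    then show ?thesis
      using cell_section_index[OF x i(1) aj(2), of d c h] c aj(2) i cell_shapeD[OF h(2) i(1) aj(2)] by auto
  next
    case False
    then have d': "j < d" "d \<le> i" "i \<noteq> j" by auto
    have "minor d x h = h $$ (x j, j) * (\<Prod>b\<in>{..<d} - {j}. h $$ (x b, b))"
      using minor_cell_shape[OF h(2) d] d'(1) by (simp add: prod.remove[of _ j])
    moreover have "minor d (x(j := x i)) h = h $$ (x i, j) * (\<Prod>b\<in>{..<d} - {j}. h $$ (x b, b))"
      by (rule minor_exchange[OF h(2) i(1) d'(1,2)]) auto
    moreover have "(\<Prod>b\<in>{..<d} - {j}. h $$ (x b, b)) \<noteq> 0" using nz d by auto
    ultimately have "minor d (x(j := x i)) h / minor d x h = h $$ (x i, j) / h $$ (x j, j)" by simp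
    then show ?thesis
      using cell_section_index[OF x i(1) aj(2), of d c h] d' i(2) c[OF aj(2)] nz[OF aj(2)] by simp
  qed
qed (use h(1) in \<open>auto simp: cell_section_def\<close>)

lemma cell_section_mult:
  assumes x: "x permutes {..<n}" and g: "g \<in> carrier_mat n n" and p: "p \<in> flag_stab n {d}" and d: "d \<le> n"
  shows "cell_section n d x c (g * p) = cell_section n d x c g"
proof (rule eq_matI)
  fix a j assume "a < dim_row (cell_section n d x c g)" "j < dim_col (cell_section n d x c g)"
  then have aj: "a < n" "j < n" by (auto simp: cell_section_def)
  obtain i where i: "i < n" "a = x i" using permutes_image[OF x] aj(1) by (metis imageE lessThan_iff)
  have xlt: "x i < n" if "i < n" for i using permutes_in_image[OF x, of i] that by simp
  have "minor d r (g * p) = minor d r g * minor d id p" if "\<And>b. b < d \<Longrightarrow> r b < n" for r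
    using minor_mult[OF g p _ d that] by simp
  then have "minor d (x(j := x i)) (g * p) / minor d x (g * p) = minor d (x(j := x i)) g / minor d x g"
    using minor_flag_stab_nonzero[OF p _ d] xlt d i(1) by auto
  then show "cell_section n d x c (g * p) $$ (a, j) = cell_section n d x c g $$ (a, j)"
    unfolding i(2) cell_section_index[OF x i(1) aj(2)] by simp
qed (simp_all add: cell_section_def)


text \<open>
  The projection from the full flag variety restricts to an isomorphism of the cells of a minimal coset
  representative: the full flag is recovered by the section of the cell, which is rational in the minors of
  level \<open>d\<close>.  So a polynomial that vanishes on the lifted orbit pulls back to a function that vanishes on the given
  dense orbit, hence on the whole cell; the lifted orbit is dense.  The section is equivariant, which makes the
  stabilizers agree.
\<close>
lemma dense_orbit_lift:
  fixes n d w
  defines "P \<equiv> flag_stab n {d}" and "B \<equiv> flag_stab n {1..<n}"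
  assumes d: "1 \<le> d" "d \<le> n - 1" and w: "w \<in> min_coset_reps n d"
    and nonempty: "dense_orbit n P (schubert_variety n P w) \<noteq> {}"
  obtains h where "h \<in> carrier (SL n)"
    "h <#\<^bsub>SL n\<^esub> P \<in> dense_orbit n P (schubert_variety n P w)"
    "h <#\<^bsub>SL n\<^esub> B \<in> dense_orbit n B (schubert_variety n B w)"
    "char_lattice n P (schubert_variety n P w) = char_lattice n B (schubert_variety n B w)"
proof -
  have n: "0 < n" "d \<le> n" "d < n" using d by auto
  interpret P: flag_variety n "{d}" using n by unfold_locales auto
  interpret B: flag_variety n "{1..<n}" using n by unfold_locales auto
  interpret SL: group "SL n" by (rule group_SL)
  have PB: "P = P.Q" "B = B.Q" by (simp_all add: P_def B_def)
  have BP: "B.Q \<subseteq> P.Q"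
  proof -
    have "d \<in> {1..<n}" using d n by simp
    then show ?thesis unfolding flag_stab_def by blast
  qed
  let ?XP = "schubert_variety n P.Q w" and ?XB = "schubert_variety n B.Q w"
  have wp: "w permutes {1..n}" by (rule min_coset_reps_permutes[OF w])
  define x where "x = row_perm w"
  have x: "x permutes {..<n}" unfolding x_def by (rule row_perm_permutes[OF wp])
  have xlt: "x i < n" if "i < n" for i using permutes_in_image[OF x, of i] that by simp
  obtain A where A: "A \<in> weyl_coset n w" using weyl_coset_nonempty[OF wp n(1)] .
  have AS: "A \<in> carrier (SL n)" using A by (simp add: weyl_coset_def)
  have oneB: "1\<^sub>m n \<in> borel n" by (auto simp: borel_def)
  have APX: "P.pt A \<in> ?XP" 
    using P.cell_in_schubert[OF wp A oneB] left_mult_one_mat[OF SL_carrier_mat[OF AS]] by simp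
  have Bmult: "a * b \<in> B.Q" if "a \<in> B.Q" "b \<in> B.Q" for a b
    using subgroup.m_closed[OF B.subgroup that] by simp
  define \<delta> where "\<delta> = minor d x"
  have \<delta>_poly: "poly_fun n \<delta>" unfolding \<delta>_def using n xlt by (intro poly_fun_minor) auto
  have \<delta>_mult: "\<delta> (g * q) = \<delta> g * minor d id q" "minor d id q \<noteq> 0"
    if "g \<in> carrier_mat n n" "q \<in> P.Q" for g q
    unfolding \<delta>_def using minor_mult[OF that, of d x] minor_flag_stab_nonzero[OF that(2), of d] n xlt by auto
  obtain g where g: "g \<in> carrier (SL n)" "P.pt g \<in> P.dense ?XP"
  proof -
    obtain y where y: "y \<in> P.dense ?XP" using nonempty unfolding PB by blast
    then have "y \<in> P.points" using P.dense_imp_points[OF y] P.dense_subset by blast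
    then show ?thesis using that y by (blast elim: P.pointsE)
  qed
  have "\<delta> g \<noteq> 0"
  proof
    assume zero: "\<delta> g = 0"
    have "\<delta> A = 0"
    proof (rule P.dense_vanish[OF g AS APX \<delta>_poly])
      fix t q assume t: "t \<in> torus n" and q: "q \<in> P.Q"
      have tg: "t * g \<in> carrier_mat n n" using P.mult_SL[OF P.torus_carrier[OF t] g(1)] by simp
      have "\<delta> (t * g) = 0"
        using zero minor_torus_mult[OF t _ n(2), of g x] g(1) n xlt unfolding \<delta>_def by simp
      then show "\<delta> (t * g * q) = 0" using \<delta>_mult(1)[OF tg q] by simp
    qed
    then show False using minor_weyl_nonzero[OF wp A n(2)] by (simp add: \<delta>_def x_def)
  qed
  then obtain p0 where p0: "p0 \<in> P.Q" "cell_shape n {d} x (g * p0)"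
    using cell_shape_exists[OF P.levels n(1) g(1) x] by (auto simp: \<delta>_def)
  define h where "h = g * p0"
  have h: "h \<in> carrier (SL n)" "P.pt h \<in> P.dense ?XP" "cell_shape n {d} x h"
    using P.mult_SL[OF g(1) P.Q_carrier[OF p0(1)]] P.pt_mult[OF g(1) p0(1)] p0(2) g(2)
    by (simp_all only: h_def)
  have hm: "h \<in> carrier_mat n n" "det h = 1" using h(1) by simp_all
  have hX: "P.pt h \<in> ?XP" using h(2) P.dense_subset by blast
  define c where "c j = h $$ (x j, j)" for j
  have c: "c j \<noteq> 0" if "j < n" for j
    unfolding c_def using cell_shape_diagonal_nonzero[OF h(3) x hm(1) _ that] hm(2) by simp
  have "x i \<le> x j" if "i < n" "j < n" "h $$ (x i, j) \<noteq> 0" for i j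
    using P.cell_shape_schubert[OF wp h(1) hX h(3)[unfolded x_def] that(1,2)] that(3)
    unfolding x_def by fastforce
  then obtain b0 where b0: "b0 \<in> borel n" "h = b0 * A"
    using upper_shape_borel[OF wp A h(1)] unfolding x_def by blast
  let ?R = "cell_section n d x c"
  have Rh: "?R h = h" by (rule cell_section_eq[OF x hm(1) h(3) _ n(2)]) (use hm in \<open>auto simp: c_def\<close>)
  define D where "D t = diag n (\<lambda>j. inverse (t $$ (x j, x j)))" for t
  have D: "D t \<in> torus n" if "t \<in> torus n" for t unfolding D_def by (rule torus_conjugate[OF x that])
  have R_orbit: "?R (t * h * p) = t * h * D t" if t: "t \<in> torus n" and p: "p \<in> P.Q" for t p
  proof -
    have th: "t * h \<in> carrier (SL n)" using P.mult_SL[OF P.torus_carrier[OF t] h(1)] .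
    have thD: "t * h * D t \<in> carrier (SL n)" using P.mult_SL[OF th P.torus_carrier[OF D[OF t]]] .
    have entry: "(t * h * D t) $$ (x i, j) = t $$ (x i, x i) * h $$ (x i, j) * inverse (t $$ (x j, x j))"
      if "i < n" "j < n" for i j
      unfolding D_def
      using mult_diag_index[of "t * h" n "x i" j] torus_mult_index[OF t hm(1), of "x i" j] th xlt that by simp
    have "?R (t * h * D t) = t * h * D t"
    proof (rule cell_section_eq[OF x _ _ _ n(2)])
      show "cell_shape n {d} x (t * h * D t)"
        using h(3) entry unfolding cell_shape_def by auto
      show "(t * h * D t) $$ (x j, j) = c j" if "j < n" for j
        using entry[OF that that] torus_nonzero[OF t xlt[OF that]] by (simp add: c_def)
    qed (use thD in auto)
    moreover have "?R (t * h * q) = ?R (t * h)" if "q \<in> P.Q" for q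
      using cell_section_mult[OF x _ that n(2)] th by simp
    moreover have "D t \<in> P.Q" using D[OF t] P.torus_le by blast
    ultimately show ?thesis using p by metis
  qed
  \<comment> \<open>density of the lifted orbit among the matrices in the image of the section\<close>
  have key0: "F h' = 0"
    if F: "F \<in> poly_funs (mat_coords n)"
      and zero: "\<And>t q. t \<in> torus n \<Longrightarrow> q \<in> B.Q \<Longrightarrow> F (t * h * q) = 0"
      and h': "h' \<in> carrier (SL n)" "P.pt h' \<in> ?XP" "cell_shape n {d} x h'" "\<And>j. j < n \<Longrightarrow> h' $$ (x j, j) = c j"
    for F h'
  proof -
    define \<rho> where "\<rho> a j = (let i = inv_into UNIV x a in if i = j then (\<lambda>g. c j * \<delta> g)
      else if j < d \<and> d \<le> i then (\<lambda>g. c j * minor d (x(j := x i)) g) else (\<lambda>_. 0))" for a j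
    obtain N G where G: "poly_fun n G" "\<forall>g\<in>carrier_mat n n. \<delta> g \<noteq> 0 \<longrightarrow> G g = \<delta> g ^ N * F (?R g)"
    proof -
      have "\<exists>N G. poly_fun n G \<and> (\<forall>g\<in>carrier_mat n n. \<delta> g \<noteq> 0 \<longrightarrow> G g = \<delta> g ^ N * F (?R g))"
      proof (rule poly_fun_rational_subst[OF F \<delta>_poly, of \<rho> ?R])
        fix a j assume aj: "a < n" "j < n"
        then obtain i where i: "i < n" "a = x i" using permutes_image[OF x] by (metis imageE lessThan_iff)
        have x_inv: "inv_into UNIV x a = i" using i permutes_inverses(2)[OF x] by simp
        show "poly_fun n (\<rho> a j)"
        proof -
          have "poly_fun n (\<lambda>g. c j * \<delta> g)" by (rule poly_fun_mult[OF poly_fun_const \<delta>_poly])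
          moreover have "poly_fun n (minor d (x(j := x i)))"
            by (rule poly_fun_minor[OF n(2)]) (use i(1) xlt n in auto)
          then have "poly_fun n (\<lambda>g. c j * minor d (x(j := x i)) g)" by (rule poly_fun_mult[OF poly_fun_const])
          ultimately show ?thesis unfolding \<rho>_def x_inv Let_def by (simp add: poly_fun_const)
        qed
        fix g :: "complex mat" assume "g \<in> carrier_mat n n" "\<delta> g \<noteq> 0"
        then show "\<rho> a j g = \<delta> g * ?R g $$ (a, j)"
          unfolding i(2) cell_section_index[OF x i(1) aj(2)] using x_inv i(2)
          by (simp add: \<rho>_def Let_def) (simp add: \<delta>_def)
      qed
      then show ?thesis using that by blast
    qed
    have "\<delta> h' * G h' = 0"
    proof (rule P.dense_vanish[OF h(1,2) h'(1,2), where F = "\<lambda>g. \<delta> g * G g"])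
      show "poly_fun n (\<lambda>g. \<delta> g * G g)" by (intro poly_fun_mult \<delta>_poly G(1))
      fix t p assume t: "t \<in> torus n" and p: "p \<in> P.Q"
      have thp: "t * h * p \<in> carrier_mat n n"
        using P.mult_SL[OF P.mult_SL[OF P.torus_carrier[OF t] h(1)] P.Q_carrier[OF p]] by simp
      have "F (t * h * D t) = 0" using zero[OF t] D[OF t] B.torus_le by blast
      then show "\<delta> (t * h * p) * G (t * h * p) = 0"
        using G(2) thp R_orbit[OF t p] by (cases "\<delta> (t * h * p) = 0") auto
    qed
    moreover have "\<delta> h' \<noteq> 0"
    proof -
      have "\<delta> h' = (\<Prod>a<d. c a)" unfolding \<delta>_def minor_cell_shape[OF h'(3) n(2)] using h'(4) n by simp
      then show ?thesis using c n by simp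
    qed
    moreover have "?R h' = h'"
      by (rule cell_section_eq[OF x _ h'(3) _ n(2)]) (use h' in auto)
    ultimately show "F h' = 0" using G(2) h'(1) by auto
  qed
  \<comment> \<open>a general element of the cell is brought into the image of the section by right multiplication\<close>
  have key: "f (b * A * q) = 0"
    if f: "f \<in> poly_funs (mat_coords n)"
      and zero: "\<And>t q. t \<in> torus n \<Longrightarrow> q \<in> B.Q \<Longrightarrow> f (t * h * q) = 0"
      and b: "b \<in> borel n" and q: "q \<in> B.Q" for f b q
  proof -
    have bA: "b * A \<in> carrier (SL n)" using P.mult_SL[of b A] b AS by (simp add: borel_def)
    have bm: "b \<in> carrier_mat n n" using b by (simp add: borel_def)
    have bX: "B.pt (b * A) \<in> ?XB" by (rule B.cell_in_schubert[OF wp A b])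
    have "minor k x (b * A) \<noteq> 0" if k: "k \<in> {1..<n}" for k
    proof -
      have "minor k x (b * A) = (\<Prod>i<k. (b * A) $$ (x i, i))"
      proof (rule minor_unique_transversal)
        fix \<pi> assume \<pi>: "\<pi> permutes {..<k}" and nz: "\<And>i. i < k \<Longrightarrow> (b * A) $$ (x i, \<pi> i) \<noteq> 0"
        show "\<pi> = id"
        proof (rule permutes_le_imp_id[OF _ \<pi>, of "\<lambda>a. n - x a"])
          fix a assume a: "a \<in> {..<k}"
          have \<pi>a: "\<pi> a < n" using permutes_in_image[OF \<pi>, of a] a k by simp
          then have "b $$ (x a, x (\<pi> a)) \<noteq> 0"
            using nz[of a] a mult_weyl_index[OF wp A bm, of "x a" "\<pi> a"] xlt k by (auto simp: x_def)
          then have "x a \<le> x (\<pi> a)" using b xlt[of a] a k by (force simp: borel_def not_less)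
          then show "n - x (\<pi> a) \<le> n - x a" by simp
        next
          show "inj_on (\<lambda>a. n - x a) {..<k}"
          proof (rule inj_onI)
            fix a a' assume aa: "a \<in> {..<k}" "a' \<in> {..<k}" "n - x a = n - x a'"
            then have "x a < n" "x a' < n" using xlt k by auto
            then have "x a = x a'" using aa(3) by linarith
            then show "a = a'" using permutes_inj[OF x] by (auto simp: inj_eq)
          qed
        qed simp
      qed
      also have "\<dots> \<noteq> 0"
      proof -
        have "(b * A) $$ (x i, i) \<noteq> 0" if "i < k" for i
        proof -
          have i: "i < n" using that k by simp
          have "A $$ (x i, i) \<noteq> 0"
            using A i xlt[OF i] unfolding weyl_coset_row_perm[OF wp] x_def by blast
          then show ?thesis
            using mult_weyl_index[OF wp A bm xlt[OF i] i] borel_diagonal_nonzero[OF b xlt[OF i]] by (simp add: x_def)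
        qed
        then show ?thesis by simp
      qed
      finally show ?thesis .
    qed
    then obtain q1 where q1: "q1 \<in> B.Q" "cell_shape n {1..<n} x (b * A * q1)"
      using cell_shape_exists[OF B.levels n(1) bA x] by blast
    define h1 where "h1 = b * A * q1"
    have h1: "h1 \<in> carrier (SL n)" "B.pt h1 \<in> ?XB" "cell_shape n {1..<n} x h1"
      using B.mult_SL[OF bA B.Q_carrier[OF q1(1)]] B.pt_mult[OF bA q1(1)] q1(2) bX by (simp_all only: h1_def)
    have h1m: "h1 \<in> carrier_mat n n" "det h1 = 1" using h1(1) by simp_all
    have shape1: "cell_shape n {d} x h1"
      unfolding cell_shape_def
    proof (intro allI impI)
      fix i j assume ij: "i < n" "j < n" "h1 $$ (x i, j) \<noteq> 0"
      show "i = j \<or> (\<exists>k\<in>{d}. j < k \<and> k \<le> i)"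
      proof (cases "i = j")
        case False
        have "j < i" using cell_shapeD[OF h1(3) ij(1,2,3) False] by auto
        moreover have "x i < x j"
          using B.cell_shape_schubert[OF wp h1(1,2) h1(3)[unfolded x_def] ij(1,2) False] ij(3) by (simp add: x_def)
        ultimately have "j < d \<and> d \<le> i" using min_coset_reps_descent[OF w _ ij(1)] by (simp add: x_def)
        then show ?thesis by simp
      qed simp
    qed
    define c1 where "c1 j = h1 $$ (x j, j)" for j
    have c1: "c1 j \<noteq> 0" if "j < n" for j
      unfolding c1_def using cell_shape_diagonal_nonzero[OF shape1 x h1m(1) _ that] h1m(2) by simp
    have prods: "(\<Prod>j<n. c1 j) = (\<Prod>j<n. c j)"
      using minor_cell_shape[OF shape1, of n] minor_cell_shape[OF h(3), of n]
        minor_permutes[OF x h1m(1)] minor_permutes[OF x hm(1)] h1m(2) hm(2) by (simp add: c_def c1_def)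
    define E where "E = diag n (\<lambda>j. c j / c1 j)"
    have E: "E \<in> torus n" unfolding E_def using prods c by (intro diag_in_torus) (simp add: prod_dividef)
    define q2 where "q2 = q1 * E"
    have q2: "q2 \<in> B.Q" unfolding q2_def using Bmult q1(1) E B.torus_le by blast
    define h2 where "h2 = h1 * E"
    have h2_eq: "h2 = b * A * q2"
      unfolding h2_def h1_def q2_def
      using B.assoc_SL[OF bA B.Q_carrier[OF q1(1)] B.torus_carrier[OF E]] .
    have h2: "h2 \<in> carrier (SL n)" unfolding h2_def using B.mult_SL[OF h1(1) B.torus_carrier[OF E]] .
    have entry: "h2 $$ (x i, j) = h1 $$ (x i, j) * (c j / c1 j)" if "i < n" "j < n" for i j
      unfolding h2_def E_def using mult_diag_index[OF h1m(1) xlt[OF that(1)] that(2)] .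
    have shape2: "cell_shape n {d} x h2" using shape1 entry unfolding cell_shape_def by auto
    have diag2: "h2 $$ (x j, j) = c j" if "j < n" for j
      using entry[OF that that] c1[OF that] by (simp add: c1_def)
    have "q2 \<in> P.Q" using q2 BP by blast
    then have "P.pt h2 = P.pt (b * A)" unfolding h2_eq by (rule P.pt_mult[OF bA])
    then have h2X: "P.pt h2 \<in> ?XP" using P.cell_in_schubert[OF wp A b] by simp
    define s where "s = inv\<^bsub>SL n\<^esub> q2 * q"
    have q2i: "inv\<^bsub>SL n\<^esub> q2 \<in> B.Q" by (rule subgroup.m_inv_closed[OF B.subgroup q2])
    have s: "s \<in> B.Q" unfolding s_def using Bmult[OF q2i q] .
    have "q2 * s = (q2 * inv\<^bsub>SL n\<^esub> q2) * q"
      unfolding s_def using B.assoc_SL[OF B.Q_carrier[OF q2] B.Q_carrier[OF q2i] B.Q_carrier[OF q]] by simp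
    also have "q2 * inv\<^bsub>SL n\<^esub> q2 = 1\<^sub>m n" using SL.r_inv[OF B.Q_carrier[OF q2]] by simp
    finally have "q2 * s = q" using left_mult_one_mat[OF SL_carrier_mat[OF B.Q_carrier[OF q]]] by simp
    then have hs: "h2 * s = b * A * q"
      unfolding h2_eq using B.assoc_SL[OF bA B.Q_carrier[OF q2] B.Q_carrier[OF s]] by simp
    have sm: "s \<in> carrier_mat n n" using B.Q_carrier[OF s] by simp
    obtain F where F: "F \<in> poly_funs (mat_coords n)" "\<forall>g\<in>carrier_mat n n. f (g * s) = F g"
      using poly_fun_right_mult[OF f sm] unfolding poly_fun_def by blast
    have "F h2 = 0"
    proof (rule key0[OF F(1) _ h2 h2X shape2 diag2])
      fix t u assume t: "t \<in> torus n" and u: "u \<in> B.Q"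
      have th: "t * h \<in> carrier (SL n)" using P.mult_SL[OF P.torus_carrier[OF t] h(1)] .
      have "F (t * h * u) = f (t * h * u * s)" using F(2) B.mult_SL[OF th B.Q_carrier[OF u]] by simp
      also have "t * h * u * s = t * h * (u * s)" using B.assoc_SL[OF th B.Q_carrier[OF u] B.Q_carrier[OF s]] .
      finally show "F (t * h * u) = 0" using zero[OF t Bmult[OF u s]] by simp
    qed
    then show "f (b * A * q) = 0" using F(2) h2 hs by auto
  qed
  have hXB: "B.pt h \<in> ?XB" unfolding b0(2) by (rule B.cell_in_schubert[OF wp A b0(1)])
  let ?O = "(\<lambda>t. t <#\<^bsub>SL n\<^esub> B.pt h) ` torus n"
  have "homog_topology n B.Q closure_of ?O = ?XB"
  proof
    have "?O \<subseteq> (\<lambda>b. B.pt (b * A)) ` borel n"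
    proof
      fix y assume "y \<in> ?O"
      then obtain t where t: "t \<in> torus n" "y = B.pt (t * h)" using B.torus_pt h(1) by auto
      have tB: "t \<in> B.Q" using t(1) B.torus_le by blast
      have b0B: "b0 \<in> B.Q" using b0(1) borel_eq by simp
      have "t * b0 \<in> borel n" using Bmult[OF tB b0B] borel_eq by simp
      moreover have "t * h = t * b0 * A"
        unfolding b0(2) using B.assoc_SL[OF B.Q_carrier[OF tB] B.Q_carrier[OF b0B] AS] by simp
      ultimately show "y \<in> (\<lambda>b. B.pt (b * A)) ` borel n" using t(2) by auto
    qed
    then show "homog_topology n B.Q closure_of ?O \<subseteq> ?XB"
      unfolding B.schubert_variety_eq[OF wp A] by (rule closure_of_mono)
    show "?XB \<subseteq> homog_topology n B.Q closure_of ?O"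
    proof
      fix y assume y: "y \<in> ?XB"
      have "?XB \<subseteq> B.points" unfolding B.schubert_variety_eq[OF wp A] by (rule B.closure_subset_points)
      then obtain z where z: "z \<in> carrier (SL n)" "y = B.pt z" using y by (blast elim: B.pointsE)
      show "y \<in> homog_topology n B.Q closure_of ?O"
        unfolding z(2) B.homog_closure_iff[OF z(1)]
      proof (intro ballI impI)
        fix f assume f: "f \<in> poly_funs (mat_coords n)"
          and zero: "\<forall>s\<in>carrier (SL n). B.pt s \<in> ?O \<longrightarrow> f s = 0"
        have "f (t * h * q) = 0" if t: "t \<in> torus n" and q: "q \<in> B.Q" for t q
        proof -
          have th: "t * h \<in> carrier (SL n)" using P.mult_SL[OF P.torus_carrier[OF t] h(1)] .
          have "B.pt (t * h * q) = t <#\<^bsub>SL n\<^esub> B.pt h" using B.pt_mult[OF th q] B.torus_pt[OF t h(1)] by simp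
          then show ?thesis using zero B.mult_SL[OF th B.Q_carrier[OF q]] t by blast
        qed
        then have cell: "f (b * A * q) = 0" if "b \<in> borel n" "q \<in> B.Q" for b q
          using key[OF f _ that] by blast
        show "f z = 0"
          by (rule B.schubert_vanish[OF wp A z(1) _ poly_funI[OF f] cell]) (use y z(2) in simp_all)
      qed
    qed
  qed
  then have hB: "B.pt h \<in> B.dense ?XB" using hXB by (simp add: dense_orbit_def)
  have "(\<forall>y\<in>P.dense ?XP. t <#\<^bsub>SL n\<^esub> y = y) \<longleftrightarrow> (\<forall>y\<in>B.dense ?XB. t <#\<^bsub>SL n\<^esub> y = y)"
    if t: "t \<in> torus n" for t
  proof -
    have th: "t * h \<in> carrier (SL n)" using P.mult_SL[OF P.torus_carrier[OF t] h(1)] .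
    have "(\<forall>y\<in>P.dense ?XP. t <#\<^bsub>SL n\<^esub> y = y) \<longleftrightarrow> P.pt (t * h) = P.pt h"
      using P.stabilizer_dense[OF h(1,2) t] P.torus_pt[OF t h(1)] h(2) P.dense_subset by (metis subsetD)
    also have "\<dots> \<longleftrightarrow> B.pt (t * h) = B.pt h"
    proof
      assume "P.pt (t * h) = P.pt h"
      then obtain p where p: "p \<in> P.Q" "t * h = h * p" using P.pt_eq_iff[OF th h(1)] by blast
      have oneP: "1\<^sub>m n \<in> P.Q" using subgroup.one_closed[OF P.subgroup] by simp
      have "t * h * D t = ?R (t * h)"
        using R_orbit[OF t oneP] right_mult_one_mat[OF SL_carrier_mat[OF th]] by simp
      also have "\<dots> = ?R h" unfolding p(2) by (rule cell_section_mult[OF x hm(1) p(1) n(2)])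
      finally have "t * h * D t = h" using Rh by simp
      moreover have "D t \<in> B.Q" using D[OF t] B.torus_le by blast
      ultimately show "B.pt (t * h) = B.pt h" using B.pt_mult[OF th] by metis
    next
      assume "B.pt (t * h) = B.pt h"
      then show "P.pt (t * h) = P.pt h"
        using B.pt_eq_iff[OF th h(1)] P.pt_eq_iff[OF th h(1)] BP by blast
    qed
    also have "\<dots> \<longleftrightarrow> (\<forall>y\<in>B.dense ?XB. t <#\<^bsub>SL n\<^esub> y = y)"
      using B.stabilizer_dense[OF h(1) hB t] B.torus_pt[OF t h(1)] hB B.dense_subset by (metis subsetD)
    finally show ?thesis .
  qed
  then have "char_lattice n P.Q ?XP = char_lattice n B.Q ?XB"
    unfolding char_lattice_def by auto
  then show ?thesis using that[of h] h(1,2) hB unfolding PB by blast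
qed

section \<open>Bruhat order\<close>

text \<open>
  An inversion of \<open>w\<close> is moved along the transposition, unless the transposition reverses the order of
  its two positions; then it is kept.  This embeds the inversions of \<open>w\<close> into those of \<open>w \<circ> (a b)\<close> other than
  \<open>(a, b)\<close>.
\<close>
lemma perm_length_transpose:
  assumes ab: "1 \<le> a" "a < b" "b \<le> n" and less: "w a < w b"
  shows "perm_length n w < perm_length n (w \<circ> transpose a b)"
proof -
  let ?t = "transpose a b"
  define I where "I w = {(i, j). 1 \<le> i \<and> i < j \<and> j \<le> n \<and> w j < w i}" for w :: "nat \<Rightarrow> nat"
  have fin: "finite (I w)" for w
    by (rule finite_subset[of _ "{1..n} \<times> {1..n}"]) (auto simp: I_def)
  define \<phi> where "\<phi> = (\<lambda>(i, j). if ?t i < ?t j then (?t i, ?t j) else (i, j))"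
  have inj: "inj_on \<phi> (I w)"
  proof (rule inj_onI)
    fix p p' assume p: "p \<in> I w" "p' \<in> I w" "\<phi> p = \<phi> p'"
    obtain i j i' j' where ij: "p = (i, j)" "p' = (i', j')" by (metis surj_pair)
    have lt: "i < j" "i' < j'" using p ij by (auto simp: I_def)
    show "p = p'"
      using p(3) lt unfolding ij \<phi>_def by (auto split: if_splits dest: transpose_eq_imp_eq)
  qed
  have "\<phi> ` I w \<subseteq> I (w \<circ> ?t) - {(a, b)}"
  proof
    fix y assume "y \<in> \<phi> ` I w"
    then obtain i j where ij: "1 \<le> i" "i < j" "j \<le> n" "w j < w i" "y = \<phi> (i, j)" by (auto simp: I_def)
    show "y \<in> I (w \<circ> ?t) - {(a, b)}"
    proof (cases "?t i < ?t j")
      case True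
      have "1 \<le> ?t i" "?t j \<le> n" using ij ab by (auto simp: transpose_def)
      moreover have "(?t i, ?t j) \<noteq> (a, b)" using ij(2) ab(2) by (auto simp: transpose_def split: if_splits)
      ultimately show ?thesis using True ij by (auto simp: \<phi>_def I_def)
    next
      case False
      then have "(i = a \<and> j = b) \<or> (i = a \<and> a < j \<and> j < b) \<or> (j = b \<and> a < i \<and> i < b)"
        using ij(2) ab(2) by (auto simp: transpose_def split: if_splits)
      then show ?thesis using False ij ab less by (auto simp: \<phi>_def I_def transpose_def)
    qed
  qed
  then have "card (I w) \<le> card (I (w \<circ> ?t) - {(a, b)})"
    using card_inj_on_le[OF inj] fin by blast
  also have "\<dots> < card (I (w \<circ> ?t))"
    using ab less fin by (intro psubset_card_mono) (auto simp: I_def)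
  finally show ?thesis by (simp add: perm_length_def I_def)
qed

lemma bruhat_stepI:
  assumes "1 \<le> a" "a < b" "b \<le> n" "u a < u b"
  shows "bruhat_step n u (u \<circ> transpose a b)"
  unfolding bruhat_step_def
  by (rule conjI, rule bexI[of _ a], rule bexI[of _ b])
     (use assms perm_length_transpose[OF assms] in auto)

lemma bruhat_stepE:
  assumes "bruhat_step n u w" "u permutes {1..n}"
  obtains a b where "1 \<le> a" "a < b" "b \<le> n" "u a < u b" "w = u \<circ> transpose a b"
proof -
  have "\<exists>a b. 1 \<le> a \<and> a < b \<and> b \<le> n \<and> w = u \<circ> transpose a b"
    using assms(1) unfolding bruhat_step_def
    by (metis atLeastAtMost_iff linorder_neqE_nat transpose_commute)
  then obtain a b where ab: "1 \<le> a" "a < b" "b \<le> n" "w = u \<circ> transpose a b" by blast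
  have "u a < u b"
  proof (rule ccontr)
    assume "\<not> u a < u b"
    moreover have "u a \<noteq> u b" using permutes_inj[OF assms(2)] ab(2) by (auto simp: inj_eq)
    ultimately have "w a < w b" using ab by simp
    then have "perm_length n w < perm_length n (w \<circ> transpose a b)" by (rule perm_length_transpose[OF ab(1-3)])
    moreover have "w \<circ> transpose a b = u" unfolding ab(4) by (simp add: comp_assoc)
    ultimately show False using assms(1) unfolding bruhat_step_def by simp
  qed
  then show ?thesis using that ab by blast
qed

lemma bruhat_step_permutes:
  assumes "bruhat_step n u w" "w permutes {1..n}"
  shows "u permutes {1..n}"
proof -
  obtain a b where ab: "a \<in> {1..n}" "b \<in> {1..n}" "w = u \<circ> transpose a b"
    using assms(1) unfolding bruhat_step_def by blast
  have "w \<circ> transpose a b = u" unfolding ab(3) by (simp add: comp_assoc)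
  then show ?thesis using permutes_compose[OF permutes_swap_id[OF ab(1,2)] assms(2)] by simp
qed

text \<open>The rank numbers that describe the Bruhat order.\<close>
definition count_ge :: "(nat \<Rightarrow> nat) \<Rightarrow> nat \<Rightarrow> nat \<Rightarrow> nat" where
  "count_ge u k m = (\<Sum>i=1..k. of_bool (m \<le> u i))"

lemma count_ge_transpose:
  assumes "1 \<le> a" "a < b" "u a < u b"
  shows "count_ge (u \<circ> transpose a b) k m = count_ge u k m + of_bool (a \<le> k \<and> k < b \<and> u a < m \<and> m \<le> u b)"
proof -
  consider "k < a" | "a \<le> k" "k < b" | "b \<le> k" by linarith
  then show ?thesis
  proof cases
    case 1
    then show ?thesis unfolding count_ge_def using assms by (auto intro!: sum.cong)
  next
    case 2
    have "count_ge (u \<circ> transpose a b) k m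
        = of_bool (m \<le> u b) + (\<Sum>i\<in>{1..k} - {a}. of_bool (m \<le> u (transpose a b i)))"
      unfolding count_ge_def using 2 assms by (subst sum.remove[of _ a]) auto
    also have "(\<Sum>i\<in>{1..k} - {a}. of_bool (m \<le> u (transpose a b i))) = (\<Sum>i\<in>{1..k} - {a}. of_bool (m \<le> u i) :: nat)"
      using 2 by (intro sum.cong) (auto simp: transpose_def)
    finally have "count_ge (u \<circ> transpose a b) k m = of_bool (m \<le> u b) + (\<Sum>i\<in>{1..k} - {a}. of_bool (m \<le> u i))" .
    moreover have "count_ge u k m = of_bool (m \<le> u a) + (\<Sum>i\<in>{1..k} - {a}. of_bool (m \<le> u i))"
      unfolding count_ge_def using 2 assms by (subst sum.remove[of _ a]) auto
    ultimately show ?thesis using 2 assms(3) by auto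
  next
    case 3
    have "transpose a b permutes {1..k}" using 3 assms by (intro permutes_swap_id) auto
    from sum.permute[OF this, of "\<lambda>i. of_bool (m \<le> u i) :: nat"] show ?thesis
      using 3 by (simp add: count_ge_def comp_def)
  qed
qed

text \<open>
  The tableau criterion of Ehresmann.  At the first position \<open>j\<close> where \<open>u\<close> and \<open>w\<close> differ, exchange
  \<open>u j\<close> with the next value in the interval \<open>(u j, w j]\<close>; the counts stay below those of \<open>w\<close>.
\<close>
lemma tableau_criterion:
  assumes "u permutes {1..n}" "w permutes {1..n}" "\<And>k m. k \<le> n \<Longrightarrow> count_ge u k m \<le> count_ge w k m"
  shows "bruhat_le n u w"
  using assms(1,3)
proof (induction "\<Sum>k\<le>n. \<Sum>m\<le>n. count_ge w k m - count_ge u k m" arbitrary: u rule: less_induct)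
  case less
  note u = less.prems(1) and le = less.prems(2) and w = assms(2)
  show ?case
  proof (cases "u = w")
    case True
    then show ?thesis by (simp add: bruhat_le_def)
  next
    case False
    then have "\<exists>j. u j \<noteq> w j" by auto
    define j where "j = (LEAST j. u j \<noteq> w j)"
    have j: "u j \<noteq> w j" unfolding j_def using LeastI_ex[OF \<open>\<exists>j. u j \<noteq> w j\<close>] .
    have before: "u i = w i" if "i < j" for i using not_less_Least[of i "\<lambda>j. u j \<noteq> w j"] that by (auto simp: j_def)
    have jn: "1 \<le> j" "j \<le> n"
      using j permutes_not_in[OF u, of j] permutes_not_in[OF w, of j] by (metis atLeastAtMost_iff)+
    have split_j: "count_ge v j m = (\<Sum>i=1..j-1. of_bool (m \<le> v i)) + of_bool (m \<le> v j)" for v m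
    proof -
      have "{1..j} = insert j {1..j-1}" using jn by auto
      then show ?thesis using jn by (simp add: count_ge_def)
    qed
    have "(\<Sum>i=1..j-1. of_bool (u j \<le> u i)) = (\<Sum>i=1..j-1. of_bool (u j \<le> w i) :: nat)"
      using before jn by (intro sum.cong) auto
    then have "u j \<le> w j" using le[OF jn(2), of "u j"] split_j[of u "u j"] split_j[of w "u j"]
      by (cases "u j \<le> w j") simp_all
    then have ujw: "u j < w j" using j by simp
    define b where "b = (LEAST b. j < b \<and> u j < u b \<and> u b \<le> w j)"
    have "\<exists>b. j < b \<and> u j < u b \<and> u b \<le> w j"
    proof -
      obtain p where p: "u p = w j" using permutes_surj[OF u] by (metis surjD)
      have "p \<noteq> j" using p j by auto
      moreover have "\<not> p < j" using before[of p] p permutes_inj[OF w] by (auto simp: inj_eq)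
      ultimately show ?thesis using p ujw by (intro exI[of _ p]) auto
    qed
    then have b: "j < b" "u j < u b" "u b \<le> w j" unfolding b_def using LeastI_ex[of "\<lambda>b. j < b \<and> u j < u b \<and> u b \<le> w j"] by auto
    have between: "\<not> (u j < u i \<and> u i \<le> w j)" if "j < i" "i < b" for i
      using not_less_Least[of i "\<lambda>b. j < b \<and> u j < u b \<and> u b \<le> w j"] that by (auto simp: b_def)
    have wj: "w j \<in> {1..n}" using permutes_in_image[OF w, of j] jn by simp
    have bn: "b \<le> n"
    proof (rule ccontr)
      assume "\<not> b \<le> n"
      then have "u b = b" using permutes_not_in[OF u, of b] by simp
      then show False using b wj \<open>\<not> b \<le> n\<close> by simp
    qed
    define z where "z = u \<circ> transpose j b"
    have z: "z permutes {1..n}"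
      unfolding z_def using permutes_compose[OF permutes_swap_id[of j "{1..n}" b] u] jn b bn by simp
    have step: "bruhat_step n u z" unfolding z_def by (rule bruhat_stepI[OF jn(1) b(1) bn b(2)])
    have cz: "count_ge z k m = count_ge u k m + of_bool (j \<le> k \<and> k < b \<and> u j < m \<and> m \<le> u b)" for k m
      unfolding z_def by (rule count_ge_transpose[OF jn(1) b(1,2)])
    have le_z: "count_ge z k m \<le> count_ge w k m" if kn: "k \<le> n" for k m
    proof (cases "j \<le> k \<and> k < b \<and> u j < m \<and> m \<le> u b")
      case True
      have split_val: "count_ge v k m = count_ge v k (Suc (w j)) + (\<Sum>i=1..k. of_bool (m \<le> v i \<and> v i \<le> w j))" for v
      proof -
        have "m \<le> w j" using True b by simp
        then show ?thesis unfolding count_ge_def sum.distrib[symmetric] by (intro sum.cong) auto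
      qed
      have parts: "{1..k} = {1..j-1} \<union> {j..k}" "{1..j-1} \<inter> {j..k} = {}" using jn True by auto
      have split_pos: "(\<Sum>i=1..k. of_bool (m \<le> v i \<and> v i \<le> w j) :: nat) =
          (\<Sum>i=1..j-1. of_bool (m \<le> v i \<and> v i \<le> w j)) + (\<Sum>i=j..k. of_bool (m \<le> v i \<and> v i \<le> w j))" for v
        unfolding parts(1) by (rule sum.union_disjoint) (use parts(2) in auto)
      have "(\<Sum>i=j..k. of_bool (m \<le> u i \<and> u i \<le> w j)) = (0 :: nat)"
      proof (rule sum.neutral, rule ballI)
        fix i assume i: "i \<in> {j..k}"
        show "of_bool (m \<le> u i \<and> u i \<le> w j) = (0 :: nat)"
          using between[of i] i True by (cases "i = j") auto
      qed
      moreover have "(\<Sum>i=1..j-1. of_bool (m \<le> u i \<and> u i \<le> w j)) = (\<Sum>i=1..j-1. of_bool (m \<le> w i \<and> w i \<le> w j) :: nat)"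
        using before jn by (intro sum.cong) auto
      moreover have "(\<Sum>i=j..k. of_bool (m \<le> w i \<and> w i \<le> w j)) \<ge> (\<Sum>i\<in>{j}. of_bool (m \<le> w i \<and> w i \<le> w j) :: nat)"
        using True by (intro sum_mono2) auto
      moreover have "(\<Sum>i\<in>{j}. of_bool (m \<le> w i \<and> w i \<le> w j) :: nat) = 1" using True b by simp
      ultimately show ?thesis
        using cz[of k m] True le[OF kn, of "Suc (w j)"] split_val[of u] split_val[of w] split_pos[of u] split_pos[of w]
        by simp
    next
      case False
      have "of_bool (j \<le> k \<and> k < b \<and> u j < m \<and> m \<le> u b) = (0 :: nat)"
        by (simp only: False of_bool_eq)
      then show ?thesis using cz[of k m] le[OF kn, of m] by linarith
    qed
    have "(\<Sum>k\<le>n. \<Sum>m\<le>n. count_ge w k m - count_ge z k m) < (\<Sum>k\<le>n. \<Sum>m\<le>n. count_ge w k m - count_ge u k m)"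
    proof (rule sum_strict_mono_ex1)
      show "\<forall>k\<in>{..n}. (\<Sum>m\<le>n. count_ge w k m - count_ge z k m) \<le> (\<Sum>m\<le>n. count_ge w k m - count_ge u k m)"
        using cz by (intro ballI sum_mono) (simp add: diff_le_mono2)
      have "(\<Sum>m\<le>n. count_ge w j m - count_ge z j m) < (\<Sum>m\<le>n. count_ge w j m - count_ge u j m)"
      proof (rule sum_strict_mono_ex1)
        show "\<forall>m\<in>{..n}. count_ge w j m - count_ge z j m \<le> count_ge w j m - count_ge u j m"
          using cz by (simp add: diff_le_mono2)
        have "u b \<le> n" using b wj by simp
        moreover have "count_ge z j (u b) = count_ge u j (u b) + 1" using cz[of j "u b"] b by simp
        ultimately show "\<exists>m\<in>{..n}. count_ge w j m - count_ge z j m < count_ge w j m - count_ge u j m"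
          using le_z[OF jn(2), of "u b"] by (intro bexI[of _ "u b"]) auto
      qed simp
      then show "\<exists>k\<in>{..n}. (\<Sum>m\<le>n. count_ge w k m - count_ge z k m) < (\<Sum>m\<le>n. count_ge w k m - count_ge u k m)"
        using jn by blast
    qed simp
    then have "bruhat_le n z w" using less.hyps[OF _ z le_z] by blast
    then show ?thesis using step unfolding bruhat_le_def by (meson converse_rtranclp_into_rtranclp)
  qed
qed

section \<open>The parabolic subgroup of the symmetric group\<close>

lemma increasing_permutes_id:
  assumes p: "p permutes {1..n}" and inc: "\<And>i. 1 \<le> i \<Longrightarrow> i < n \<Longrightarrow> p i < p (Suc i)"
  shows "p = id"
proof -
  have ge: "i \<le> p i" if "1 \<le> i" "i \<le> n" for i
    using that
  proof (induction i rule: dec_induct)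
    case base
    then show ?case using permutes_in_image[OF p, of 1] by simp
  next
    case (step i)
    then show ?case using inc[of i] by simp
  qed
  show ?thesis
  proof (rule permutes_le_imp_id[OF _ p, of "\<lambda>a. n - a"])
    show "n - p a \<le> n - a" if "a \<in> {1..n}" for a using ge[of a] that by simp
  qed (auto simp: inj_on_def)
qed

lemma parabolic_subgroup_generators:
  "{transpose i (i + 1) | i. 1 \<le> i \<and> i < n \<and> i \<noteq> d} \<subseteq> carrier (sym_group n)"
  by (auto simp: sym_group_carrier intro!: permutes_swap_id)

lemma subgroup_parabolic: "subgroup (parabolic_subgroup n d) (sym_group n)"
  unfolding parabolic_subgroup_def
  by (rule group.generate_is_subgroup[OF sym_group_is_group parabolic_subgroup_generators])

text \<open>
  A permutation other than the identity has a descent \<open>i\<close>, and \<open>i \<noteq> d\<close> if \<open>{1..d}\<close> is preserved.  Multiplication by the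
  transposition of \<open>i\<close> and \<open>i + 1\<close> then decreases the length.
\<close>
lemma parabolic_subgroup_iff:
  assumes d: "d \<le> n"
  shows "p \<in> parabolic_subgroup n d \<longleftrightarrow> p permutes {1..n} \<and> p ` {1..d} = {1..d}"
proof
  assume "p \<in> parabolic_subgroup n d"
  then show "p permutes {1..n} \<and> p ` {1..d} = {1..d}"
    unfolding parabolic_subgroup_def
  proof (induction rule: generate.induct)
    case one
    show ?case unfolding sym_group_one by (intro conjI permutes_id) simp
  next
    case (incl h)
    then obtain i where i: "h = transpose i (i + 1)" "1 \<le> i" "i < n" "i \<noteq> d" by blast
    have "h permutes {1..n}" unfolding i(1) using i by (intro permutes_swap_id) auto
    moreover have "h ` {1..d} = {1..d}" unfolding i(1) using i by (intro transpose_image_eq) auto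
    ultimately show ?case by blast
  next
    case (inv h)
    then obtain i where i: "h = transpose i (i + 1)" "1 \<le> i" "i < n" "i \<noteq> d" by blast
    have "h permutes {1..n}" unfolding i(1) using i by (intro permutes_swap_id) auto
    moreover have "h ` {1..d} = {1..d}" unfolding i(1) using i by (intro transpose_image_eq) auto
    ultimately show ?case using sym_group_inv_equality[of h n] i(1) by (simp add: sym_group_carrier)
  next
    case (eng h1 h2)
    then show ?case unfolding sym_group_mult by (metis image_comp permutes_compose)
  qed
next
  assume "p permutes {1..n} \<and> p ` {1..d} = {1..d}"
  then show "p \<in> parabolic_subgroup n d"
  proof (induction "perm_length n p" arbitrary: p rule: less_induct)
    case less
    then have p: "p permutes {1..n}" "p ` {1..d} = {1..d}" by auto
    show ?case
    proof (cases "p = id")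
      case True
      then show ?thesis
        using subgroup.one_closed[OF subgroup_parabolic] by (metis sym_group_one)
    next
      case False
      then obtain i where i: "1 \<le> i" "i < n" "\<not> p i < p (Suc i)" using increasing_permutes_id[OF p(1)] by blast
      have "p i \<noteq> p (Suc i)" using permutes_inj[OF p(1)] by (auto simp: inj_eq)
      then have desc: "p (Suc i) < p i" using i(3) by simp
      have "i \<noteq> d"
      proof
        assume "i = d"
        then have "p i \<le> d" using p(2) i(1) by (metis atLeastAtMost_iff image_eqI order_refl)
        moreover have "p (Suc i) \<notin> p ` {1..d}" using permutes_inj[OF p(1)] \<open>i = d\<close> by (auto simp: inj_eq)
        moreover have "p (Suc i) \<in> {1..n}" using permutes_in_image[OF p(1)] i by simp
        ultimately show False using desc p(2) by auto
      qed
      let ?t = "transpose i (i + 1)"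
      define q where "q = p \<circ> ?t"
      have pq: "p = q \<circ> ?t" unfolding q_def by (simp add: comp_assoc)
      have "?t permutes {1..n}" using i by (intro permutes_swap_id) auto
      then have q: "q permutes {1..n}" unfolding q_def using permutes_compose p(1) by blast
      have "?t ` {1..d} = {1..d}" using \<open>i \<noteq> d\<close> i by (intro transpose_image_eq) auto
      then have qd: "q ` {1..d} = {1..d}" unfolding q_def using p(2) by (metis image_comp)
      have "perm_length n q < perm_length n p"
        unfolding pq using i desc by (intro perm_length_transpose) (auto simp: q_def)
      then have "q \<in> parabolic_subgroup n d" using less.hyps q qd by blast
      moreover have "?t \<in> parabolic_subgroup n d"
        unfolding parabolic_subgroup_def using i \<open>i \<noteq> d\<close> by (intro generate.incl) blast
      ultimately have "q \<otimes>\<^bsub>sym_group n\<^esub> ?t \<in> parabolic_subgroup n d"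
        using subgroup.m_closed[OF subgroup_parabolic] by blast
      then show ?thesis using pq by (simp add: sym_group_mult)
    qed
  qed
qed

lemma coset_parabolic_eq_iff:
  assumes d: "d \<le> n" and u: "u permutes {1..n}" and v: "v permutes {1..n}"
  shows "u <#\<^bsub>sym_group n\<^esub> parabolic_subgroup n d = v <#\<^bsub>sym_group n\<^esub> parabolic_subgroup n d \<longleftrightarrow>
    u ` {1..d} = v ` {1..d}"
proof
  have mem: "y \<in> v <#\<^bsub>sym_group n\<^esub> parabolic_subgroup n d \<longleftrightarrow> (\<exists>p\<in>parabolic_subgroup n d. y = v \<circ> p)" for y v
    by (auto simp: l_coset_def sym_group_mult)
  {
    assume eq: "u <#\<^bsub>sym_group n\<^esub> parabolic_subgroup n d = v <#\<^bsub>sym_group n\<^esub> parabolic_subgroup n d"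
    have "id \<in> parabolic_subgroup n d" using d by (simp add: parabolic_subgroup_iff permutes_id)
    then have "u \<in> u <#\<^bsub>sym_group n\<^esub> parabolic_subgroup n d" unfolding mem by (metis comp_id)
    then obtain p where "p \<in> parabolic_subgroup n d" "u = v \<circ> p" unfolding eq mem by blast
    then show "u ` {1..d} = v ` {1..d}" using parabolic_subgroup_iff[OF d] by (metis image_comp)
  next
    assume eq: "u ` {1..d} = v ` {1..d}"
    define p where "p = inv_into UNIV v \<circ> u"
    have up: "u = v \<circ> p" unfolding p_def using permutes_inv_o(1)[OF v] by (simp add: comp_assoc[symmetric])
    have "p permutes {1..n}" unfolding p_def by (rule permutes_compose[OF u permutes_inv[OF v]])
    moreover have "p ` {1..d} = {1..d}"
      unfolding p_def image_comp[symmetric] eq using permutes_inv_o(2)[OF v] by (simp add: image_comp)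
    ultimately have "p \<in> parabolic_subgroup n d" using d by (simp add: parabolic_subgroup_iff)
    then have "u \<in> v <#\<^bsub>sym_group n\<^esub> parabolic_subgroup n d" unfolding mem using up by blast
    from group.l_repr_independence[OF sym_group_is_group this _ subgroup_parabolic]
    show "u <#\<^bsub>sym_group n\<^esub> parabolic_subgroup n d = v <#\<^bsub>sym_group n\<^esub> parabolic_subgroup n d"
      using v by (simp add: sym_group_carrier)
  }
qed

section \<open>Limits in Schubert varieties\<close>

lemma poly_funs_limit:
  assumes f: "f \<in> poly_funs (mat_coords n)"
    and L: "\<And>i j. i < n \<Longrightarrow> j < n \<Longrightarrow> (\<lambda>m. \<gamma> m $$ (i, j)) \<longlonglongrightarrow> L $$ (i, j)"
  shows "(\<lambda>m. f (\<gamma> m)) \<longlonglongrightarrow> f L"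
  using f
proof induction
  case (coord p)
  then show ?case using L by (auto simp: mat_coords_def)
qed (auto intro: tendsto_add tendsto_mult)

lemma SL_limit:
  assumes \<gamma>: "\<And>m. \<gamma> m \<in> carrier (SL n)" and Lm: "L \<in> carrier_mat n n"
    and L: "\<And>i j. i < n \<Longrightarrow> j < n \<Longrightarrow> (\<lambda>m. \<gamma> m $$ (i, j)) \<longlonglongrightarrow> L $$ (i, j)"
  shows "L \<in> carrier (SL n)"
proof -
  have "poly_fun n (\<lambda>g. det g)" by (rule poly_fun_det) (auto intro: poly_fun_entry)
  then obtain F where F: "F \<in> poly_funs (mat_coords n)" "\<forall>g\<in>carrier_mat n n. det g = F g"
    unfolding poly_fun_def by blast
  have "F (\<gamma> m) = 1" for m
  proof -
    have "\<gamma> m \<in> carrier_mat n n" "det (\<gamma> m) = 1" using \<gamma>[of m] by simp_all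
    then show ?thesis using F(2) by metis
  qed
  then have "(\<lambda>m. 1) \<longlonglongrightarrow> F L" using poly_funs_limit[OF F(1) L] by simp
  then have "F L = 1" using LIMSEQ_unique tendsto_const by blast
  then show ?thesis using F(2) Lm by simp
qed

context flag_variety begin

lemma borel_subset: "borel n \<subseteq> Q"
proof
  fix b assume "b \<in> borel n"
  then show "b \<in> Q" unfolding borel_def flag_stab_def by fastforce
qed

lemma schubert_borel_stable:
  assumes w: "w permutes {1..n}" and h: "h \<in> carrier (SL n)" "pt h \<in> schubert_variety n Q w"
    and b: "b \<in> borel n"
  shows "pt (b * h) \<in> schubert_variety n Q w"
proof -
  obtain A where A: "A \<in> weyl_coset n w" using weyl_coset_nonempty[OF w n_pos] .
  have bS: "b \<in> carrier (SL n)" and AS: "A \<in> carrier (SL n)" using b A by (simp_all add: borel_def weyl_coset_def)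
  show ?thesis
  proof (rule in_schubertI[OF w A mult_SL[OF bS h(1)]])
    fix f assume f: "f \<in> poly_funs (mat_coords n)"
      and zero: "\<And>b q. b \<in> borel n \<Longrightarrow> q \<in> Q \<Longrightarrow> f (b * A * q) = 0"
    show "f (b * h) = 0"
    proof (rule schubert_vanish[OF w A h, where F = "\<lambda>h. f (b * h)"])
      show "poly_fun n (\<lambda>h. f (b * h))" using poly_fun_left_mult[OF f] bS by simp
      fix c q assume c: "c \<in> borel n" and q: "q \<in> Q"
      have cS: "c \<in> carrier (SL n)" using c by (simp add: borel_def)
      have "b * (c * A * q) = b * c * A * q"
        using assoc_SL[OF bS mult_SL[OF cS AS] Q_carrier[OF q]] assoc_SL[OF bS cS AS] by simp
      moreover have "b * c \<in> borel n"
      proof -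
        have "subgroup (flag_stab n {1..<n}) (SL n)" by (rule subgroup_flag_stab) auto
        from subgroup.m_closed[OF this, of b c] show ?thesis using b c by (simp add: borel_eq)
      qed
      ultimately show "f (b * (c * A * q)) = 0" using zero q by simp
    qed
  qed
qed

lemma schubert_limit:
  assumes w: "w permutes {1..n}" and \<gamma>: "\<And>m. \<gamma> m \<in> carrier (SL n)" "\<And>m. pt (\<gamma> m) \<in> schubert_variety n Q w"
    and L: "L \<in> carrier (SL n)" "\<And>i j. i < n \<Longrightarrow> j < n \<Longrightarrow> (\<lambda>m. \<gamma> m $$ (i, j)) \<longlonglongrightarrow> L $$ (i, j)"
  shows "pt L \<in> schubert_variety n Q w"
proof -
  obtain A where A: "A \<in> weyl_coset n w" using weyl_coset_nonempty[OF w n_pos] .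
  show ?thesis
  proof (rule in_schubertI[OF w A L(1)])
    fix f assume f: "f \<in> poly_funs (mat_coords n)"
      and zero: "\<And>b q. b \<in> borel n \<Longrightarrow> q \<in> Q \<Longrightarrow> f (b * A * q) = 0"
    have "f (\<gamma> m) = 0" for m by (rule schubert_vanish[OF w A \<gamma> poly_funI[OF f] zero])
    then have "(\<lambda>m. 0) \<longlonglongrightarrow> f L" using poly_funs_limit[OF f L(2)] by simp
    then show "f L = 0" using LIMSEQ_unique tendsto_const by blast
  qed
qed

text \<open>
  The fixed point \<open>u\<close> is the limit for \<open>z \<rightarrow> 0\<close> of the points \<open>\<gamma> z\<close>, with \<open>\<gamma> z\<close> obtained from a monomial matrix
  of \<open>u\<close> by placing \<open>z\<close> in the corner of the minor of the transposition.  For \<open>z \<noteq> 0\<close> a column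
  operation clears the opposite corner and shows that \<open>\<gamma> z\<close> lies in the cell of \<open>u \<circ> (a b)\<close>.
\<close>
lemma fixed_point_transpose:
  assumes w: "w permutes {1..n}" and u: "u permutes {1..n}" and ab: "1 \<le> a" "a < b" "b \<le> n" "u a < u b"
    and ut: "fixed_point n Q (u \<circ> transpose a b) \<in> schubert_variety n Q w"
  shows "fixed_point n Q u \<in> schubert_variety n Q w"
proof -
  let ?y = "u \<circ> transpose a b"
  have y: "?y permutes {1..n}"
    using permutes_compose[OF permutes_swap_id[of a "{1..n}" b] u] ab by simp
  obtain A where A: "A \<in> weyl_coset n u" using weyl_coset_nonempty[OF u n_pos] .
  obtain Y where Y: "Y \<in> weyl_coset n ?y" using weyl_coset_nonempty[OF y n_pos] .
  have AS: "A \<in> carrier (SL n)" and YS: "Y \<in> carrier (SL n)" using A Y by (simp_all add: weyl_coset_def)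
  have Am: "A \<in> carrier_mat n n" using AS by simp
  define x where "x = row_perm u"
  have x: "x permutes {..<n}" unfolding x_def by (rule row_perm_permutes[OF u])
  have xlt: "x i < n" if "i < n" for i using permutes_in_image[OF x, of i] that by simp
  define i0 j0 where "i0 = a - 1" and "j0 = b - 1"
  have ij: "i0 < j0" "j0 < n" "a = Suc i0" "b = Suc j0" using ab by (auto simp: i0_def j0_def)
  have xij: "x i0 < x j0" using ab(4) Suc_row_perm[OF u, of i0] Suc_row_perm[OF u, of j0] ij by (simp add: x_def)
  have xy: "row_perm ?y i = x (transpose i0 j0 i)" for i
    by (auto simp: row_perm_def x_def ij transpose_def)
  have pat: "A $$ (i, j) \<noteq> 0 \<longleftrightarrow> i = x j" if "i < n" "j < n" for i j
    using A that unfolding weyl_coset_row_perm[OF u] x_def by blast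
  define \<gamma> where "\<gamma> z = mat n n (\<lambda>(i, j). if i = x j0 \<and> j = i0 then z else A $$ (i, j))" for z
  have \<gamma>m: "\<gamma> z \<in> carrier_mat n n" for z by (simp add: \<gamma>_def)
  have \<gamma>_shape: "cell_shape n {1..<n} x (\<gamma> z)" for z
    unfolding cell_shape_def
  proof (intro allI impI)
    fix i j assume "i < n" "j < n" "\<gamma> z $$ (x i, j) \<noteq> 0"
    then have "(x i = x j0 \<and> j = i0) \<or> x i = x j" using pat xlt by (auto simp: \<gamma>_def split: if_splits)
    then have "(i = j0 \<and> j = i0) \<or> i = j" using permutes_inj[OF x] by (auto simp: inj_eq)
    then show "i = j \<or> (\<exists>k\<in>{1..<n}. j < k \<and> k \<le> i)" using ij by (auto intro!: bexI[of _ j0])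
  qed
  have A_shape: "cell_shape n {1..<n} x A"
    unfolding cell_shape_def using pat xlt permutes_inj[OF x] by (auto simp: inj_eq)
  have "minor n x (\<gamma> z) = minor n x A" for z
  proof -
    have "\<gamma> z $$ (x a, a) = A $$ (x a, a)" if "a < n" for a
      using that xlt[OF that] ij permutes_inj[OF x] by (auto simp: \<gamma>_def inj_eq)
    then show ?thesis using minor_cell_shape[OF \<gamma>_shape, of n] minor_cell_shape[OF A_shape, of n] by simp
  qed
  then have \<gamma>S: "\<gamma> z \<in> carrier (SL n)" for z
    using minor_permutes[OF x \<gamma>m] minor_permutes[OF x Am] AS \<gamma>m by (auto simp: sign_def split: if_splits)
  have in_X: "pt (\<gamma> z) \<in> schubert_variety n Q w" if z: "z \<noteq> 0" for z
  proof -
    define e where "e = - (A $$ (x j0, j0) / z)"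
    define q where "q = mat n n (\<lambda>(i, j). if i = j then 1 else if i = i0 \<and> j = j0 then e else 0)"
    have qm: "q \<in> carrier_mat n n" by (simp add: q_def)
    have "det q = (\<Prod>i<n. q $$ (i, i))"
      by (rule det_upper_triangular_prod[OF qm]) (use ij in \<open>auto simp: q_def\<close>)
    also have "\<dots> = 1" by (simp add: q_def)
    finally have qB: "q \<in> borel n" using qm ij by (auto simp: borel_def q_def)
    have entry: "(\<gamma> z * q) $$ (i, j) = \<gamma> z $$ (i, j) + (if j = j0 then e * \<gamma> z $$ (i, i0) else 0)"
      if "i < n" "j < n" for i j
    proof -
      have "(\<gamma> z * q) $$ (i, j) = (\<Sum>l<n. \<gamma> z $$ (i, l) * q $$ (l, j))"
        using that \<gamma>m[of z] qm by (auto simp: scalar_prod_def atLeast0LessThan)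
      also have "\<dots> = (\<Sum>l<n. (if l = j then \<gamma> z $$ (i, l) else 0) + (if l = i0 then if j = j0 then e * \<gamma> z $$ (i, l) else 0 else 0))"
        using that ij by (intro sum.cong) (auto simp: q_def)
      also have "\<dots> = \<gamma> z $$ (i, j) + (if j = j0 then e * \<gamma> z $$ (i, i0) else 0)"
        using that ij by (simp add: sum.distrib sum.delta)
      finally show ?thesis .
    qed
    have qS: "q \<in> carrier (SL n)" using qB by (simp add: borel_def)
    have "row_perm ?y i \<le> row_perm ?y j"
      if "i < n" "j < n" "(\<gamma> z * q) $$ (row_perm ?y i, j) \<noteq> 0" for i j
    proof -
      let ?r = "row_perm ?y i"
      have r: "?r < n" using permutes_in_image[OF row_perm_permutes[OF y], of i] that by simp
      have e0: "\<gamma> z $$ (x j0, j0) + e * \<gamma> z $$ (x j0, i0) = 0"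
        using xlt[OF ij(2)] ij z by (auto simp: \<gamma>_def e_def)
      show ?thesis
      proof (cases "j = j0")
        case True
        have "\<gamma> z $$ (?r, j0) \<noteq> 0 \<or> \<gamma> z $$ (?r, i0) \<noteq> 0" using entry[OF r that(2)] that(3) True by auto
        moreover have "?r \<noteq> x j0" using entry[OF r that(2)] that(3) True e0 by auto
        moreover have "\<gamma> z $$ (?r, j0) \<noteq> 0 \<Longrightarrow> ?r = x j0"
          using pat[OF r, of j0] r ij by (auto simp: \<gamma>_def split: if_splits)
        moreover have "\<gamma> z $$ (?r, i0) \<noteq> 0 \<Longrightarrow> ?r \<noteq> x j0 \<Longrightarrow> ?r = x i0"
          using pat[OF r, of i0] r ij by (auto simp: \<gamma>_def split: if_splits)
        ultimately show ?thesis using True by (auto simp: xy)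
      next
        case False
        then have "\<gamma> z $$ (?r, j) \<noteq> 0" using entry[OF r that(2)] that(3) by simp
        then have "(?r = x j0 \<and> j = i0) \<or> ?r = x j"
          using pat[OF r that(2)] r that(2) by (auto simp: \<gamma>_def split: if_splits)
        then show ?thesis using xij False by (auto simp: xy transpose_def)
      qed
    qed
    then obtain c where c: "c \<in> borel n" "\<gamma> z * q = c * Y"
      using upper_shape_borel[OF y Y mult_SL[OF \<gamma>S qS]] by blast
    have "pt Y \<in> schubert_variety n Q w" using ut fixed_point_eq_pt[OF y Y] by simp
    then have "pt (\<gamma> z * q) \<in> schubert_variety n Q w"
      unfolding c(2) by (rule schubert_borel_stable[OF w YS _ c(1)])
    then show ?thesis using pt_mult[OF \<gamma>S, of q] qB borel_subset by auto
  qed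
  have "pt A \<in> schubert_variety n Q w"
  proof (rule schubert_limit[OF w, of "\<lambda>m. \<gamma> ((1 / 2) ^ m)"])
    fix i j assume "i < n" "j < n"
    have "(\<lambda>m. (1 / 2) ^ m :: complex) \<longlonglongrightarrow> 0" by (rule LIMSEQ_power_zero) simp
    moreover have "A $$ (x j0, i0) = 0"
      using pat[OF xlt[OF ij(2)], of i0] ij permutes_inj[OF x] by (auto simp: inj_eq)
    ultimately show "(\<lambda>m. \<gamma> ((1 / 2) ^ m) $$ (i, j)) \<longlonglongrightarrow> A $$ (i, j)"
      using \<open>i < n\<close> \<open>j < n\<close> by (cases "i = x j0 \<and> j = i0") (auto simp: \<gamma>_def)
  qed (use \<gamma>S AS in_X in auto)
  then show ?thesis using fixed_point_eq_pt[OF u A] by simp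
qed

lemma bruhat_le_fixed_point:
  assumes w: "w permutes {1..n}" and "bruhat_le n u w"
  shows "u permutes {1..n} \<and> fixed_point n Q u \<in> schubert_variety n Q w"
  using assms(2) unfolding bruhat_le_def
proof (induction rule: converse_rtranclp_induct)
  case base
  obtain A where A: "A \<in> weyl_coset n w" using weyl_coset_nonempty[OF w n_pos] .
  have one: "1\<^sub>m n \<in> borel n" by (auto simp: borel_def)
  have "A \<in> carrier_mat n n" using A by (simp add: weyl_coset_def)
  then have "pt A \<in> schubert_variety n Q w" using cell_in_schubert[OF w A one] left_mult_one_mat by metis
  then show ?case using w fixed_point_eq_pt[OF w A] by simp
next
  case (step u z)
  have u: "u permutes {1..n}" using bruhat_step_permutes[OF step.hyps(1)] step.IH by blast
  obtain a b where "1 \<le> a" "a < b" "b \<le> n" "u a < u b" "z = u \<circ> transpose a b"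
    using bruhat_stepE[OF step.hyps(1) u] by blast
  then show ?case using fixed_point_transpose[OF w u] step.IH u by blast
qed

end

text \<open>
  The minors with rows \<open>u 1, \<dots>, u k\<close> do not vanish at the fixed point of \<open>u\<close>.  The bound for nonvanishing minors
  on a Schubert variety turns this into the inequalities of the tableau criterion.
\<close>
lemma fixed_point_imp_bruhat_le:
  assumes n: "0 < n" and w: "w permutes {1..n}" and u: "u permutes {1..n}"
    and mem: "fixed_point n (flag_stab n {1..<n}) u \<in> schubert_variety n (flag_stab n {1..<n}) w"
  shows "bruhat_le n u w"
proof (rule tableau_criterion[OF u w])
  interpret flag_variety n "{1..<n}" using n by unfold_locales auto
  fix k m assume k: "k \<le> n"
  obtain A where A: "A \<in> weyl_coset n u" using weyl_coset_nonempty[OF u n] .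
  have AS: "A \<in> carrier (SL n)" using A by (simp add: weyl_coset_def)
  have AX: "pt A \<in> schubert_variety n Q w" using mem fixed_point_eq_pt[OF u A] by simp
  have ulow: "row_perm u i < n" if "i < n" for i
    using permutes_in_image[OF row_perm_permutes[OF u], of i] that by simp
  have count: "count_ge v k m = (\<Sum>i<k. of_bool (m \<le> Suc (row_perm v i)))" if "v permutes {1..n}" for v
    unfolding count_ge_def Suc_row_perm[OF that]
    by (rule sum.reindex_bij_witness[of _ Suc "\<lambda>i. i - 1"]) auto
  have "\<exists>\<pi>. \<pi> permutes {..<k} \<and> (\<forall>i<k. row_perm u i \<le> row_perm w (\<pi> i))"
  proof (cases "1 \<le> k \<and> k < n")
    case True
    show ?thesis
      by (rule schubert_minor[OF w AS AX _ _ minor_weyl_nonzero[OF u A k]]) (use True ulow in auto)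
  next
    case False
    then consider "k = 0" | "k = n" using k by linarith
    then show ?thesis
    proof cases
      case 1
      then show ?thesis by (intro exI[of _ id]) (auto simp: permutes_id)
    next
      case 2
      let ?\<pi> = "inv_into UNIV (row_perm w) \<circ> row_perm u"
      have "?\<pi> permutes {..<n}"
        by (rule permutes_compose[OF row_perm_permutes[OF u] permutes_inv[OF row_perm_permutes[OF w]]])
      moreover have "row_perm w (?\<pi> i) = row_perm u i" for i
        using permutes_inverses(1)[OF row_perm_permutes[OF w]] by simp
      ultimately show ?thesis using 2 by (intro exI[of _ ?\<pi>]) simp
    qed
  qed
  then obtain \<pi> where \<pi>: "\<pi> permutes {..<k}" "\<forall>i<k. row_perm u i \<le> row_perm w (\<pi> i)" by blast
  have "count_ge u k m = (\<Sum>i<k. of_bool (m \<le> Suc (row_perm u i)))" by (rule count[OF u])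
  also have "\<dots> \<le> (\<Sum>i<k. of_bool (m \<le> Suc (row_perm w (\<pi> i))))"
    using \<pi>(2) by (intro sum_mono) (force simp: of_bool_def)
  also have "\<dots> = (\<Sum>i<k. of_bool (m \<le> Suc (row_perm w i)))"
    using sum.permute[OF \<pi>(1), of "\<lambda>i. of_bool (m \<le> Suc (row_perm w i)) :: nat"] by (simp add: comp_def)
  also have "\<dots> = count_ge w k m" by (rule count[OF w, symmetric])
  finally show "count_ge u k m \<le> count_ge w k m" .
qed

section \<open>Initial degenerations of a generic flag\<close>

text \<open>
  Column reduction by the Borel subgroup with respect to an arbitrary order \<open>rk\<close> of the rows.  Each column
  is modified by the previous ones so that its leading row is as late as possible; two columns with the
  same leading row would allow the later one to be improved.
\<close>
lemma column_echelon_exists: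
  fixes rk :: "nat \<Rightarrow> nat"
  assumes g: "g \<in> carrier (SL n)" and rk: "inj_on rk {..<n}" "\<And>i. i < n \<Longrightarrow> rk i < n"
  obtains q u where "q \<in> borel n" "u permutes {..<n}"
    "\<And>j. j < n \<Longrightarrow> (g * q) $$ (u j, j) \<noteq> 0"
    "\<And>i j. i < n \<Longrightarrow> j < n \<Longrightarrow> (g * q) $$ (i, j) \<noteq> 0 \<Longrightarrow> rk (u j) \<le> rk i"
proof -
  have gm: "g \<in> carrier_mat n n" "det g = 1" using g by simp_all
  define col where "col j c i = g $$ (i, j) + (\<Sum>l<j. c l * g $$ (i, l))" for j :: nat and c :: "nat \<Rightarrow> complex" and i
  have nonzero: "\<exists>i<n. col j c i \<noteq> 0" if j: "j < n" for j c
  proof (rule ccontr)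
    assume zero: "\<not> ?thesis"
    define v where "v = vec n (\<lambda>l. if l = j then 1 else if l < j then c l else 0)"
    have "g *\<^sub>v v = 0\<^sub>v n"
    proof (rule eq_vecI)
      fix i assume "i < dim_vec (0\<^sub>v n :: complex vec)"
      then have i: "i < n" by simp
      have "(g *\<^sub>v v) $ i = (\<Sum>l<n. g $$ (i, l) * (if l = j then 1 else if l < j then c l else 0))"
        using i gm by (simp add: scalar_prod_def v_def atLeast0LessThan)
      also have "\<dots> = (\<Sum>l<n. (if l = j then g $$ (i, l) else 0) + (if l < j then c l * g $$ (i, l) else 0))"
        by (intro sum.cong) auto
      also have "\<dots> = g $$ (i, j) + (\<Sum>l<n. if l < j then c l * g $$ (i, l) else 0)"
        using j by (simp add: sum.distrib sum.delta)
      also have "(\<Sum>l<n. if l < j then c l * g $$ (i, l) else 0) = (\<Sum>l<j. c l * g $$ (i, l))"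
        using j by (intro sum.mono_neutral_cong_right) auto
      finally show "(g *\<^sub>v v) $ i = 0\<^sub>v n $ i" using zero i by (simp add: col_def)
    qed (use gm in auto)
    moreover have "v \<in> carrier_vec n" "v $ j = 1" using j by (auto simp: v_def)
    moreover have "v \<noteq> 0\<^sub>v n" using \<open>v $ j = 1\<close> j by auto
    ultimately show False using det_0_iff_vec_prod_zero_field[OF gm(1)] gm(2) by auto
  qed
  define late where "late j m \<longleftrightarrow> (\<exists>c. \<forall>i<n. rk i < m \<longrightarrow> col j c i = 0)" for j m
  have bound: "m \<le> n" if jm: "j < n" "late j m" for j m
  proof (rule ccontr)
    assume "\<not> m \<le> n"
    then obtain c where "\<forall>i<n. rk i < m \<longrightarrow> col j c i = 0" "n < m" using jm(2) by (auto simp: late_def)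
    then show False using nonzero[OF jm(1), of c] rk(2) by fastforce
  qed
  define lead where "lead j = (GREATEST m. late j m)" for j
  have lead: "late j (lead j)" if "j < n" for j
    unfolding lead_def by (rule GreatestI_nat[of _ 0 n]) (use bound that in \<open>auto simp: late_def\<close>)
  have lead_max: "m \<le> lead j" if "j < n" "late j m" for j m
    unfolding lead_def by (rule Greatest_le_nat[of _ _ n]) (use bound that in auto)
  obtain c where c: "\<And>j i. j < n \<Longrightarrow> i < n \<Longrightarrow> rk i < lead j \<Longrightarrow> col j (c j) i = 0"
    using lead unfolding late_def by metis
  have "\<exists>i<n. rk i = lead j \<and> col j (c j) i \<noteq> 0" if j: "j < n" for j
  proof (rule ccontr)
    assume "\<not> ?thesis"
    then have "late j (Suc (lead j))" using c[OF j] unfolding late_def by (metis less_Suc_eq)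
    then show False using lead_max[OF j] by fastforce
  qed
  then obtain u0 where u0: "\<And>j. j < n \<Longrightarrow> u0 j < n" "\<And>j. j < n \<Longrightarrow> rk (u0 j) = lead j"
    "\<And>j. j < n \<Longrightarrow> col j (c j) (u0 j) \<noteq> 0" by metis
  have distinct: "u0 j \<noteq> u0 k" if jk: "j < k" "k < n" for j k
  proof
    assume eq: "u0 j = u0 k"
    have jn: "j < n" using jk by simp
    have lead_eq: "lead j = lead k" using u0(2)[OF jn] u0(2)[OF jk(2)] eq by simp
    define \<kappa> where "\<kappa> = col k (c k) (u0 k) / col j (c j) (u0 k)"
    define c' where "c' l = c k l - \<kappa> * ((if l = j then 1 else 0) + (if l < j then c j l else 0))" for l
    have col': "col k c' i = col k (c k) i - \<kappa> * col j (c j) i" for i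
    proof -
      have "(\<Sum>l<k. c' l * g $$ (i, l)) = (\<Sum>l<k. c k l * g $$ (i, l)
          - \<kappa> * ((if l = j then g $$ (i, l) else 0) + (if l < j then c j l * g $$ (i, l) else 0)))"
        by (intro sum.cong) (auto simp: c'_def algebra_simps)
      also have "\<dots> = (\<Sum>l<k. c k l * g $$ (i, l))
          - \<kappa> * (g $$ (i, j) + (\<Sum>l<k. if l < j then c j l * g $$ (i, l) else 0))"
        using jk by (simp add: sum_subtractf sum_distrib_left[symmetric] sum.distrib sum.delta)
      also have "(\<Sum>l<k. if l < j then c j l * g $$ (i, l) else 0) = (\<Sum>l<j. c j l * g $$ (i, l))"
        using jk by (intro sum.mono_neutral_cong_right) auto
      finally show ?thesis by (simp add: col_def)
    qed
    have "col k c' i = 0" if "i < n" "rk i < Suc (lead k)" for i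
    proof (cases "rk i < lead k")
      case True
      then show ?thesis using col' c[OF jn that(1)] c[OF jk(2) that(1)] lead_eq by simp
    next
      case False
      then have "rk i = rk (u0 k)" using that(2) u0(2)[OF jk(2)] by simp
      then have "i = u0 k" using inj_onD[OF rk(1)] that(1) u0(1)[OF jk(2)] by simp
      then show ?thesis using col' u0(3)[OF jn] eq by (simp add: \<kappa>_def)
    qed
    then have "late k (Suc (lead k))" unfolding late_def by blast
    then show False using lead_max[OF jk(2)] by fastforce
  qed
  define u where "u j = (if j < n then u0 j else j)" for j
  have inj: "inj_on u {..<n}"
    using distinct by (intro linorder_inj_onI') (auto simp: u_def)
  have "u ` {..<n} = {..<n}" by (rule endo_inj_surj[OF _ _ inj]) (auto simp: u_def u0(1))
  then have u: "u permutes {..<n}"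
    using inj by (intro bij_imp_permutes bij_betw_imageI) (auto simp: u_def)
  define q where "q = mat n n (\<lambda>(l, j). if l = j then 1 else if l < j then c j l else 0)"
  have qm: "q \<in> carrier_mat n n" by (simp add: q_def)
  have "det q = (\<Prod>i<n. q $$ (i, i))"
    by (rule det_upper_triangular_prod[OF qm]) (simp add: q_def)
  also have "\<dots> = 1" by (simp add: q_def)
  finally have qB: "q \<in> borel n" using qm by (auto simp: borel_def q_def)
  have entry: "(g * q) $$ (i, j) = col j (c j) i" if "i < n" "j < n" for i j
  proof -
    have "(g * q) $$ (i, j) = (\<Sum>l<n. g $$ (i, l) * q $$ (l, j))"
      using that gm qm by (auto simp: scalar_prod_def atLeast0LessThan)
    also have "\<dots> = (\<Sum>l<n. (if l = j then g $$ (i, l) else 0) + (if l < j then c j l * g $$ (i, l) else 0))"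
      using that by (intro sum.cong) (auto simp: q_def)
    also have "\<dots> = g $$ (i, j) + (\<Sum>l<n. if l < j then c j l * g $$ (i, l) else 0)"
      using that by (simp add: sum.distrib sum.delta)
    also have "(\<Sum>l<n. if l < j then c j l * g $$ (i, l) else 0) = (\<Sum>l<j. c j l * g $$ (i, l))"
      using that by (intro sum.mono_neutral_cong_right) auto
    finally show ?thesis by (simp add: col_def)
  qed
  show ?thesis
  proof (rule that[OF qB u])
    show "(g * q) $$ (u j, j) \<noteq> 0" if "j < n" for j
      using that entry[OF u0(1)[OF that] that] u0(3)[OF that] by (simp add: u_def)
    show "rk (u j) \<le> rk i" if "i < n" "j < n" "(g * q) $$ (i, j) \<noteq> 0" for i j
      using that entry[OF that(1,2)] c[OF that(2,1)] u0(2)[OF that(2)] by (auto simp: u_def not_less[symmetric])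
  qed
qed

lemma prod_powi: "z \<noteq> 0 \<Longrightarrow> (\<Prod>i<n. z powi f i) = (z :: complex) powi (\<Sum>i<n. f i)" for n :: nat
  by (induction n) (simp_all add: power_int_add)

lemma row_perm_surj:
  assumes u: "u permutes {..<n}"
  obtains u1 where "u1 permutes {1..n}" "row_perm u1 = u"
proof -
  define u1 where "u1 k = (if 1 \<le> k \<and> k \<le> n then Suc (u (k - 1)) else k)" for k
  have "bij_betw (\<lambda>k. k - 1) {1..n} {..<n}" by (rule bij_betwI[of _ _ _ Suc]) auto
  moreover have "bij_betw u {..<n} {..<n}" using permutes_imp_bij[OF u] .
  moreover have "bij_betw Suc {..<n} {1..n}" by (rule bij_betwI[of _ _ _ "\<lambda>k. k - 1"]) auto
  ultimately have "bij_betw (Suc \<circ> (u \<circ> (\<lambda>k. k - 1))) {1..n} {1..n}" by (blast intro: bij_betw_trans)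
  then have "bij_betw u1 {1..n} {1..n}"
    by (rule bij_betw_cong[THEN iffD1, rotated]) (auto simp: u1_def)
  then have "u1 permutes {1..n}" by (intro bij_imp_permutes) (auto simp: u1_def)
  moreover have "row_perm u1 = u"
    using permutes_not_in[OF u] by (auto simp: row_perm_def u1_def fun_eq_iff)
  ultimately show ?thesis by (rule that)
qed

context flag_variety begin

text \<open>
  Degenerating a point of the dense orbit along a one-parameter subgroup that orders the rows by \<open>rk\<close>
  leaves only the leading entries.
\<close>
lemma initial_fixed_point:
  fixes rk :: "nat \<Rightarrow> nat"
  assumes w: "w permutes {1..n}" and h: "h \<in> carrier (SL n)" "pt h \<in> dense (schubert_variety n Q w)"
    and u: "u permutes {1..n}" and rk: "inj_on rk {..<n}"
    and lead: "\<And>j. j < n \<Longrightarrow> h $$ (row_perm u j, j) \<noteq> 0"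
      "\<And>i j. i < n \<Longrightarrow> j < n \<Longrightarrow> h $$ (i, j) \<noteq> 0 \<Longrightarrow> rk (row_perm u j) \<le> rk i"
  shows "fixed_point n Q u \<in> schubert_variety n Q w"
proof -
  let ?x = "row_perm u"
  have x: "?x permutes {..<n}" by (rule row_perm_permutes[OF u])
  have xlt: "?x i < n" if "i < n" for i using permutes_in_image[OF x, of i] that by simp
  have hm: "h \<in> carrier_mat n n" using h(1) by simp
  define L where "L = monomial n ?x (\<lambda>j. h $$ (?x j, j))"
  \<comment> \<open>multiples of the positions \<open>rk i\<close>, shifted to have sum \<open>0\<close>\<close>
  define wt where "wt i = int n * int (rk i) - (\<Sum>l<n. int (rk l))" for i
  have wt: "(\<Sum>i<n. wt i) = 0" by (simp add: wt_def sum_subtractf sum_distrib_left[symmetric])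
  define z where "z m = (1 / 2 :: complex) ^ m" for m
  have z0: "z m \<noteq> 0" for m by (simp add: z_def)
  define t where "t m = diag n (\<lambda>i. z m powi wt i)" for m
  have t: "t m \<in> torus n" for m
    unfolding t_def using wt prod_powi[OF z0, of m wt n] by (intro diag_in_torus) simp
  have t_entry: "t m $$ (i, i) = z m powi wt i" if "i < n" for m i using that by (simp add: t_def diag_def)
  define D where "D m = diag n (\<lambda>j. inverse (t m $$ (?x j, ?x j)))" for m
  have D: "D m \<in> torus n" for m unfolding D_def by (rule torus_conjugate[OF x t])
  have th: "t m * h \<in> carrier (SL n)" for m using mult_SL[OF torus_carrier[OF t] h(1)] .
  define \<gamma> where "\<gamma> m = t m * h * D m" for m
  have \<gamma>S: "\<gamma> m \<in> carrier (SL n)" for m unfolding \<gamma>_def using mult_SL[OF th torus_carrier[OF D]] .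
  have \<gamma>X: "pt (\<gamma> m) \<in> schubert_variety n Q w" for m
  proof -
    have "D m \<in> Q" using D torus_le by blast
    then have "pt (\<gamma> m) = t m <#\<^bsub>SL n\<^esub> pt h" unfolding \<gamma>_def using pt_mult[OF th] torus_pt[OF t h(1)] by simp
    then show ?thesis using dense_torus[OF h(2) t] dense_subset by auto
  qed
  have entry: "\<gamma> m $$ (i, j) = h $$ (i, j) * z m powi (wt i - wt (?x j))" if "i < n" "j < n" for m i j
  proof -
    have "\<gamma> m $$ (i, j) = t m $$ (i, i) * h $$ (i, j) * inverse (t m $$ (?x j, ?x j))"
      unfolding \<gamma>_def D_def
      using mult_diag_index[of "t m * h" n i j] torus_mult_index[OF t hm that] th[of m] that by simp
    then show ?thesis
      using t_entry[OF that(1)] t_entry[OF xlt[OF that(2)]] z0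
      by (simp add: power_int_diff divide_inverse)
  qed
  have limit: "(\<lambda>m. \<gamma> m $$ (i, j)) \<longlonglongrightarrow> L $$ (i, j)" if ij: "i < n" "j < n" for i j
  proof (cases "i = ?x j \<or> h $$ (i, j) = 0")
    case True
    then have "\<gamma> m $$ (i, j) = L $$ (i, j)" for m
      using entry[OF ij] ij z0 by (auto simp: L_def monomial_def)
    then show ?thesis by simp
  next
    case False
    have "rk (?x j) \<noteq> rk i" using False inj_onD[OF rk, of "?x j" i] ij xlt by auto
    then have less: "rk (?x j) < rk i" using lead(2)[OF ij] False by simp
    define p where "p = n * (rk i - rk (?x j))"
    have p: "p > 0" "wt i - wt (?x j) = int p"
      using less ij by (auto simp: p_def wt_def of_nat_diff algebra_simps)
    have "\<gamma> m $$ (i, j) = h $$ (i, j) * ((1 / 2) ^ p) ^ m" for m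
      unfolding entry[OF ij] p(2) by (simp add: z_def power_mult[symmetric] mult.commute)
    moreover have "(\<lambda>m. h $$ (i, j) * ((1 / 2) ^ p) ^ m) \<longlonglongrightarrow> h $$ (i, j) * 0"
      by (intro tendsto_intros LIMSEQ_power_zero) (use p(1) in \<open>simp add: norm_power power_less_one_iff\<close>)
    moreover have "L $$ (i, j) = 0" using False ij by (simp add: L_def monomial_def)
    ultimately show ?thesis by simp
  qed
  have LS: "L \<in> carrier (SL n)" by (rule SL_limit[OF \<gamma>S _ limit]) (simp add: L_def)
  have "pt L \<in> schubert_variety n Q w" by (rule schubert_limit[OF w \<gamma>S \<gamma>X LS limit])
  moreover have "L \<in> weyl_coset n u"
    unfolding weyl_coset_row_perm[OF u] using LS lead(1) by (auto simp: L_def monomial_def)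
  ultimately show ?thesis using fixed_point_eq_pt[OF u] by metis
qed

lemma dense_minor_nonzero:
  assumes h: "h \<in> carrier (SL n)" "pt h \<in> dense X" and s: "s \<in> carrier (SL n)" "pt s \<in> X"
    and k: "k \<in> \<Delta>" and r: "\<And>i. i < k \<Longrightarrow> r i < n" and nz: "minor k r s \<noteq> 0"
  shows "minor k r h \<noteq> 0"
proof
  assume zero: "minor k r h = 0"
  have kn: "k \<le> n" using k levels by auto
  have hm: "h \<in> carrier_mat n n" using h(1) by simp
  have "minor k r s = 0"
  proof (rule dense_vanish[OF h s])
    show "poly_fun n (minor k r)" using poly_fun_minor[of k n r, OF kn r] .
    fix t q assume t: "t \<in> torus n" and q: "q \<in> Q"
    have "t * h \<in> carrier_mat n n" using mult_SL[OF torus_carrier[OF t] h(1)] by simp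
    then show "minor k r (t * h * q) = 0"
      using minor_mult[OF _ q k kn, of "t * h" r] minor_torus_mult[OF t hm kn, of r] r zero by simp
  qed
  then show False using nz by simp
qed

text \<open>
  An element of the torus that fixes the flag of \<open>h\<close> multiplies all its minors of level \<open>k\<close> by the same factor.
\<close>
lemma weight_in_lattice:
  assumes h: "h \<in> carrier (SL n)" "pt h \<in> dense X" and k: "k \<in> \<Delta>"
    and r: "\<And>i. i < k \<Longrightarrow> r i < n" "minor k r h \<noteq> 0" and s: "\<And>i. i < k \<Longrightarrow> s i < n" "minor k s h \<noteq> 0"
  shows "torus_char n (weight_exp k r s) \<in> char_lattice n Q X"
proof -
  have kn: "k \<le> n" using k levels by auto
  have hm: "h \<in> carrier_mat n n" using h(1) by simp
  have "torus_char n (weight_exp k r s) t = 1"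
    if t: "t \<in> torus n" and fixed: "\<forall>x\<in>dense X. t <#\<^bsub>SL n\<^esub> x = x" for t
  proof -
    have th: "t * h \<in> carrier (SL n)" using mult_SL[OF torus_carrier[OF t] h(1)] .
    have "pt (t * h) = pt h" using fixed h(2) torus_pt[OF t h(1)] by simp
    then obtain c where c: "c \<noteq> 0" "\<And>r. (\<And>i. i < k \<Longrightarrow> r i < n) \<Longrightarrow> minor k r (t * h) = minor k r h * c"
      using minor_pt[OF th h(1) _ k] by blast
    have "(\<Prod>i<k. t $$ (r i, r i)) = c"
      using c(2)[of r, OF r(1)] minor_torus_mult[OF t hm kn, of r, OF r(1)] r(2) by simp
    moreover have "(\<Prod>i<k. t $$ (s i, s i)) = c"
      using c(2)[of s, OF s(1)] minor_torus_mult[OF t hm kn, of s, OF s(1)] s(2) by simp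
    ultimately show ?thesis
      using torus_char_weight_exp[of t n k r s, OF t r(1) s(1)] c(1) by (simp add: prod_dividef)
  qed
  then show ?thesis by (auto simp: char_lattice_def characters_eq)
qed

text \<open>
  A fixed point lies in the chart of some cone of the fan, hence in the chart of a maximal cone; the
  explicit description of the cone of such a chart gives uniqueness.
\<close>
lemma fixed_point_cone_eq:
  assumes u: "u permutes {1..n}" and fan: "is_fan_of n Q X \<Sigma>"
    and g: "g \<in> carrier (SL n)" "pt g \<in> dense X" and mem: "fixed_point n Q u \<in> X"
  shows "fixed_point_cone n Q X \<Sigma> (fixed_point n Q u) =
    {\<nu> \<in> N_real (char_lattice n Q X). \<forall>k\<in>\<Delta>. \<forall>r. (\<forall>i<k. r i < n) \<longrightarrow> minor k r g \<noteq> 0 \<longrightarrow>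
      0 \<le> \<nu> (torus_char n (weight_exp k r (row_perm u)))}" (is "_ = ?K")
proof -
  obtain U where f: "is_fan (char_lattice n Q X) \<Sigma>"
    and U: "\<forall>\<sigma>\<in>\<Sigma>. toric_chart n Q X \<sigma> (U \<sigma>)" "(\<Union>\<sigma>\<in>\<Sigma>. U \<sigma>) = X"
      "\<forall>\<sigma>\<in>\<Sigma>. \<forall>\<tau>\<in>\<Sigma>. U \<sigma> \<inter> U \<tau> = U (\<sigma> \<inter> \<tau>)"
    using fan unfolding is_fan_of_def by blast
  have unique: "\<sigma> = ?K" if "\<sigma> \<in> \<Sigma>" "toric_chart n Q X \<sigma> V" "fixed_point n Q u \<in> V" for \<sigma> V
  proof -
    interpret flag_chart n \<Delta> X \<sigma> V g u "row_perm u"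
      using that g u by unfold_locales auto
    have "strongly_convex_rational_cone (char_lattice n Q X) \<sigma>"
      using f that(1) unfolding is_fan_def by blast
    then show ?thesis by (rule chart_cone_eq)
  qed
  obtain \<sigma>0 where \<sigma>0: "\<sigma>0 \<in> \<Sigma>" "fixed_point n Q u \<in> U \<sigma>0" using mem U(2) by blast
  have "finite \<Sigma>" using f unfolding is_fan_def by blast
  from finite_has_maximal2[OF this \<sigma>0(1)]
  obtain \<tau> where \<tau>: "\<tau> \<in> \<Sigma>" "\<sigma>0 \<subseteq> \<tau>" "\<forall>\<rho>\<in>\<Sigma>. \<tau> \<subseteq> \<rho> \<longrightarrow> \<tau> = \<rho>" by blast
  have "U \<sigma>0 \<inter> U \<tau> = U (\<sigma>0 \<inter> \<tau>)" using U(3) \<sigma>0(1) \<tau>(1) by blast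
  also have "\<sigma>0 \<inter> \<tau> = \<sigma>0" using \<tau>(2) by blast
  finally have "fixed_point n Q u \<in> U \<tau>" using \<sigma>0(2) by blast
  then have \<tau>U: "toric_chart n Q X \<tau> (U \<tau>)" "fixed_point n Q u \<in> U \<tau>" using U(1) \<tau>(1) by auto
  have \<tau>K: "\<tau> = ?K" by (rule unique[OF \<tau>(1) \<tau>U])
  show ?thesis
    unfolding fixed_point_cone_def
  proof (rule the_equality)
    show "?K \<in> \<Sigma> \<and> (\<forall>\<rho>\<in>\<Sigma>. ?K \<subseteq> \<rho> \<longrightarrow> \<rho> = ?K) \<and> (\<exists>V. toric_chart n Q X ?K V \<and> fixed_point n Q u \<in> V)"
      using \<tau> \<tau>U unfolding \<tau>K[symmetric] by blast
  qed (use unique in blast)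
qed

end

text \<open>
  Rows are sorted by weight; among rows of equal weight those in \<open>V\<close> come first, and the remaining ties are
  broken by the index.
\<close>
lemma weight_order_exists:
  fixes a :: "nat \<Rightarrow> real" and n :: nat
  obtains rk :: "nat \<Rightarrow> nat" where "inj_on rk {..<n}" "\<And>i. i < n \<Longrightarrow> rk i < n"
    "\<And>i j. i < n \<Longrightarrow> j < n \<Longrightarrow> rk i \<le> rk j \<Longrightarrow> a i \<le> a j"
    "\<And>i j. i < n \<Longrightarrow> j < n \<Longrightarrow> rk i \<le> rk j \<Longrightarrow> a i = a j \<Longrightarrow> j \<in> V \<Longrightarrow> i \<in> V"
proof -
  define less where "less i j \<longleftrightarrow> a i < a j \<or> (a i = a j \<and> ((i \<in> V \<and> j \<notin> V) \<or> ((i \<in> V \<longleftrightarrow> j \<in> V) \<and> i < j)))" for i j :: nat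
  have irrefl: "\<not> less i i" for i by (simp add: less_def)
  have trans: "less i k" if "less i j" "less j k" for i j k using that by (auto simp: less_def)
  have total: "less i j \<or> i = j \<or> less j i" for i j by (auto simp: less_def)
  define rk where "rk i = card {j. j < n \<and> less j i}" for i
  have mono: "rk i < rk j" if "less i j" "i < n" for i j
    unfolding rk_def
  proof (rule psubset_card_mono)
    show "{k. k < n \<and> less k i} \<subset> {k. k < n \<and> less k j}" using that trans irrefl by blast
  qed simp
  have le: "i = j \<or> less i j" if "i < n" "j < n" "rk i \<le> rk j" for i j
    using total[of i j] mono[of j i] that by auto
  show ?thesis
  proof (rule that[of rk])
    show "inj_on rk {..<n}"
      using le irrefl trans by (intro inj_onI) (metis lessThan_iff order_refl)
    show "rk i < n" if "i < n" for i
    proof -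
      have "{j. j < n \<and> less j i} \<subset> {..<n}" using irrefl that by auto
      then have "rk i < card {..<n}" unfolding rk_def by (intro psubset_card_mono) auto
      then show ?thesis by simp
    qed
    show "a i \<le> a j" if "i < n" "j < n" "rk i \<le> rk j" for i j using le[OF that] by (auto simp: less_def)
    show "i \<in> V" if "i < n" "j < n" "rk i \<le> rk j" "a i = a j" "j \<in> V" for i j
      using le[OF that(1-3)] that(4,5) by (auto simp: less_def)
  qed
qed

lemma weight_exp_image_cong:
  assumes "inj_on x {..<k}" "inj_on y {..<k}" "x ` {..<k} = y ` {..<k}"
  shows "weight_exp k r x = weight_exp k r y"
proof
  fix i
  have single: "(\<Sum>a<k. of_bool (x a = i)) = (of_bool (i \<in> x ` {..<k}) :: int)" if "inj_on x {..<k}"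
    for x :: "nat \<Rightarrow> nat"
  proof -
    have "(\<Sum>a<k. of_bool (x a = i)) = (\<Sum>b\<in>x ` {..<k}. of_bool (b = i) :: int)"
      using sum.reindex[OF that, of "\<lambda>b. of_bool (b = i) :: int"] by (simp only: comp_def)
    also have "\<dots> = (\<Sum>b\<in>x ` {..<k}. if b = i then 1 else 0)" by (intro sum.cong) auto
    finally show ?thesis by (simp add: sum.delta)
  qed
  have "(\<Sum>a<k. of_bool (x a = i)) = (\<Sum>a<k. of_bool (y a = i) :: int)"
    unfolding single[OF assms(1)] single[OF assms(2)] assms(3) ..
  then show "weight_exp k r x i = weight_exp k r y i" by (simp add: weight_exp_def sum_subtractf)
qed

lemma row_perm_image:
  assumes "w permutes {1..n}"
  shows "w ` {1..d} = Suc ` row_perm w ` {..<d}"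
proof -
  have "w ` {1..d} = w ` Suc ` {..<d}" by (simp add: lessThan_atLeast0 image_Suc_atLeastLessThan atLeastLessThanSuc_atLeastAtMost)
  then show ?thesis by (simp add: image_comp Suc_row_perm[OF assms] comp_def)
qed

section \<open>The maximal cones of toric Schubert varieties\<close>

theorem proposition3p7:
  fixes n d :: nat and w v :: "nat \<Rightarrow> nat"
    and \<Sigma> \<Sigma>B :: "((complex mat \<Rightarrow> complex) \<Rightarrow> real) set set"
  assumes "1 \<le> d" and "d \<le> n - 1"
    and "w \<in> min_coset_reps n d"
    and "toric n (parabolic n d) (schubert_variety n (parabolic n d) w)"
    and "is_fan_of n (parabolic n d) (schubert_variety n (parabolic n d) w) \<Sigma>"
    and "is_fan_of n (borel n) (schubert_variety n (borel n) w) \<Sigma>B"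
    and "v \<in> min_coset_reps n d" and "bruhat_le n v w"
  shows "fixed_point_cone n (parabolic n d) (schubert_variety n (parabolic n d) w) \<Sigma>
             (fixed_point n (parabolic n d) v) =
         (\<Union>u\<in>coset_below n d w v.
            fixed_point_cone n (borel n) (schubert_variety n (borel n) w) \<Sigma>B
              (fixed_point n (borel n) u))"
proof -
  have n: "0 < n" "d \<le> n" "d < n" using assms(1,2) by auto
  interpret P: flag_variety n "{d}" using n by unfold_locales auto
  interpret B: flag_variety n "{1..<n}" using n by unfold_locales auto
  let ?XP = "schubert_variety n P.Q w" and ?XB = "schubert_variety n B.Q w"
  have w: "w permutes {1..n}" and v: "v permutes {1..n}"
    using min_coset_reps_permutes assms(3,7) by blast+
  have "dense_orbit n P.Q ?XP \<noteq> {}" using assms(4) by (simp add: toric_def parabolic_eq)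
  then obtain h where h: "h \<in> carrier (SL n)" "P.pt h \<in> P.dense ?XP" "B.pt h \<in> B.dense ?XB"
    and lattices: "char_lattice n P.Q ?XP = char_lattice n B.Q ?XB"
    using dense_orbit_lift[OF assms(1-3)] by metis
  have hm: "h \<in> carrier_mat n n" using h(1) by simp
  define M where "M = char_lattice n B.Q ?XB"
  define K where "K \<Delta> u = {\<nu> \<in> N_real M. \<forall>k\<in>\<Delta>. \<forall>r. (\<forall>i<k. r i < n) \<longrightarrow> minor k r h \<noteq> 0 \<longrightarrow>
      0 \<le> \<nu> (torus_char n (weight_exp k r (row_perm u)))}" for \<Delta> u
  have CP: "fixed_point_cone n P.Q ?XP \<Sigma> (fixed_point n P.Q v) = K {d} v"
    unfolding K_def M_def lattices[symmetric]
    by (rule P.fixed_point_cone_eq[OF v _ h(1,2)])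
       (use assms(5) P.bruhat_le_fixed_point[OF w assms(8)] in \<open>simp_all add: parabolic_eq\<close>)
  have below: "u \<in> coset_below n d w v \<longleftrightarrow> u permutes {1..n} \<and> bruhat_le n u w \<and> u ` {1..d} = v ` {1..d}" for u
    using coset_parabolic_eq_iff[OF n(2) _ v, of u] by (auto simp: coset_below_def sym_group_carrier)
  have CB: "fixed_point_cone n B.Q ?XB \<Sigma>B (fixed_point n B.Q u) = K {1..<n} u" if "bruhat_le n u w" for u
    unfolding K_def M_def
    by (rule B.fixed_point_cone_eq[OF _ _ h(1,3)])
       (use assms(6) B.bruhat_le_fixed_point[OF w that] in \<open>simp_all add: borel_eq\<close>)
  have less: "row_perm u i < n" if "u permutes {1..n}" "i < n" for u i
    using permutes_in_image[OF row_perm_permutes[OF that(1)], of i] that(2) by simp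
  have inj: "inj_on (row_perm u) A" if "u permutes {1..n}" for u A
    using permutes_inj[OF row_perm_permutes[OF that]] by (rule inj_on_subset) simp
  have same_rows: "u ` {1..d} = v ` {1..d} \<longleftrightarrow> row_perm u ` {..<d} = row_perm v ` {..<d}"
    if u: "u permutes {1..n}" for u
    unfolding row_perm_image[OF u] row_perm_image[OF v] by (simp add: inj_image_eq_iff)
  have sub: "K {1..<n} u \<subseteq> K {d} v" if u: "u permutes {1..n}" "u ` {1..d} = v ` {1..d}" for u
  proof -
    have eq: "weight_exp d r (row_perm u) = weight_exp d r (row_perm v)" for r
      using weight_exp_image_cong[OF inj[OF u(1)] inj[OF v]] same_rows[OF u(1)] u(2) by simp
    have d: "d \<in> {1..<n}" using assms(1) n by simp
    show ?thesis
    proof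
      fix \<nu> assume "\<nu> \<in> K {1..<n} u"
      then have N: "\<nu> \<in> N_real M" and pos: "\<forall>k\<in>{1..<n}. \<forall>r. (\<forall>i<k. r i < n) \<longrightarrow> minor k r h \<noteq> 0 \<longrightarrow>
          0 \<le> \<nu> (torus_char n (weight_exp k r (row_perm u)))"
        unfolding K_def by simp_all
      show "\<nu> \<in> K {d} v" unfolding K_def using N bspec[OF pos d] eq by simp
    qed
  qed
  have cover: "\<exists>u\<in>coset_below n d w v. \<nu> \<in> K {1..<n} u" if \<nu>: "\<nu> \<in> K {d} v" for \<nu>
  proof -
    let ?S = "{t \<in> torus n. \<forall>x\<in>B.dense ?XB. t <#\<^bsub>SL n\<^esub> x = x}"
    have M: "M = annihilator n ?S" unfolding M_def by (rule B.char_lattice_eq_annihilator)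
    have \<nu>N: "\<nu> \<in> N_real M" using \<nu> by (simp add: K_def)
    obtain a where a: "\<And>k r x. (\<And>b. b < k \<Longrightarrow> r b < n) \<Longrightarrow> (\<And>b. b < k \<Longrightarrow> x b < n) \<Longrightarrow>
        torus_char n (weight_exp k r x) \<in> M \<Longrightarrow>
        \<nu> (torus_char n (weight_exp k r x)) = (\<Sum>b<k. a (r b)) - (\<Sum>b<k. a (x b))"
      using N_real_weights[of ?S n \<nu>] \<nu>N unfolding M by auto
    let ?V = "row_perm v ` {..<d}"
    obtain rk where rk: "inj_on rk {..<n}" "\<And>i. i < n \<Longrightarrow> rk i < n"
      "\<And>i j. i < n \<Longrightarrow> j < n \<Longrightarrow> rk i \<le> rk j \<Longrightarrow> a i \<le> a j"
      "\<And>i j. i < n \<Longrightarrow> j < n \<Longrightarrow> rk i \<le> rk j \<Longrightarrow> a i = a j \<Longrightarrow> j \<in> ?V \<Longrightarrow> i \<in> ?V"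
      using weight_order_exists[of n a ?V] by blast
    obtain q x where q: "q \<in> borel n" and x: "x permutes {..<n}"
      and lead: "\<And>j. j < n \<Longrightarrow> (h * q) $$ (x j, j) \<noteq> 0"
        "\<And>i j. i < n \<Longrightarrow> j < n \<Longrightarrow> (h * q) $$ (i, j) \<noteq> 0 \<Longrightarrow> rk (x j) \<le> rk i"
      using column_echelon_exists[of h n rk, OF h(1) rk(1,2)] by blast
    obtain u where u: "u permutes {1..n}" "row_perm u = x" using row_perm_surj[OF x] .
    define h' where "h' = h * q"
    have qB: "q \<in> B.Q" and qP: "q \<in> P.Q" using B.borel_subset P.borel_subset q by blast+
    have h': "h' \<in> carrier (SL n)" "B.pt h' = B.pt h" "P.pt h' = P.pt h"
      unfolding h'_def using B.mult_SL[OF h(1) B.Q_carrier[OF qB]] B.pt_mult[OF h(1) qB] P.pt_mult[OF h(1) qP]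
      by blast+
    note lead' = lead[folded h'_def]
    have xlt: "x i < n" if "i < n" for i using permutes_in_image[OF x, of i] that by simp
    have le_u: "bruhat_le n u w"
    proof (rule fixed_point_imp_bruhat_le[OF n(1) w u(1)])
      show "fixed_point n B.Q u \<in> ?XB"
        by (rule B.initial_fixed_point[OF w h'(1) _ u(1) rk(1)]) (use h(3) h'(2) lead' u(2) in simp_all)
    qed
    have minor_iff: "minor k r h' \<noteq> 0 \<longleftrightarrow> minor k r h \<noteq> 0"
      if k: "k \<in> {1..<n}" and r: "\<And>i. i < k \<Longrightarrow> r i < n" for k r
    proof -
      obtain c where "c \<noteq> 0" "\<And>r. (\<And>i. i < k \<Longrightarrow> r i < n) \<Longrightarrow> minor k r h' = minor k r h * c"
        using B.minor_pt[OF h'(1) h(1) h'(2) k] by blast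
      then show ?thesis using r by simp
    qed
    \<comment> \<open>the leading rows precede, one by one, the rows of any nonzero minor\<close>
    have optimal: "\<exists>\<pi>. \<pi> permutes {..<k} \<and> (\<forall>i<k. rk (x (\<pi> i)) \<le> rk (r i))"
      if k: "k \<in> {1..<n}" and r: "\<And>i. i < k \<Longrightarrow> r i < n" "minor k r h \<noteq> 0" for k r
    proof -
      have "minor k r h' \<noteq> 0" using minor_iff[OF k r(1)] r(2) by simp
      then obtain \<pi> where \<pi>: "\<pi> permutes {..<k}" "\<And>i. i < k \<Longrightarrow> h' $$ (r i, \<pi> i) \<noteq> 0"
        using minor_transversal by blast
      have "rk (x (\<pi> i)) \<le> rk (r i)" if "i < k" for i
        using lead'(2)[OF r(1)[OF that] _ \<pi>(2)[OF that]] permutes_in_image[OF \<pi>(1), of i] that k by simp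
      then show ?thesis using \<pi>(1) by blast
    qed
    have x_minor: "minor k x h \<noteq> 0" if k: "k \<in> {1..<n}" for k
    proof -
      have "minor k x h' = (\<Prod>i<k. h' $$ (x i, i))"
      proof (rule minor_unique_transversal)
        fix \<pi> assume \<pi>: "\<pi> permutes {..<k}" and nz: "\<And>i. i < k \<Longrightarrow> h' $$ (x i, \<pi> i) \<noteq> 0"
        show "\<pi> = id"
        proof (rule permutes_le_imp_id[OF _ \<pi>, of "\<lambda>i. rk (x i)"])
          fix i assume "i \<in> {..<k}"
          then show "rk (x (\<pi> i)) \<le> rk (x i)"
            using lead'(2)[of "x i" "\<pi> i"] nz[of i] xlt[of i] permutes_in_image[OF \<pi>, of i] k by simp
        next
          show "inj_on (\<lambda>i. rk (x i)) {..<k}"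
          proof (rule inj_onI)
            fix i j assume ij: "i \<in> {..<k}" "j \<in> {..<k}" "rk (x i) = rk (x j)"
            then have "x i = x j" using inj_onD[OF rk(1)] xlt k by simp
            then show "i = j" using permutes_inj[OF x] by (auto simp: inj_eq)
          qed
        qed simp
      qed
      moreover have "(\<Prod>i<k. h' $$ (x i, i)) \<noteq> 0" using lead'(1) k by simp
      ultimately show ?thesis using minor_iff[OF k, of x] xlt k by simp
    qed
    have sums: "(\<Sum>i<k. a (x i)) \<le> (\<Sum>i<k. a (r i))"
      if k: "k \<in> {1..<n}" and r: "\<And>i. i < k \<Longrightarrow> r i < n" "minor k r h \<noteq> 0" for k r
    proof -
      obtain \<pi> where \<pi>: "\<pi> permutes {..<k}" "\<forall>i<k. rk (x (\<pi> i)) \<le> rk (r i)" using optimal[OF k r] by blast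
      have "(\<Sum>i<k. a (x (\<pi> i))) \<le> (\<Sum>i<k. a (r i))"
      proof (rule sum_mono)
        fix i assume "i \<in> {..<k}"
        then have i: "i < k" "\<pi> i < n" using permutes_in_image[OF \<pi>(1), of i] k by auto
        show "a (x (\<pi> i)) \<le> a (r i)" using rk(3)[OF xlt[OF i(2)] r(1)[OF i(1)]] \<pi>(2) i(1) by blast
      qed
      then show ?thesis using sum.permute[OF \<pi>(1), of "\<lambda>i. a (x i)"] by (simp add: comp_def)
    qed
    have \<nu>u: "\<nu> \<in> K {1..<n} u"
      unfolding K_def u(2)
    proof (intro CollectI conjI \<nu>N ballI allI impI)
      fix k r assume k: "k \<in> {1..<n}" and r: "\<forall>i<k. r i < n" "minor k r h \<noteq> 0"
      have xk: "x i < n" if "i < k" for i using xlt k that by simp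
      have "torus_char n (weight_exp k r x) \<in> M"
        unfolding M_def by (rule B.weight_in_lattice[OF h(1,3) k]) (use r xk x_minor[OF k] in auto)
      then have "\<nu> (torus_char n (weight_exp k r x)) = (\<Sum>b<k. a (r b)) - (\<Sum>b<k. a (x b))"
        using a[of k r x] r(1) xk by blast
      then show "0 \<le> \<nu> (torus_char n (weight_exp k r x))" using sums[OF k] r by simp
    qed
    have d: "d \<in> {1..<n}" using assms(1) n by simp
    let ?y = "row_perm v"
    have ylt: "?y i < n" if "i < d" for i using less[OF v] that n by simp
    obtain A where A: "A \<in> weyl_coset n v" using weyl_coset_nonempty[OF v n(1)] .
    have AS: "A \<in> carrier (SL n)" using A by (simp add: weyl_coset_def)
    have "P.pt A \<in> ?XP"
      using P.bruhat_le_fixed_point[OF w assms(8)] P.fixed_point_eq_pt[OF v A] by simp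
    then have y_minor: "minor d ?y h \<noteq> 0"
      using P.dense_minor_nonzero[OF h(1,2) AS _ _ ylt minor_weyl_nonzero[OF v A n(2)]] by simp
    obtain \<pi> where \<pi>: "\<pi> permutes {..<d}" "\<forall>i<d. rk (x (\<pi> i)) \<le> rk (?y i)"
      using optimal[of d ?y, OF d ylt y_minor] by blast
    have \<pi>d: "\<pi> i < d" if "i < d" for i using permutes_in_image[OF \<pi>(1), of i] that by simp
    have xd: "x i < n" if "i < d" for i using xlt n that by simp
    have le: "a (x (\<pi> i)) \<le> a (?y i)" if "i < d" for i
      using rk(3)[OF xd[OF \<pi>d[OF that]] ylt[OF that]] \<pi>(2) that by blast
    have "(\<Sum>i<d. a (?y i)) \<le> (\<Sum>i<d. a (x i))"
    proof -
      have "torus_char n (weight_exp d x ?y) \<in> M"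
        unfolding M_def by (rule B.weight_in_lattice[OF h(1,3) d xd x_minor[OF d] ylt y_minor])
      then have "\<nu> (torus_char n (weight_exp d x ?y)) = (\<Sum>b<d. a (x b)) - (\<Sum>b<d. a (?y b))"
        using a[of d x ?y] xd ylt by blast
      moreover have "0 \<le> \<nu> (torus_char n (weight_exp d x ?y))"
        using \<nu> x_minor[OF d] xd unfolding K_def by blast
      ultimately show ?thesis by simp
    qed
    also have "\<dots> = (\<Sum>i<d. a (x (\<pi> i)))"
      using sum.permute[OF \<pi>(1), of "\<lambda>i. a (x i)"] by (simp add: comp_def)
    finally have total: "(\<Sum>i<d. a (?y i)) \<le> (\<Sum>i<d. a (x (\<pi> i)))" .
    have eq: "a (x (\<pi> i)) = a (?y i)" if i: "i < d" for i
    proof (rule ccontr)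
      assume "a (x (\<pi> i)) \<noteq> a (?y i)"
      then have "a (x (\<pi> i)) < a (?y i)" using le[OF i] by simp
      then have "(\<Sum>i<d. a (x (\<pi> i))) < (\<Sum>i<d. a (?y i))"
        using le i by (intro sum_strict_mono_ex1) auto
      then show False using total by simp
    qed
    \<comment> \<open>equal weights: a row that precedes a row of \<open>v\<close> belongs to \<open>v\<close> by the choice among ties\<close>
    have "x (\<pi> i) \<in> ?V" if i: "i < d" for i
      using rk(4)[OF xd[OF \<pi>d[OF i]] ylt[OF i]] \<pi>(2) eq[OF i] i by blast
    then have "(x \<circ> \<pi>) ` {..<d} \<subseteq> ?V" by auto
    then have "x ` {..<d} \<subseteq> ?V" using permutes_image[OF \<pi>(1)] by (metis image_comp)
    moreover have "card (x ` {..<d}) = card ?V"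
      using card_image[OF inj[OF u(1), of "{..<d}"]] card_image[OF inj[OF v, of "{..<d}"]] u(2) by simp
    ultimately have "x ` {..<d} = ?V" by (intro card_subset_eq) auto
    then have "u ` {1..d} = v ` {1..d}" using same_rows[OF u(1)] u(2) by simp
    then have "u \<in> coset_below n d w v" using below u(1) le_u by blast
    then show ?thesis using \<nu>u by blast
  qed
  have "K {d} v = (\<Union>u\<in>coset_below n d w v. K {1..<n} u)"
  proof (rule subset_antisym)
    show "K {d} v \<subseteq> (\<Union>u\<in>coset_below n d w v. K {1..<n} u)"
    proof
      fix \<nu> assume "\<nu> \<in> K {d} v"
      from cover[OF this] show "\<nu> \<in> (\<Union>u\<in>coset_below n d w v. K {1..<n} u)" by (simp only: UN_iff)
    qed
    show "(\<Union>u\<in>coset_below n d w v. K {1..<n} u) \<subseteq> K {d} v"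
    proof (rule UN_least)
      fix u assume "u \<in> coset_below n d w v"
      then show "K {1..<n} u \<subseteq> K {d} v" using sub[of u] below[of u] by simp
    qed
  qed
  also have "\<dots> = (\<Union>u\<in>coset_below n d w v. fixed_point_cone n B.Q ?XB \<Sigma>B (fixed_point n B.Q u))"
  proof (rule SUP_cong[OF refl])
    fix u assume "u \<in> coset_below n d w v"
    then show "K {1..<n} u = fixed_point_cone n B.Q ?XB \<Sigma>B (fixed_point n B.Q u)"
      using CB[of u] below[of u] by simp
  qed
  finally show ?thesis unfolding parabolic_eq borel_eq CP .
qed

end
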